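(* For every $d\ge1$ there exists a constant $C_d$ depending on $d$ only such that the following holds. Let $n\ge1$ and let $X_1,\dots,X_n$ be independent random vectors in $\mathbb{R}^d$ having log-concave densities, with mean zero and unit covariance matrix $I_d$. Let $\Delta_n=\operatorname{ess\,sup}_{x\in\mathbb{R}^d}|p_n(x)-\varphi(x)|$, where $p_n$ is the density of $Z_n=(X_1+\dots+X_n)/\sqrt n$ and $\varphi(x)=(2\pi)^{-d/2}e^{-|x|^2/2}$. Then $$\Delta_n\le\frac{C_d}{\sqrt n}.$$ If additionally the distributions of all the $X_k$ are symmetric, then $$\Delta_n\le\frac{C_d}{n}.$$
   Context: A density $p$ on $\mathbb{R}^d$ is log-concave if $p((1-\lambda)x+\lambda y)\ge p(x)^{1-\lambda}p(y)^{\lambda}$ for all $x,y\in\mathbb{R}^d$ and $\lambda\in(0,1)$. The distribution of $X$ is symmetric if $-X$ has the same distribution as $X$. For $n\ge2$ the essential supremum equals the supremum for the continuous version of $p_n$. The $X_k$ need not be identically distributed. *)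

theory Defs
  imports "HOL-Probability.Probability"
begin

text \<open>Since \<open>0 powr a = 0\<close>, the inequality is trivial wherever \<open>p x = 0\<close> or \<open>p y = 0\<close>, as it
  should be.\<close>

definition log_concave :: "('v::real_vector \<Rightarrow> real) \<Rightarrow> bool" where
  "log_concave p \<longleftrightarrow> (\<forall>x. 0 \<le> p x) \<and>
     (\<forall>x y. \<forall>t\<in>{0<..<1}.
        p ((1 - t) *\<^sub>R x + t *\<^sub>R y) \<ge> p x powr (1 - t) * p y powr t)"

definition has_log_concave_density :: "'a measure \<Rightarrow> ('a \<Rightarrow> 'v::euclidean_space) \<Rightarrow> bool" where
  "has_log_concave_density M X \<longleftrightarrow>
     (\<exists>p. log_concave p \<and> distributed M lborel X (\<lambda>x. ennreal (p x)))"

definition covariance_matrix :: "'a measure \<Rightarrow> ('a \<Rightarrow> real ^ 'd) \<Rightarrow> real ^ 'd ^ 'd" where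
  "covariance_matrix M X =
     (\<chi> i j. \<integral>\<omega>. (X \<omega> - (\<integral>\<omega>'. X \<omega>' \<partial>M)) $ i * (X \<omega> - (\<integral>\<omega>'. X \<omega>' \<partial>M)) $ j \<partial>M)"

definition symmetric_distribution :: "'a measure \<Rightarrow> ('a \<Rightarrow> 'v::euclidean_space) \<Rightarrow> bool" where
  "symmetric_distribution M X \<longleftrightarrow> distr M borel (\<lambda>\<omega>. - X \<omega>) = distr M borel X"

definition std_gaussian_density :: "real ^ 'd \<Rightarrow> real" where
  "std_gaussian_density x =
     (2 * pi) powr (- real CARD('d) / 2) * exp (- (norm x)\<^sup>2 / 2)"

definition normalized_sum :: "nat \<Rightarrow> (nat \<Rightarrow> 'a \<Rightarrow> 'v::real_vector) \<Rightarrow> 'a \<Rightarrow> 'v" where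
  "normalized_sum n X \<omega> = (1 / sqrt (real n)) *\<^sub>R (\<Sum>k=1..n. X k \<omega>)"

text \<open>No integrability assumption is needed next to the conditions on mean and covariance:
  a Bochner integral that does not exist is \<open>0\<close>, so the unit diagonal of the covariance matrix
  already forces finite second moments.\<close>

definition isotropic_log_concave_vectors ::
    "'a measure \<Rightarrow> nat \<Rightarrow> (nat \<Rightarrow> 'a \<Rightarrow> real ^ 'd) \<Rightarrow> bool" where
  "isotropic_log_concave_vectors M n X \<longleftrightarrow>
     prob_space M \<and>
     prob_space.indep_vars M (\<lambda>_. borel) X {1..n} \<and>
     (\<forall>k\<in>{1..n}. has_log_concave_density M (X k) \<and>
        (\<integral>\<omega>. X k \<omega> \<partial>M) = 0 \<and> covariance_matrix M (X k) = mat 1)"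

definition density_distance :: "(real ^ 'd \<Rightarrow> real) \<Rightarrow> ereal" where
  "density_distance p = esssup lborel (\<lambda>x. ereal \<bar>p x - std_gaussian_density x\<bar>)"

text \<open>\<open>C\<close> is a valid constant for sample spaces of type \<open>'a\<close> in dimension \<open>CARD('d)\<close>.
  A density of the sum is determined only up to null sets, and \<^const>\<open>density_distance\<close> does not
  depend on the version; hence \<open>p\<close> ranges over all versions with finite values.

  Pitfall: in \<open>\<exists>C. \<forall>(M :: 'a measure). \<dots>\<close> the constant could depend on the type \<open>'a\<close>, as
  types cannot be quantified inside a formula. That the constant depends on the dimension only
  is therefore expressed via a fixed sample type: some \<open>C\<close> is valid for sample spaces of
  type \<open>nat \<Rightarrow> real ^ 'd\<close> (which carries every joint law of a sequence of random vectors),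
  and every such \<open>C\<close> is valid for sample spaces of an arbitrary type \<open>'a\<close>.\<close>

definition local_limit_constant :: "'a itself \<Rightarrow> 'd::finite itself \<Rightarrow> real \<Rightarrow> bool" where
  "local_limit_constant (_ :: 'a itself) (_ :: 'd itself) C \<longleftrightarrow>
     (\<forall>n\<ge>1. \<forall>(M :: 'a measure) (X :: nat \<Rightarrow> 'a \<Rightarrow> real ^ 'd) (p :: real ^ 'd \<Rightarrow> real).
        isotropic_log_concave_vectors M n X \<and>
        (\<forall>x. 0 \<le> p x) \<and> distributed M lborel (normalized_sum n X) (\<lambda>x. ennreal (p x)) \<longrightarrow>
          density_distance p \<le> ereal (C / sqrt (real n)) \<and>
          ((\<forall>k\<in>{1..n}. symmetric_distribution M (X k)) \<longrightarrow>
             density_distance p \<le> ereal (C / real n)))"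

end

theory Submission
  imports Defs
begin

text \<open>An isotropic log-concave density \<open>p\<close> on \<open>\<real>\<^sup>d\<close> satisfies \<open>p x \<le> A exp (- a |x|)\<close> with constants
  depending on \<open>d\<close> only: it is bounded below at some point \<open>z\<close> near the mean, its level set at height
  \<open>4\<^sup>-\<^sup>(\<^sup>d\<^sup>+\<^sup>3\<^sup>) p z\<close> has volume bounded below because the variance is 1 in every direction, and averaging
  this set with a point \<open>x\<close> shows that \<open>p x\<close> cannot be large. Hence the fourth moments are bounded, and
  the characteristic functions of the \<open>X\<^sub>k\<close> are uniformly close to the Gaussian one near \<open>0\<close>, to
  third order in general and to fourth order under symmetry, and are uniformly bounded away from \<open>1\<close>
  in modulus elsewhere. Fourier inversion, applied after convolution with a small Gaussian so that no
  integrability of characteristic functions is needed, turns the resulting \<open>L\<^sup>1\<close> bound on their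
  difference into a bound on the difference of the densities.\<close>


section \<open>Linear images and the volume of convex sets\<close>

text \<open>All constants may depend on the dimension only, so every bound on a single law is
  quantitative. Boundedness of the density enters twice through Plancherel's inequality: it keeps
  characteristic functions away from modulus 1, and it makes up for their missing integrability. A
  bounded density gives only square integrability, so two of the n factors of the product are kept
  and the other n - 2 contribute \<delta>^(n-2); rescaling by sqrt n costs n^(d/2), which this
  geometric factor absorbs. As two factors are needed, n = 1 is treated apart. The level 4^-(d+3) is
  q^2 for q = 2^-(d+3): the midpoint substitution costs 2^d, a quadratic weight costs 4, and a last
  factor 2 allows absorption. Since densities are given only up to null sets, the final comparison
  avoids point values: a bound on smoothed densities, uniform in the smoothing, passes to integrals
  over compact sets and then, by inner regularity, to almost every point.\<close>

lemma nn_integral_lborel_affine: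
  fixes f :: "'a::euclidean_space \<Rightarrow> ennreal"
  assumes [measurable]: "f \<in> borel_measurable borel" and c: "c \<noteq> 0"
  shows "(\<integral>\<^sup>+x. f x \<partial>lborel) = ennreal (\<bar>c\<bar> ^ DIM('a)) * (\<integral>\<^sup>+x. f (t + c *\<^sub>R x) \<partial>lborel)"
  by (subst lborel_affine[OF c, of t])
     (simp add: nn_integral_density nn_integral_distr nn_integral_cmult)

lemma has_bochner_integral_lborel_affine:
  fixes f :: "'a::euclidean_space \<Rightarrow> 'b::{banach, second_countable_topology}"
  assumes f: "has_bochner_integral lborel f I" and c: "c \<noteq> 0"
  shows "has_bochner_integral lborel (\<lambda>x. f (t + c *\<^sub>R x)) (I /\<^sub>R \<bar>c\<bar> ^ DIM('a))"
proof -
  have [measurable]: "f \<in> borel_measurable borel"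
    using f by (auto simp: has_bochner_integral_iff dest: borel_measurable_integrable)
  let ?D = "density (distr lborel borel (\<lambda>x. t + c *\<^sub>R x)) (\<lambda>_. ennreal (\<bar>c\<bar> ^ DIM('a)))"
  have D: "lborel = ?D" using lborel_affine[OF c] .
  have "integrable ?D f" "integral\<^sup>L ?D f = I"
    using f D by (auto simp: has_bochner_integral_iff)
  moreover have "integrable ?D f \<longleftrightarrow> integrable lborel (\<lambda>x. f (t + c *\<^sub>R x))"
  proof -
    have "integrable ?D f \<longleftrightarrow> integrable lborel (\<lambda>x. \<bar>c\<bar> ^ DIM('a) *\<^sub>R f (t + c *\<^sub>R x))"
      by (subst integrable_density) (auto simp: integrable_distr_eq)
    also have "\<dots> \<longleftrightarrow> integrable lborel (\<lambda>x. f (t + c *\<^sub>R x))"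
    proof
      assume "integrable lborel (\<lambda>x. \<bar>c\<bar> ^ DIM('a) *\<^sub>R f (t + c *\<^sub>R x))"
      from integrable_scaleR_right[OF this, of "inverse (\<bar>c\<bar> ^ DIM('a))"]
      show "integrable lborel (\<lambda>x. f (t + c *\<^sub>R x))" using c by simp
    qed simp
    finally show ?thesis .
  qed
  moreover have "integral\<^sup>L ?D f = \<bar>c\<bar> ^ DIM('a) *\<^sub>R integral\<^sup>L lborel (\<lambda>x. f (t + c *\<^sub>R x))"
    by (subst integral_density) (auto simp: integral_distr)
  ultimately show ?thesis
    using c by (auto simp: has_bochner_integral_iff)
qed

text \<open>The determinant is linear in each row, so the rows of the identity matrix can be replaced one by
  one by elements of \<open>S\<close>, each time losing at most a factor \<open>c\<close>.\<close>

lemma exists_large_det: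
  fixes S :: "(real ^ 'd) set"
  assumes "\<And>\<theta>. \<exists>x\<in>S. c * norm \<theta> \<le> \<bar>\<theta> \<bullet> x\<bar>" and "0 \<le> c"
  shows "\<exists>V :: real ^ 'd ^ 'd. (\<forall>i. V $ i \<in> S) \<and> c ^ CARD('d) \<le> \<bar>det V\<bar>"
proof -
  have "\<exists>V :: real ^ 'd ^ 'd. (\<forall>i\<in>I. V $ i \<in> S) \<and> (\<forall>i. i \<notin> I \<longrightarrow> V $ i = axis i 1) \<and> c ^ card I \<le> \<bar>det V\<bar>"
    if "finite I" for I
    using that
  proof (induction I)
    case empty
    have "mat 1 $ i = (axis i 1 :: real ^ 'd)" for i
      by (simp add: mat_def axis_def vec_eq_iff)
    then show ?case
      by (intro exI[of _ "mat 1"]) simp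
  next
    case (insert j I)
    then obtain V :: "real ^ 'd ^ 'd" where V: "\<forall>i\<in>I. V $ i \<in> S" "\<forall>i. i \<notin> I \<longrightarrow> V $ i = axis i 1"
      "c ^ card I \<le> \<bar>det V\<bar>" by blast
    define g :: "real ^ 'd \<Rightarrow> real" where "g x = det (\<chi> i. if i = j then x else V $ i)" for x
    have "linear g"
    proof
      show "g (x + y) = g x + g y" for x y
        unfolding g_def using det_row_add[of j "\<lambda>_. x" "\<lambda>_. y" "\<lambda>i. V $ i"] by simp
      show "g (r *\<^sub>R x) = r *\<^sub>R g x" for r x
        unfolding g_def using det_row_mul[of j r "\<lambda>_. x" "\<lambda>i. V $ i"]
        unfolding scalar_mult_eq_scaleR by simp
    qed
    \<comment> \<open>As a function of row \<open>j\<close> the determinant is x \<mapsto> w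
      \<bullet> x. Its value at \<open>axis j 1\<close> is \<open>det V\<close>, so
      \<open>norm w\<close> is at least |det V|, and the assumption at \<theta> = w yields a row
      \<open>x\<close> with |g x| \<ge> c |det V|.\<close>
    define w where "w = adjoint g 1"
    have g: "g x = w \<bullet> x" for x
      using adjoint_works[OF \<open>linear g\<close>, of x 1] by (simp add: w_def inner_commute)
    have "(\<chi> i. if i = j then axis j 1 else V $ i) = V"
      using V(2) insert(2) by (auto simp: vec_eq_iff)
    then have "det V = w \<bullet> axis j 1"
      using g[of "axis j 1"] by (simp add: g_def)
    then have w: "\<bar>det V\<bar> \<le> norm w"
      using Cauchy_Schwarz_ineq2[of w "axis j 1"] by (simp add: norm_axis_1)
    obtain x where x: "x \<in> S" "c * norm w \<le> \<bar>w \<bullet> x\<bar>"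
      using assms(1) by blast
    have "c * c ^ card I \<le> c * norm w"
      using V(3) w \<open>0 \<le> c\<close> by (intro mult_left_mono) auto
    with x(2) g[of x] have "c ^ card (insert j I) \<le> \<bar>g x\<bar>"
      using insert by simp
    with V x(1) show ?case
      by (intro exI[of _ "\<chi> i. if i = j then x else V $ i"]) (auto simp: g_def)
  qed
  from this[of UNIV] show ?thesis by auto
qed

text \<open>The library has this only for well-ordered index types, since it computes the determinant of a
  shear as that of a triangular matrix.\<close>

lemma measure_linear_image_cart:
  fixes f :: "real ^ 'n \<Rightarrow> real ^ 'n"
  assumes "linear f" "S \<in> lmeasurable"
  shows "f ` S \<in> lmeasurable \<and> measure lebesgue (f ` S) = \<bar>det (matrix f)\<bar> * measure lebesgue S"
proof -
  \<comment> \<open>For determinant 1 or -1 it suffices to treat boxes with a corner at the origin;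
    translation covers the rest. The coordinate swap and the shear below are of this kind.\<close>
  have unimodular: "f ` S \<in> lmeasurable \<and> measure lebesgue (f ` S) = \<bar>det (matrix f)\<bar> * measure lebesgue S"
    if "linear f" "S \<in> lmeasurable" "\<bar>det (matrix f)\<bar> = 1"
      "\<And>u. cbox 0 u \<noteq> {} \<Longrightarrow> measure lebesgue (f ` cbox 0 u) = measure lebesgue (cbox 0 u)"
    for f :: "real ^ 'n \<Rightarrow> real ^ 'n" and S
  proof -
    have "measure lebesgue (f ` cbox a b) = 1 * measure lebesgue (cbox a b)" for a b
    proof (cases "cbox a b = {}")
      case False
      have ab: "cbox a b = (+) a ` cbox 0 (b - a)"
        using cbox_translation[of a 0 "b - a"] by simp
      then have ne: "cbox 0 (b - a) \<noteq> {}" using False by auto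
      have "f ` cbox a b = (+) (f a) ` f ` cbox 0 (b - a)"
        unfolding ab image_image linear_add[OF that(1)] ..
      then show ?thesis
        using that(4)[OF ne] by (simp only: measure_translation ab mult_1)
    qed simp
    from measure_linear_sufficient[OF that(1,2) this] show ?thesis
      by (simp add: that(3))
  qed
  let ?P = "\<lambda>f :: real ^ 'n \<Rightarrow> real ^ 'n. \<forall>S\<in>lmeasurable.
    f ` S \<in> lmeasurable \<and> measure lebesgue (f ` S) = \<bar>det (matrix f)\<bar> * measure lebesgue S"
  have "?P f"
  proof (rule induct_linear_elementary[OF \<open>linear f\<close>])
    fix f g :: "real ^ 'n \<Rightarrow> real ^ 'n"
    assume lin: "linear f" "linear g" and P: "?P f" "?P g"
    have "f ` g ` S \<in> lmeasurable \<and>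
        measure lebesgue (f ` g ` S) = \<bar>det (matrix f)\<bar> * (\<bar>det (matrix g)\<bar> * measure lebesgue S)"
      if "S \<in> lmeasurable" for S
      using P that by auto
    then show "?P (f \<circ> g)"
      using matrix_compose[OF lin(2,1)] by (auto simp: image_comp det_mul abs_mult)
  next
    fix f :: "real ^ 'n \<Rightarrow> real ^ 'n" and i
    assume lin: "linear f" and 0: "\<And>x. f x $ i = 0"
    have "\<not> surj f"
      using 0 by (metis axis_nth surjE zero_neq_one)
    then have ninj: "\<not> inj f"
      using linear_injective_imp_surjective[OF lin] by blast
    have "negligible (f ` S)" for S
      by (rule negligible_subset[OF negligible_standard_hyperplane_cart[of i]]) (use 0 in auto)
    then show "?P f"
      using det_nz_iff_inj[OF lin] ninj
      by (auto simp: negligible_iff_measure negligible_imp_measure0)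
  next
    fix c :: "'n \<Rightarrow> real"
    have "matrix (\<lambda>x. \<chi> i. c i * x $ i) = (\<chi> i j. if i = j then c i else 0)"
      by (auto simp: matrix_def axis_def vec_eq_iff)
    then have "det (matrix (\<lambda>x. \<chi> i. c i * x $ i)) = prod c UNIV"
      by (simp add: det_diagonal)
    then show "?P (\<lambda>x. \<chi> i. c i * x $ i)"
      using measurable_stretch measure_stretch by auto
  next
    fix m n :: 'n
    assume "m \<noteq> n"
    let ?\<tau> = "Transposition.transpose m n"
    let ?h = "\<lambda>x :: real ^ 'n. \<chi> i. x $ ?\<tau> i"
    have "linear ?h" by (rule linearI) (simp_all add: vec_eq_iff)
    moreover have "matrix ?h = (\<chi> i. mat 1 $ ?\<tau> i)"
      by (auto simp: matrix_def axis_def mat_def vec_eq_iff)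
    then have "\<bar>det (matrix ?h)\<bar> = 1"
      by (simp add: det_permute_rows[of ?\<tau> "mat 1"] permutes_swap_id sign_swap_id abs_mult)
    moreover have "measure lebesgue (?h ` cbox 0 u) = measure lebesgue (cbox 0 u)"
      if ne: "cbox 0 u \<noteq> {}" for u
    proof -
      have im: "?h ` cbox 0 u = cbox 0 (?h u)"
      proof (intro set_eqI iffI)
        fix y assume y: "y \<in> cbox 0 (?h u)"
        have "y = ?h (?h y)" by (simp add: vec_eq_iff)
        moreover have "?h y \<in> cbox 0 u"
          using y unfolding mem_box_cart by (metis transpose_involutory vec_lambda_beta zero_index)
        ultimately show "y \<in> ?h ` cbox 0 u" by blast
      qed (auto simp: mem_box_cart)
      then have "cbox 0 (?h u) \<noteq> {}" using ne by auto
      then show ?thesis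
        using ne prod.permute[OF permutes_swap_id[of m UNIV n], of "\<lambda>i. u $ i"]
        by (simp add: im content_cbox_cart o_def)
    qed
    ultimately show "?P ?h" using unimodular[of ?h] by blast
  next
    fix m n :: 'n
    assume mn: "m \<noteq> n"
    let ?h = "\<lambda>x :: real ^ 'n. \<chi> i. if i = m then x $ m + x $ n else x $ i"
    have "linear ?h" by (rule linearI) (simp_all add: vec_eq_iff algebra_simps)
    moreover have "matrix ?h = (\<chi> k. if k = m then row m (mat 1) + 1 *s row n (mat 1) else row k (mat 1))"
      by (auto simp: matrix_def axis_def mat_def row_def vec_eq_iff)
    then have "det (matrix ?h) = 1"
      using det_row_operation[OF mn, of "mat 1 :: real ^ 'n ^ 'n" 1] by simp
    moreover have "measure lebesgue (?h ` cbox 0 u) = measure lebesgue (cbox 0 u)"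
      if "cbox 0 u \<noteq> {}" for u
      using measure_shear_interval[OF mn that] by simp
    ultimately show "?P ?h" using unimodular[of ?h] by simp
  qed
  with assms(2) show ?thesis by blast
qed

text \<open>The rows of a matrix with determinant at least c^d in modulus span a parallelepiped at
  z. Its parameter domain is the cube of side 1/d: the coordinates there sum to at most 1, so the
  image stays in the convex hull of z and the points z + V_i, and its volume is |det V|
  d^-d.\<close>

lemma convex_measure_lower_bound:
  fixes K :: "(real ^ 'd) set"
  assumes "convex K" and z: "z \<in> K" and K[measurable]: "K \<in> sets borel"
    and wide: "\<And>\<theta>. \<exists>x\<in>K. c * norm \<theta> \<le> \<bar>\<theta> \<bullet> (x - z)\<bar>" and c: "0 \<le> c"
  shows "ennreal ((c / CARD('d)) ^ CARD('d)) \<le> emeasure lborel K"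
proof -
  let ?d = "real CARD('d)"
  have "\<exists>x\<in>(\<lambda>x. x - z) ` K. c * norm \<theta> \<le> \<bar>\<theta> \<bullet> x\<bar>" for \<theta>
    using wide[of \<theta>] by auto
  from exists_large_det[OF this c] obtain V :: "real ^ 'd ^ 'd"
    where V: "\<And>i. V $ i \<in> (\<lambda>x. x - z) ` K" "c ^ CARD('d) \<le> \<bar>det V\<bar>" by blast
  then have VK: "z + V $ i \<in> K" for i
  proof -
    obtain x where "x \<in> K" "V $ i = x - z" using V(1)[of i] by blast
    then show ?thesis by simp
  qed
  define T where "T t = (transpose V) *v t" for t
  have T: "T t = (\<Sum>i\<in>UNIV. t $ i *\<^sub>R V $ i)" for t
    by (simp add: T_def vec_eq_iff matrix_vector_mult_def transpose_def mult.commute)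
  have Tlin: "linear T"
    unfolding T_def by (rule matrix_vector_mul_linear)
  have Tmat: "matrix T = transpose V"
    unfolding T_def by (rule matrix_of_matrix_vector_mul)
  define B :: "(real ^ 'd) set" where "B = cbox 0 (\<chi> i. 1 / ?d)"
  have img: "T ` B \<subseteq> (+) (-z) ` K"
  proof safe
    fix t assume "t \<in> B"
    then have t: "0 \<le> t $ i" "t $ i \<le> 1 / ?d" for i
      by (auto simp: B_def mem_box_cart)
    have "(\<Sum>i\<in>UNIV. t $ i) \<le> (\<Sum>i\<in>(UNIV::'d set). 1 / ?d)"
      by (intro sum_mono t)
    then have s: "(\<Sum>i\<in>UNIV. t $ i) \<le> 1" by simp
    \<comment> \<open>Barycentric weights indexed by \<open>'d option\<close>: \<open>None\<close>
      carries the weight left for \<open>z\<close> itself.\<close>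
    define a where "a o' = (case o' of None \<Rightarrow> 1 - (\<Sum>i\<in>UNIV. t $ i) | Some i \<Rightarrow> t $ i)" for o'
    define y where "y o' = (case o' of None \<Rightarrow> z | Some i \<Rightarrow> z + V $ i)" for o'
    have U: "(UNIV :: 'd option set) = insert None (Some ` UNIV)"
      by (auto simp: UNIV_option_conv)
    have "(\<Sum>o'\<in>UNIV. a o' *\<^sub>R y o') \<in> K"
    proof (rule convex_sum[OF _ \<open>convex K\<close>])
      show "sum a UNIV = 1" unfolding U
        by (subst sum.insert) (auto simp: a_def sum.reindex)
    qed (use s t z VK in \<open>auto simp: a_def y_def split: option.split\<close>)
    also have "(\<Sum>o'\<in>UNIV. a o' *\<^sub>R y o') = z + T t"
      unfolding U T by (subst sum.insert)
       (auto simp: a_def y_def sum.reindex algebra_simps sum.distrib scaleR_sum_left)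
    finally show "T t \<in> (+) (-z) ` K"
      by (intro image_eqI[of _ _ "z + T t"]) auto
  qed
  have ne: "B \<noteq> {}"
    unfolding B_def by (auto simp: cbox_def Basis_vec_def inner_axis box_ne_empty intro!: exI[of _ 0])
  have Bm: "measure lebesgue B = (1 / ?d) ^ CARD('d)"
    using content_cbox_cart[OF ne[unfolded B_def]] unfolding B_def by simp
  have TB: "T ` B \<in> lmeasurable" "measure lebesgue (T ` B) = \<bar>det V\<bar> * (1 / ?d) ^ CARD('d)"
    using measure_linear_image_cart[OF Tlin, of B] Bm
    by (auto simp: B_def Tmat det_transpose)
  have "ennreal ((c / ?d) ^ CARD('d)) \<le> ennreal (measure lebesgue (T ` B))"
    unfolding TB(2) using V(2)
    by (intro ennreal_leI) (simp add: power_divide divide_right_mono)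
  also have "\<dots> = emeasure lebesgue (T ` B)"
    using TB(1) by (simp add: emeasure_eq_measure2)
  also have "\<dots> \<le> emeasure lebesgue ((+) (-z) ` K)"
    by (intro emeasure_mono[OF img] lebesgue_sets_translation) simp
  also have "\<dots> = emeasure lebesgue K"
    using emeasure_lebesgue_affine[of 1 "-z" K] by (simp add: image_def)
  also have "\<dots> = emeasure lborel K"
    by simp
  finally show ?thesis .
qed

section \<open>Isotropic log-concave densities\<close>

text \<open>Mean zero and unit covariance appear as moments of \<open>\<theta> \<bullet> x\<close>
  for every \<theta>, because the estimates test one direction at a time.
  \<open>has_bochner_integral\<close> supplies integrability along with the value.\<close>

locale isotropic_density =
  fixes p :: "real ^ 'd \<Rightarrow> real"
  assumes log_concave: "log_concave p"
    and measurable[measurable]: "p \<in> borel_measurable borel"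
    and total: "has_bochner_integral lborel p 1"
    and first: "has_bochner_integral lborel (\<lambda>x. (\<theta> \<bullet> x) * p x) 0"
    and second: "has_bochner_integral lborel (\<lambda>x. (\<theta> \<bullet> x)\<^sup>2 * p x) ((norm \<theta>)\<^sup>2)"
begin

abbreviation law :: "(real ^ 'd) measure" where
  "law \<equiv> density lborel (\<lambda>x. ennreal (p x))"

lemma nonneg[simp]: "0 \<le> p x"
  using log_concave by (simp add: log_concave_def)

lemma interpolate: "0 < t \<Longrightarrow> t < 1 \<Longrightarrow> p x powr (1 - t) * p y powr t \<le> p ((1 - t) *\<^sub>R x + t *\<^sub>R y)"
  using log_concave by (simp add: log_concave_def)

lemma midpoint: "sqrt (p x * p y) \<le> p ((1 / 2) *\<^sub>R (x + y))"
  using interpolate[of "1/2" x y]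
  by (simp add: powr_half_sqrt real_sqrt_mult scaleR_add_right)

sublocale law: prob_space law
proof
  have "emeasure law (space law) = (\<integral>\<^sup>+x. ennreal (p x) \<partial>lborel)"
    by (simp add: emeasure_density)
  also have "\<dots> = 1"
    using total by (subst nn_integral_eq_integral) (auto simp: has_bochner_integral_iff)
  finally show "emeasure law (space law) = 1" .
qed

lemma second_moment: "has_bochner_integral lborel (\<lambda>x. (norm x)\<^sup>2 * p x) (real CARD('d))"
proof -
  have "has_bochner_integral lborel (\<lambda>x. \<Sum>i\<in>Basis. (i \<bullet> x)\<^sup>2 * p x) (\<Sum>i\<in>(Basis :: (real ^ 'd) set). (norm i)\<^sup>2)"
    by (intro has_bochner_integral_sum second)
  moreover have "(\<Sum>i\<in>Basis. (i \<bullet> x)\<^sup>2 * p x) = (norm x)\<^sup>2 * p x" for x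
    by (subst power2_norm_eq_inner, subst euclidean_inner[of x x])
       (simp add: sum_distrib_right power2_eq_square inner_commute)
  ultimately show ?thesis
    by simp
qed

lemma chebyshev:
  assumes "0 < r"
  shows "emeasure law {x. r \<le> norm x} \<le> ennreal (real CARD('d) / r\<^sup>2)"
proof -
  have "emeasure law {x. r \<le> norm x} = (\<integral>\<^sup>+x. ennreal (p x) * indicator {x. r \<le> norm x} x \<partial>lborel)"
    by (simp add: emeasure_density)
  also have "\<dots> \<le> (\<integral>\<^sup>+x. ennreal (1 / r\<^sup>2 * ((norm x)\<^sup>2 * p x)) \<partial>lborel)"
  proof (intro nn_integral_mono)
    fix x
    have "p x \<le> 1 / r\<^sup>2 * ((norm x)\<^sup>2 * p x)" if "r \<le> norm x"
    proof -
      have "r\<^sup>2 * p x \<le> (norm x)\<^sup>2 * p x"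
        using assms that by (intro mult_right_mono power_mono) auto
      with assms show ?thesis by (simp add: field_simps)
    qed
    then show "ennreal (p x) * indicator {x. r \<le> norm x} x \<le> ennreal (1 / r\<^sup>2 * ((norm x)\<^sup>2 * p x))"
      by (auto split: split_indicator intro!: ennreal_leI simp del: times_divide_eq_left)
  qed
  also have "\<dots> = ennreal (1 / r\<^sup>2 * real CARD('d))"
    using has_bochner_integral_mult_right[OF second_moment, of "1 / r\<^sup>2"] assms
    by (intro nn_integral_eq_integral[THEN trans]) (auto simp: has_bochner_integral_iff)
  finally show ?thesis by simp
qed

text \<open>When p x is this far below p z, even q times the geometric mean of the two is at least p
  x, and the midpoint inequality takes over. Integrated over x, this bounds the part of the law
  outside a level set.\<close>

lemma log_concave_away:
  assumes "p x < q\<^sup>2 * p z" "0 \<le> q"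
  shows "p x \<le> q * p ((1 / 2) *\<^sub>R (x + z))"
proof -
  have "p x = sqrt (p x * p x)" by simp
  also have "\<dots> \<le> sqrt (p x * (q\<^sup>2 * p z))"
    using assms by (intro real_sqrt_le_mono mult_left_mono) auto
  also have "\<dots> = q * sqrt (p x * p z)"
    using assms by (simp add: real_sqrt_mult)
  also have "\<dots> \<le> q * p ((1 / 2) *\<^sub>R (x + z))"
    using assms midpoint by (intro mult_left_mono) auto
  finally show ?thesis .
qed

text \<open>By the previous bound and the substitution \<open>x = 2y - z\<close>, at most half of the second moment about
  \<open>z\<close> in direction \<open>\<theta>\<close> comes from outside the level set.\<close>

lemma level_set_wide:
  assumes "q = (1 / 2) ^ (CARD('d) + 3)"
  shows "\<exists>x\<in>{x. q\<^sup>2 * p z \<le> p x}. 1 / 2 * norm \<theta> \<le> \<bar>\<theta> \<bullet> (x - z)\<bar>"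
proof (cases "\<theta> = 0")
  case True
  have "q\<^sup>2 \<le> 1" using assms by (simp add: power_le_one)
  then have "q\<^sup>2 * p z \<le> p z" using mult_right_mono[of "q\<^sup>2" 1 "p z"] by simp
  with True show ?thesis by auto
next
  case False
  show ?thesis
  proof (rule ccontr)
    assume "\<not> ?thesis"
    then have narrow: "\<bar>\<theta> \<bullet> (x - z)\<bar> < 1 / 2 * norm \<theta>" if "q\<^sup>2 * p z \<le> p x" for x
      using that by (auto simp: not_le dest!: spec[of _ x])
    define u where "u x = (\<theta> \<bullet> (x - z))\<^sup>2" for x
    \<comment> \<open>Second moment of \<open>\<theta> \<bullet> x\<close> about its value at z;
      mean zero removes the cross term.\<close>
    define I where "I = (norm \<theta>)\<^sup>2 + (\<theta> \<bullet> z)\<^sup>2"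
    have I: "has_bochner_integral lborel (\<lambda>x. u x * p x) I"
    proof -
      have "has_bochner_integral lborel (\<lambda>x. (\<theta> \<bullet> x)\<^sup>2 * p x + ((- 2 * (\<theta> \<bullet> z)) * ((\<theta> \<bullet> x) * p x) + (\<theta> \<bullet> z)\<^sup>2 * p x))
         ((norm \<theta>)\<^sup>2 + ((- 2 * (\<theta> \<bullet> z)) * 0 + (\<theta> \<bullet> z)\<^sup>2 * 1))"
        by (intro has_bochner_integral_add has_bochner_integral_mult_right second first total)
      then show ?thesis
        by (simp add: u_def I_def inner_diff_right power2_eq_square algebra_simps)
    qed
    have "has_bochner_integral lborel (\<lambda>y. u ((1 / 2) *\<^sub>R (y + z)) * p ((1 / 2) *\<^sub>R (y + z))) (2 ^ CARD('d) * I)"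
    proof -
      have "(1 / 2) *\<^sub>R z + (1 / 2) *\<^sub>R y = (1 / 2) *\<^sub>R (y + z)" for y
        by (simp add: vec_eq_iff field_simps)
      then show ?thesis
        using has_bochner_integral_lborel_affine[OF I, of "1/2" "(1 / 2) *\<^sub>R z"]
        by (simp only:) (simp add: power_one_over)
    qed
    moreover have "4 * u ((1 / 2) *\<^sub>R (y + z)) = u y" for y
    proof -
      have "(1 / 2) *\<^sub>R (y + z) - z = (1 / 2) *\<^sub>R (y - z)"
        by (simp add: vec_eq_iff field_simps)
      then show ?thesis by (simp add: u_def power2_eq_square)
    qed
    ultimately have "has_bochner_integral lborel (\<lambda>y. 4 * (u ((1 / 2) *\<^sub>R (y + z)) * p ((1 / 2) *\<^sub>R (y + z)))) (4 * (2 ^ CARD('d) * I))"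
      by (intro has_bochner_integral_mult_right) simp
    then have I': "has_bochner_integral lborel (\<lambda>y. u y * p ((1 / 2) *\<^sub>R (y + z))) (4 * (2 ^ CARD('d) * I))"
      unfolding mult.assoc[symmetric] \<open>\<And>y. 4 * u _ = u y\<close> .
    \<comment> \<open>On the level set, narrowness gives u x \<le> |\<theta>|^2 / 4; off it the
      midpoint bound applies.\<close>
    have le: "u x * p x \<le> (norm \<theta>)\<^sup>2 / 4 * p x + q * (u x * p ((1 / 2) *\<^sub>R (x + z)))" for x
    proof (cases "q\<^sup>2 * p z \<le> p x")
      case True
      have "u x \<le> (1 / 2 * norm \<theta>)\<^sup>2"
        using narrow[OF True] unfolding u_def abs_le_square_iff[symmetric] by simp
      then have "u x * p x \<le> (norm \<theta>)\<^sup>2 / 4 * p x"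
        by (intro mult_right_mono) (auto simp: power2_eq_square)
      moreover have "0 \<le> q * (u x * p ((1 / 2) *\<^sub>R (x + z)))"
        using assms by (simp add: u_def)
      ultimately show ?thesis by simp
    next
      case False
      then have "p x \<le> q * p ((1 / 2) *\<^sub>R (x + z))"
        using assms by (intro log_concave_away) auto
      then have "u x * p x \<le> u x * (q * p ((1 / 2) *\<^sub>R (x + z)))"
        by (intro mult_left_mono) (auto simp: u_def)
      moreover have "0 \<le> (norm \<theta>)\<^sup>2 / 4 * p x" by simp
      moreover have "u x * (q * p ((1 / 2) *\<^sub>R (x + z))) = q * (u x * p ((1 / 2) *\<^sub>R (x + z)))"
        by simp
      ultimately show ?thesis by linarith
    qed
    have R: "has_bochner_integral lborel (\<lambda>x. (norm \<theta>)\<^sup>2 / 4 * p x + q * (u x * p ((1 / 2) *\<^sub>R (x + z))))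
        ((norm \<theta>)\<^sup>2 / 4 * 1 + q * (4 * (2 ^ CARD('d) * I)))"
      by (intro has_bochner_integral_add has_bochner_integral_mult_right total I')
    have "I \<le> (norm \<theta>)\<^sup>2 / 4 * 1 + q * (4 * (2 ^ CARD('d) * I))"
      using integral_mono[OF integrable.intros[OF I] integrable.intros[OF R] le]
      unfolding has_bochner_integral_integral_eq[OF I] has_bochner_integral_integral_eq[OF R] .
    \<comment> \<open>This fixes the exponent d + 3 in \<open>q\<close>: 2^d from the Jacobian, 4
      from halving the distance to z in the quadratic weight, and 2 so that the term is absorbed
      into I. What remains, I \<le> |\<theta>|^2 / 2, contradicts I \<ge> |\<theta>|^2.\<close>
    also have "q * (4 * (2 ^ CARD('d) * I)) = I / 2"
      unfolding assms by (simp add: power_add power_one_over field_simps)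
    finally have "I \<le> (norm \<theta>)\<^sup>2 / 2" by simp
    then show False
      using \<open>\<theta> \<noteq> 0\<close> by (simp add: I_def) (smt (verit) zero_less_norm_iff zero_le_power2 zero_less_power field_sum_of_halves)
  qed
qed


text \<open>The second moment is d, so Chebyshev leaves at most 1/4 of the mass beyond radius 2 sqrt
  d. A density below 1/(2 vol) on the ball would give it mass at most 1/2, and 1/2 + 1/4 <
  1.\<close>

lemma central_point:
  defines "R \<equiv> 2 * sqrt (real CARD('d))"
  shows "\<exists>z. norm z \<le> R \<and> 1 / (2 * measure lborel (cball (0 :: real ^ 'd) R)) \<le> p z"
proof (rule ccontr)
  let ?v = "measure lborel (cball (0 :: real ^ 'd) R)"
  assume "\<not> ?thesis"
  then have small: "p z < 1 / (2 * ?v)" if "z \<in> cball 0 R" for z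
    using that by (auto simp: not_le dest!: spec[of _ z])
  have R: "0 < R" by (simp add: R_def)
  have "1 = emeasure law UNIV"
    using law.emeasure_space_1 by simp
  also have "\<dots> \<le> emeasure law (cball 0 R \<union> {x. R \<le> norm x})"
    by (intro emeasure_mono) auto
  also have "\<dots> \<le> emeasure law (cball 0 R) + emeasure law {x. R \<le> norm x}"
    by (intro emeasure_subadditive) auto
  also have "emeasure law {x. R \<le> norm x} \<le> ennreal (1 / 4)"
    using chebyshev[OF R] by (simp add: R_def power_mult_distrib)
  also have "emeasure law (cball 0 R) \<le> ennreal (1 / 2)"
  proof -
    have "emeasure law (cball 0 R) \<le> (\<integral>\<^sup>+x. ennreal (1 / (2 * ?v)) * indicator (cball (0 :: real ^ 'd) R) x \<partial>lborel)"
      using less_imp_le[OF small] by (subst emeasure_density)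
        (auto split: split_indicator intro!: nn_integral_mono ennreal_leI)
    also have "\<dots> = ennreal (1 / (2 * ?v)) * ennreal ?v"
      using emeasure_lborel_cball_finite[of "0 :: real ^ 'd" R]
      by (simp add: nn_integral_cmult_indicator emeasure_eq_ennreal_measure top.not_eq_extremum)
    also have "\<dots> \<le> ennreal (1 / 2)"
      by (subst ennreal_mult[symmetric]) (auto intro!: ennreal_leI)
    finally show ?thesis .
  qed
  finally have "1 \<le> ennreal (1 / 2) + ennreal (1 / 4)" by (simp add: add_mono)
  then show False
    by (subst (asm) ennreal_plus[symmetric]) (auto simp: ennreal_le_iff[symmetric] simp flip: ennreal_1)
qed

lemma convex_level_set: "convex {x. s \<le> p x}"
  unfolding convex_alt
proof safe
  fix x y and u :: real
  assume xy: "s \<le> p x" "s \<le> p y" and u: "0 \<le> u" "u \<le> 1"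
  show "s \<le> p ((1 - u) *\<^sub>R x + u *\<^sub>R y)"
  proof (cases "s \<le> 0 \<or> u = 0 \<or> u = 1")
    case False
    then have "s = s powr (1 - u) * s powr u"
      by (simp add: powr_add[symmetric])
    also have "\<dots> \<le> p x powr (1 - u) * p y powr u"
      using xy False u by (intro mult_mono powr_mono2) auto
    also have "\<dots> \<le> p ((1 - u) *\<^sub>R x + u *\<^sub>R y)"
      using False u by (intro interpolate) auto
    finally show ?thesis .
  qed (use xy in \<open>auto intro: order_trans[OF _ nonneg]\<close>)
qed

text \<open>Seen from a point \<open>x\<close>, a set of large density shrinks to half its size and still has
  density at least the geometric mean.\<close>

lemma emeasure_law_midpoints:
  assumes [measurable]: "S \<in> sets borel" "T \<in> sets borel"
    and "0 \<le> s" "\<And>u. u \<in> S \<Longrightarrow> s \<le> p u" "\<And>u. u \<in> S \<Longrightarrow> (1 / 2) *\<^sub>R (x + u) \<in> T"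
  shows "ennreal (sqrt (p x * s) / 2 ^ CARD('d)) * emeasure lborel S \<le> emeasure law T"
proof -
  have mid: "(1 / 2) *\<^sub>R x + (1 / 2) *\<^sub>R u = (1 / 2) *\<^sub>R (x + u)" for u
    by (simp add: scaleR_add_right)
  have "ennreal (sqrt (p x * s) / 2 ^ CARD('d)) * emeasure lborel S =
      ennreal ((1 / 2) ^ CARD('d)) * (ennreal (sqrt (p x * s)) * emeasure lborel S)"
    using \<open>0 \<le> s\<close> by (subst mult.assoc[symmetric], subst ennreal_mult[symmetric])
       (auto simp: power_one_over field_simps)
  also have "\<dots> = ennreal ((1 / 2) ^ CARD('d)) * (\<integral>\<^sup>+u. ennreal (sqrt (p x * s)) * indicator S u \<partial>lborel)"
    by (simp add: nn_integral_cmult_indicator)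
  also have "\<dots> \<le> ennreal ((1 / 2) ^ CARD('d)) *
      (\<integral>\<^sup>+u. ennreal (p ((1 / 2) *\<^sub>R x + (1 / 2) *\<^sub>R u)) * indicator T ((1 / 2) *\<^sub>R x + (1 / 2) *\<^sub>R u) \<partial>lborel)"
  proof (intro mult_left_mono nn_integral_mono)
    fix u
    have "sqrt (p x * s) \<le> p ((1 / 2) *\<^sub>R (x + u))" if "u \<in> S"
      by (rule order_trans[OF real_sqrt_le_mono midpoint]) (use assms(4)[OF that] in \<open>simp add: mult_left_mono\<close>)
    then show "ennreal (sqrt (p x * s)) * indicator S u
        \<le> ennreal (p ((1 / 2) *\<^sub>R x + (1 / 2) *\<^sub>R u)) * indicator T ((1 / 2) *\<^sub>R x + (1 / 2) *\<^sub>R u)"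
      unfolding mid using assms(5)[of u] by (auto split: split_indicator intro!: ennreal_leI)
  qed simp
  also have "\<dots> = (\<integral>\<^sup>+w. ennreal (p w) * indicator T w \<partial>lborel)"
    by (subst nn_integral_lborel_affine[where c="1/2" and t="(1 / 2) *\<^sub>R x"]) auto
  also have "\<dots> = emeasure law T"
    by (simp add: emeasure_density)
  finally show ?thesis .
qed

end

text \<open>For a central z the level set is convex and extends by at least 1/2 in every direction,
  hence has volume at least v. Shrunk by half towards x it has density at least sqrt (p x * q^2 * p
  z), yet mass at most 1. Solving for p x and using p z \<ge> m gives a bound in d alone.\<close>

lemma isotropic_density_bounded:
  "\<exists>M>0. \<forall>p :: real ^ 'd \<Rightarrow> real. isotropic_density p \<longrightarrow> (\<forall>x. p x \<le> M)"
proof -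
  define R where "R = 2 * sqrt (real CARD('d))"
  define m where "m = 1 / (2 * measure lborel (cball (0 :: real ^ 'd) R))"
  define q :: real where "q = (1 / 2) ^ (CARD('d) + 3)"
  define v where "v = (1 / 2 / real CARD('d)) ^ CARD('d)"
  have R: "0 < R" by (simp add: R_def)
  have m: "0 < m" unfolding m_def using content_cball_pos[OF R, of "0 :: real ^ 'd"] by simp
  have q: "0 < q" and v: "0 < v" by (simp_all add: q_def v_def)
  have "p x \<le> (2 ^ CARD('d) / v)\<^sup>2 / (q\<^sup>2 * m)" if "isotropic_density p" for p :: "real ^ 'd \<Rightarrow> real" and x
  proof -
    interpret isotropic_density p by fact
    obtain z where z: "m \<le> p z" "norm z \<le> R"
      using central_point unfolding R_def m_def by blast
    let ?K = "{x. q\<^sup>2 * p z \<le> p x}"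
    have "q\<^sup>2 \<le> 1" by (simp add: q_def power_le_one)
    then have zK: "z \<in> ?K" using mult_right_mono[of "q\<^sup>2" 1 "p z"] by simp
    have K: "?K \<in> sets borel" by measurable
    have "ennreal v \<le> emeasure lborel ?K"
      unfolding v_def by (intro convex_measure_lower_bound[OF convex_level_set zK K] level_set_wide q_def) simp
    then have "ennreal (sqrt (p x * (q\<^sup>2 * p z)) / 2 ^ CARD('d)) * ennreal v
        \<le> ennreal (sqrt (p x * (q\<^sup>2 * p z)) / 2 ^ CARD('d)) * emeasure lborel ?K"
      by (intro mult_left_mono) auto
    also have "\<dots> \<le> emeasure law UNIV"
      by (intro emeasure_law_midpoints K) auto
    also have "\<dots> = 1" using law.emeasure_space_1 by simp
    finally have "sqrt (p x * (q\<^sup>2 * p z)) / 2 ^ CARD('d) * v \<le> 1"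
      using v by (simp add: ennreal_mult[symmetric])
    then have "sqrt (p x * (q\<^sup>2 * p z)) \<le> 2 ^ CARD('d) / v"
      using v by (simp add: field_simps)
    then have "p x * (q\<^sup>2 * p z) \<le> (2 ^ CARD('d) / v)\<^sup>2"
      by (rule sqrt_le_D)
    moreover have "p x * (q\<^sup>2 * m) \<le> p x * (q\<^sup>2 * p z)"
      using z by (intro mult_left_mono) auto
    ultimately show ?thesis
      using m q by (subst pos_le_divide_eq) auto
  qed
  moreover have "0 < (2 ^ CARD('d) / v)\<^sup>2 / (q\<^sup>2 * m)" using v q m by simp
  ultimately show ?thesis by blast
qed


section \<open>Decay of isotropic log-concave densities\<close>

context isotropic_density
begin

text \<open>The substitution of \<open>level_set_wide\<close> without the quadratic weight: the
  midpoint bound integrates to q 2^d = 1/8.\<close>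

lemma emeasure_outside_level_set:
  assumes "q = (1 / 2) ^ (CARD('d) + 3)"
  shows "emeasure law {x. p x < q\<^sup>2 * p z} \<le> ennreal (1 / 8)"
proof -
  have mid: "(1 / 2) *\<^sub>R z + (1 / 2) *\<^sub>R u = (1 / 2) *\<^sub>R (u + z)" for u
    by (simp add: scaleR_add_right)
  have "emeasure law {x. p x < q\<^sup>2 * p z} \<le> (\<integral>\<^sup>+x. ennreal q * ennreal (p ((1 / 2) *\<^sub>R z + (1 / 2) *\<^sub>R x)) \<partial>lborel)"
    unfolding mid using assms log_concave_away[of _ q z]
    by (subst emeasure_density)
       (auto split: split_indicator intro!: nn_integral_mono ennreal_leI simp: ennreal_mult[symmetric])
  also have "\<dots> = ennreal q * (ennreal (2 ^ CARD('d)) * (ennreal ((1 / 2) ^ CARD('d)) *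
      (\<integral>\<^sup>+x. ennreal (p ((1 / 2) *\<^sub>R z + (1 / 2) *\<^sub>R x)) \<partial>lborel)))"
    by (subst mult.assoc[of "ennreal (2 ^ CARD('d))", symmetric])
       (simp add: nn_integral_cmult ennreal_mult[symmetric] power_one_over)
  also have "ennreal ((1 / 2) ^ CARD('d)) * (\<integral>\<^sup>+x. ennreal (p ((1 / 2) *\<^sub>R z + (1 / 2) *\<^sub>R x)) \<partial>lborel)
      = (\<integral>\<^sup>+x. ennreal (p x) \<partial>lborel)"
    by (subst nn_integral_lborel_affine[where c="1/2" and t="(1 / 2) *\<^sub>R z"]) auto
  also have "\<dots> = 1"
    using law.emeasure_space_1 by (simp add: emeasure_density)
  also have "ennreal q * (ennreal (2 ^ CARD('d)) * 1) = ennreal (1 / 8)"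
    by (simp add: assms ennreal_mult[symmetric] power_add power_one_over)
  finally show ?thesis .
qed

text \<open>The level set of z within radius R keeps mass at least 1 - 1/8 - 1/4, hence has volume
  at least 1/(2 M). Its midpoints with x lie outside radius (norm x - R)/2, where Chebyshev leaves
  mass of order (norm x - R)^-2. As p x enters the midpoint bound under a square root, the decay has
  order four.\<close>

lemma far_density_small:
  defines "R \<equiv> 2 * sqrt (real CARD('d))" and "q \<equiv> (1 / 2) ^ (CARD('d) + 3)"
  assumes M: "\<And>x. p x \<le> M" "0 < M" and z: "m \<le> p z" "0 < m" and x: "R < norm x"
  shows "p x \<le> (2 ^ CARD('d) * 8 * M * real CARD('d))\<^sup>2 / (q\<^sup>2 * m) / (norm x - R) ^ 4"
proof -
  define K where "K = {x. q\<^sup>2 * p z \<le> p x} \<inter> cball 0 R"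
  have [measurable]: "K \<in> sets borel" unfolding K_def by measurable
  have R: "0 < R" and q: "0 < q" by (simp_all add: R_def q_def)
  have "1 = emeasure law UNIV"
    using law.emeasure_space_1 by simp
  also have "\<dots> \<le> emeasure law (K \<union> ({x. p x < q\<^sup>2 * p z} \<union> {x. R \<le> norm x}))"
    by (intro emeasure_mono) (auto simp: K_def)
  also have "\<dots> \<le> emeasure law K + (emeasure law {x. p x < q\<^sup>2 * p z} + emeasure law {x. R \<le> norm x})"
    by (intro order_trans[OF emeasure_subadditive] add_left_mono emeasure_subadditive) auto
  also have "emeasure law {x. p x < q\<^sup>2 * p z} \<le> ennreal (1 / 8)"
    by (rule emeasure_outside_level_set) (rule meta_eq_to_obj_eq[OF q_def])
  also have "emeasure law {x. R \<le> norm x} \<le> ennreal (1 / 4)"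
    using chebyshev[OF R] by (simp add: R_def power_mult_distrib)
  also have "emeasure law K \<le> ennreal M * emeasure lborel K"
  proof -
    have "emeasure law K \<le> (\<integral>\<^sup>+x. ennreal M * indicator K x \<partial>lborel)"
      using M by (subst emeasure_density) (auto split: split_indicator intro!: nn_integral_mono ennreal_leI)
    then show ?thesis by (simp add: nn_integral_cmult_indicator)
  qed
  finally have "1 \<le> ennreal M * emeasure lborel K + (ennreal (1 / 8) + ennreal (1 / 4))"
    by (simp add: add_mono)
  moreover have fin: "emeasure lborel K \<noteq> \<infinity>"
    using emeasure_mono[of K "cball 0 R" lborel] emeasure_lborel_cball_finite[of "0 :: real ^ 'd" R]
    by (auto simp: K_def top_unique)
  moreover have "ennreal (1 / 8) + ennreal (1 / 4) = ennreal (3 / 8)"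
    by (subst ennreal_plus[symmetric]) auto
  ultimately have "ennreal 1 \<le> ennreal (M * measure lborel K + 3 / 8)"
    using M by (simp add: emeasure_eq_ennreal_measure ennreal_mult ennreal_plus)
  then have volK: "1 / (2 * M) \<le> measure lborel K"
    using M by (subst (asm) ennreal_le_iff) (auto simp: field_simps)
  define r where "r = (norm x - R) / 2"
  have r: "0 < r" using x by (simp add: r_def)
  have "ennreal (sqrt (p x * (q\<^sup>2 * p z)) / 2 ^ CARD('d)) * ennreal (1 / (2 * M))
      \<le> ennreal (sqrt (p x * (q\<^sup>2 * p z)) / 2 ^ CARD('d)) * emeasure lborel K"
    using volK fin by (intro mult_left_mono) (auto simp: emeasure_eq_ennreal_measure intro!: ennreal_leI)
  also have "\<dots> \<le> emeasure law {w. r \<le> norm w}"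
  proof (intro emeasure_law_midpoints)
    fix u assume "u \<in> K"
    then have "norm u \<le> R" by (simp add: K_def)
    then show "(1 / 2) *\<^sub>R (x + u) \<in> {w. r \<le> norm w}"
      using norm_diff_ineq[of x u] by (simp add: r_def)
  qed (auto simp: K_def)
  also have "\<dots> \<le> ennreal (real CARD('d) / r\<^sup>2)"
    by (rule chebyshev[OF r])
  finally have "sqrt (p x * (q\<^sup>2 * p z)) / 2 ^ CARD('d) * (1 / (2 * M)) \<le> real CARD('d) / r\<^sup>2"
    using M by (simp add: ennreal_mult[symmetric] zero_le_divide_iff)
  then have "sqrt (p x * (q\<^sup>2 * p z)) \<le> 2 ^ CARD('d) * 2 * M * real CARD('d) / r\<^sup>2"
    using M r by (simp add: field_simps)
  then have "p x * (q\<^sup>2 * p z) \<le> (2 ^ CARD('d) * 2 * M * real CARD('d) / r\<^sup>2)\<^sup>2"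
    by (rule sqrt_le_D)
  moreover have "p x * (q\<^sup>2 * m) \<le> p x * (q\<^sup>2 * p z)"
    using z by (intro mult_left_mono) auto
  ultimately have "p x \<le> (2 ^ CARD('d) * 2 * M * real CARD('d) / r\<^sup>2)\<^sup>2 / (q\<^sup>2 * m)"
    using z q by (subst pos_le_divide_eq) auto
  also have "2 ^ CARD('d) * 2 * M * real CARD('d) / r\<^sup>2 = 2 ^ CARD('d) * 8 * M * real CARD('d) / (norm x - R)\<^sup>2"
    by (simp add: r_def power_divide)
  finally show ?thesis
    by (simp add: power_divide field_simps)
qed

text \<open>On the ray from z through y, ln p is concave and has dropped by at least ln 2 at
  distance L + R from z; further out it stays below the line with that slope. Since norm z \<le> R,
  distance L + R from z means norm at least L, where \<open>far\<close> applies.\<close>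

lemma ray_decay:
  assumes far: "\<And>x. L \<le> norm x \<Longrightarrow> p x \<le> p z / 2" and z: "0 < p z" "norm z \<le> R" and L: "0 < L + R"
    and y: "L + R \<le> norm (y - z)"
  shows "p y \<le> p z * exp (- (ln 2 / (L + R)) * norm (y - z))"
proof (cases "p y = 0")
  case False
  then have py: "0 < p y" using nonneg[of y] by linarith
  define t where "t = (L + R) / norm (y - z)"
  have "0 < norm (y - z)" using L y by linarith
  then have t: "0 < t" "t \<le> 1" using L y by (simp_all add: t_def)
  define x where "x = (1 - t) *\<^sub>R z + t *\<^sub>R y"
  have "x - z = t *\<^sub>R (y - z)" by (simp add: x_def algebra_simps)
  then have "norm (x - z) = L + R" using t L y \<open>0 < norm (y - z)\<close> by (simp add: t_def)
  then have "L \<le> norm x" using z norm_triangle_ineq4[of x z] by linarith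
  from far[OF this] have px: "p x \<le> p z / 2" .
  have "p z powr (1 - t) * p y powr t \<le> p x"
  proof (cases "t = 1")
    case True
    then show ?thesis using z py by (simp add: x_def)
  next
    case False
    then show ?thesis using t interpolate unfolding x_def by auto
  qed
  with px have "p z powr (1 - t) * p y powr t \<le> p z / 2" by linarith
  then have "ln (p z powr (1 - t) * p y powr t) \<le> ln (p z / 2)"
    using z py by (subst ln_le_cancel_iff) auto
  then have "t * ln (p y) \<le> t * ln (p z) - ln 2"
    using z py by (simp add: ln_mult ln_div ln_powr algebra_simps)
  then have "ln (p y) \<le> ln (p z) - ln 2 / t"
    using t by (simp add: field_simps)
  then have "p y \<le> exp (ln (p z) - ln 2 / t)"
    using py by (metis exp_le_cancel_iff exp_ln)
  also have "\<dots> = p z * exp (- (ln 2 / (L + R)) * norm (y - z))"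
    using z by (simp add: exp_diff exp_minus t_def field_simps)
  finally show ?thesis .
qed (use z in simp)

end

theorem isotropic_density_exponential_decay:
  "\<exists>A a. 0 < A \<and> 0 < a \<and> (\<forall>p :: real ^ 'd \<Rightarrow> real. isotropic_density p \<longrightarrow> (\<forall>x. p x \<le> A * exp (- a * norm x)))"
proof -
  obtain M where M: "0 < M" "\<And>p :: real ^ 'd \<Rightarrow> real. \<And>x. isotropic_density p \<Longrightarrow> p x \<le> M"
    using isotropic_density_bounded by blast
  define R where "R = 2 * sqrt (real CARD('d))"
  define m where "m = 1 / (2 * measure lborel (cball (0 :: real ^ 'd) R))"
  define q :: real where "q = (1 / 2) ^ (CARD('d) + 3)"
  define c where "c = (2 ^ CARD('d) * 8 * M * real CARD('d))\<^sup>2 / (q\<^sup>2 * m)"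
  \<comment> \<open>Beyond radius L one has c / (norm x - R)^4 \<le> m / 2 \<le> p z / 2. The
    summand 1 makes norm x - R at least 1, so that its fourth power dominates it.\<close>
  define L where "L = R + (1 + 2 * c / m)"
  define a where "a = ln 2 / (L + R)"
  have R: "0 < R" by (simp add: R_def)
  have m: "0 < m" unfolding m_def using content_cball_pos[OF R, of "0 :: real ^ 'd"] by simp
  have q: "0 < q" by (simp add: q_def)
  have c: "0 < c" using M m q by (simp add: c_def)
  have L: "0 < L" using R c m by (simp add: L_def add_pos_pos)
  have a: "0 < a" using R L by (simp add: a_def)
  have "p y \<le> 2 * M * exp (a * R) * exp (- a * norm y)" if p: "isotropic_density p" for p :: "real ^ 'd \<Rightarrow> real" and y
  proof -
    interpret isotropic_density p by fact
    obtain z where z: "m \<le> p z" "norm z \<le> R"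
      using central_point unfolding R_def m_def by blast
    have far: "p x \<le> p z / 2" if "L \<le> norm x" for x
    proof -
      have "1 \<le> 1 + 2 * c / m" using c m by simp
      have s: "1 + 2 * c / m \<le> norm x - R" using that by (simp add: L_def)
      have pos: "0 < (norm x - R) ^ 4"
        by (rule zero_less_power) (use s \<open>1 \<le> 1 + 2 * c / m\<close> in linarith)
      have "2 * c / m \<le> norm x - R" using s by simp
      also have "norm x - R \<le> (norm x - R) ^ 4"
        using s \<open>1 \<le> 1 + 2 * c / m\<close> by (intro self_le_power) auto
      finally have "c / (norm x - R) ^ 4 \<le> m / 2"
        using m pos by (simp add: field_simps)
      moreover have "p x \<le> c / (norm x - R) ^ 4"
        unfolding c_def q_def R_def
        by (rule far_density_small[OF M(2)[OF p] M(1) z(1) m]) (use s \<open>1 \<le> 1 + 2 * c / m\<close> in \<open>simp add: R_def\<close>)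
      ultimately show ?thesis using z(1) by linarith
    qed
    have "p y \<le> 2 * M * exp (- a * norm (y - z))"
    proof (cases "L + R \<le> norm (y - z)")
      case True
      have "p y \<le> p z * exp (- a * norm (y - z))"
        unfolding a_def using far z m L R True by (intro ray_decay) auto
      also have "\<dots> \<le> 2 * M * exp (- a * norm (y - z))"
        using M(2)[OF p, of z] M(1) by (intro mult_right_mono) auto
      finally show ?thesis .
    next
      case False
      \<comment> \<open>Within distance L + R of z the exponential is at least 1/2 by the choice of
        \<open>a\<close>, so the plain bound M suffices once the constant is doubled.\<close>
      then have "a * norm (y - z) \<le> ln 2"
        using mult_left_mono[of "norm (y - z)" "L + R" a] a L R by (simp add: a_def)
      then have "exp (- ln 2) \<le> exp (- a * norm (y - z))" by simp
      then have "1 \<le> 2 * exp (- a * norm (y - z))" by (simp add: exp_minus)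
      then have "M * 1 \<le> M * (2 * exp (- a * norm (y - z)))"
        using M(1) by (intro mult_left_mono) auto
      with M(2)[OF p, of y] show ?thesis by simp
    qed
    also have "\<dots> \<le> 2 * M * (exp (a * R) * exp (- a * norm y))"
    proof -
      have "norm y - R \<le> norm (y - z)" using z norm_triangle_ineq2[of y z] by linarith
      then have "- (a * norm (y - z)) \<le> a * R + - (a * norm y)"
        using mult_left_mono[of "norm y - R" "norm (y - z)" a] a by (simp add: algebra_simps)
      then show ?thesis
        unfolding exp_add[symmetric] using M(1) by (intro mult_left_mono) auto
    qed
    finally show ?thesis by (simp add: mult.assoc)
  qed
  with M(1) a show ?thesis
    by (intro exI[of _ "2 * M * exp (a * R)"] exI[of _ a]) auto
qed

section \<open>Characteristic functions and Gaussian smoothing\<close>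

lemma has_bochner_integral_lborel_prod:
  fixes f :: "'a::euclidean_space \<Rightarrow> real \<Rightarrow> 'b::{real_normed_field, banach, second_countable_topology}"
  assumes "\<And>b. b \<in> Basis \<Longrightarrow> has_bochner_integral lborel (f b) (I b)"
  shows "has_bochner_integral lborel (\<lambda>x :: 'a. \<Prod>b\<in>Basis. f b (x \<bullet> b)) (\<Prod>b\<in>Basis. I b)"
proof -
  interpret product_sigma_finite "\<lambda>_ :: 'a. lborel :: real measure" ..
  have int: "integrable lborel (f b)" and eq: "integral\<^sup>L lborel (f b) = I b" if "b \<in> Basis" for b
    using assms[OF that] by (auto simp: has_bochner_integral_iff)
  have [measurable]: "(\<lambda>x :: 'a. \<Prod>b\<in>Basis. f b (x \<bullet> b)) \<in> borel_measurable borel"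
  proof (intro borel_measurable_prod)
    fix b :: 'a assume "b \<in> Basis"
    from borel_measurable_integrable[OF int[OF this]] have [measurable]: "f b \<in> borel_measurable borel" by simp
    show "(\<lambda>x. f b (x \<bullet> b)) \<in> borel_measurable borel" by measurable
  qed
  have coord: "(\<Prod>b\<in>Basis. f b ((\<Sum>c\<in>Basis. x c *\<^sub>R c) \<bullet> b)) = (\<Prod>b\<in>Basis. f b (x b))" for x :: "'a \<Rightarrow> real"
    by (intro prod.cong) auto
  show ?thesis
    unfolding has_bochner_integral_iff
  proof
    show "integrable lborel (\<lambda>x :: 'a. \<Prod>b\<in>Basis. f b (x \<bullet> b))"
      using product_integrable_prod[OF finite_Basis int]
      by (subst lborel_eq) (simp add: integrable_distr_eq coord)
    show "integral\<^sup>L lborel (\<lambda>x :: 'a. \<Prod>b\<in>Basis. f b (x \<bullet> b)) = (\<Prod>b\<in>Basis. I b)"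
      using product_integral_prod[OF finite_Basis int]
      by (subst lborel_eq) (simp add: integral_distr coord eq)
  qed
qed

lemma prod_Basis_const: "(\<Prod>b\<in>(Basis :: (real ^ 'd) set). c) = (c :: 'b :: comm_monoid_mult) ^ CARD('d)"
  by simp

lemma std_gaussian_density_prod:
  fixes x :: "real ^ 'd"
  shows "std_gaussian_density x = (\<Prod>b\<in>Basis. std_normal_density (x \<bullet> b))"
proof -
  have "(norm x)\<^sup>2 = (\<Sum>b\<in>Basis. (x \<bullet> b)\<^sup>2)"
    by (subst power2_norm_eq_inner, subst euclidean_inner) (simp add: power2_eq_square)
  then have "exp (- (norm x)\<^sup>2 / 2) = (\<Prod>b\<in>Basis. exp (- (x \<bullet> b)\<^sup>2 / 2))"
    by (simp add: exp_sum[symmetric] sum_negf sum_divide_distrib)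
  moreover have "(1 / sqrt (2 * pi)) ^ CARD('d) = (2 * pi) powr (- real CARD('d) / 2)"
    by (simp add: powr_half_sqrt[symmetric] powr_minus_divide[symmetric] powr_power)
  ultimately show ?thesis
    unfolding std_gaussian_density_def std_normal_density_def prod.distrib prod_Basis_const by (simp only:)
qed

lemma std_gaussian_density_nonneg[simp]: "0 \<le> std_gaussian_density x"
  by (simp add: std_gaussian_density_def)

lemma measurable_std_gaussian_density[measurable]: "std_gaussian_density \<in> borel_measurable borel"
  unfolding std_gaussian_density_def by measurable

lemma std_gaussian_density_le: "std_gaussian_density (x :: real ^ 'd) \<le> (2 * pi) powr (- real CARD('d) / 2)"
  unfolding std_gaussian_density_def by (intro mult_left_le) auto

lemma has_bochner_integral_std_normal_iexp:
  "has_bochner_integral lborel (\<lambda>x. std_normal_density x *\<^sub>R iexp (x * s)) (of_real (exp (- s\<^sup>2 / 2)))"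
proof -
  have "integrable lborel (\<lambda>x. std_normal_density x *\<^sub>R iexp (x * s))"
    by (rule Bochner_Integration.integrable_bound[OF integrable_normal_density[of 1 0]])
       (auto simp del: of_real_mult)
  moreover have "(\<integral>x. std_normal_density x *\<^sub>R iexp (x * s) \<partial>lborel) = char std_normal_distribution s"
    unfolding char_def by (subst integral_density) (auto simp: mult.commute)
  ultimately show ?thesis
    by (simp add: has_bochner_integral_iff char_std_normal_distribution)
qed

lemma has_bochner_integral_std_gaussian_iexp:
  fixes y :: "real ^ 'd"
  shows "has_bochner_integral lborel (\<lambda>t. std_gaussian_density t *\<^sub>R iexp (t \<bullet> y)) (of_real (exp (- (norm y)\<^sup>2 / 2)))"
proof -
  have "has_bochner_integral lborel (\<lambda>t. \<Prod>b\<in>Basis. std_normal_density (t \<bullet> b) *\<^sub>R iexp ((t \<bullet> b) * (y \<bullet> b)))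
      (\<Prod>b\<in>Basis. of_real (exp (- (y \<bullet> b)\<^sup>2 / 2)))"
    by (intro has_bochner_integral_lborel_prod has_bochner_integral_std_normal_iexp)
  moreover have "(\<Prod>b\<in>Basis. std_normal_density (t \<bullet> b) *\<^sub>R iexp ((t \<bullet> b) * (y \<bullet> b)))
      = std_gaussian_density t *\<^sub>R iexp (t \<bullet> y)" for t
    by (subst euclidean_inner[of t y])
       (simp add: std_gaussian_density_prod scaleR_conv_of_real prod.distrib sum_distrib_left exp_sum)
  moreover have "(\<Prod>b\<in>Basis. of_real (exp (- (y \<bullet> b)\<^sup>2 / 2))) = (of_real (exp (- (norm y)\<^sup>2 / 2)) :: complex)"
    by (subst power2_norm_eq_inner, subst euclidean_inner[of y y])
       (simp add: exp_sum[symmetric] sum_negf sum_divide_distrib power2_eq_square flip: of_real_prod)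
  ultimately show ?thesis by (simp only:)
qed

lemma has_bochner_integral_std_gaussian:
  "has_bochner_integral lborel (std_gaussian_density :: real ^ 'd \<Rightarrow> real) 1"
  using has_bochner_integral_std_gaussian_iexp[of "0 :: real ^ 'd"]
  by (auto simp: has_bochner_integral_iff scaleR_conv_of_real complex_of_real_integrable_eq)

text \<open>For e > 0 this is the characteristic function of the centred Gaussian law with
  covariance e^2 I, and \<open>gauss_kernel e\<close> below is its density: damping by the weight in
  frequency is convolution with the kernel in space.\<close>

definition gauss_weight :: "real \<Rightarrow> real ^ 'd \<Rightarrow> real" where
  "gauss_weight e t = exp (- (e * norm t)\<^sup>2 / 2)"

definition gauss_kernel :: "real \<Rightarrow> real ^ 'd \<Rightarrow> real" where
  "gauss_kernel e x = std_gaussian_density (x /\<^sub>R e) / e ^ CARD('d)"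

lemma measurable_gauss[measurable]:
  "gauss_weight e \<in> borel_measurable borel" "gauss_kernel e \<in> borel_measurable borel"
  unfolding gauss_weight_def[abs_def] gauss_kernel_def[abs_def] by measurable

lemma gauss_weight_nonneg[simp]: "0 \<le> gauss_weight e t"
  by (simp add: gauss_weight_def)

lemma gauss_weight_le_1[simp]: "gauss_weight e t \<le> 1"
  by (simp add: gauss_weight_def)

lemma gauss_kernel_nonneg[simp]: "0 < e \<Longrightarrow> 0 \<le> gauss_kernel e x"
  by (simp add: gauss_kernel_def)

lemma gauss_kernel_le:
  "0 < e \<Longrightarrow> gauss_kernel e (x :: real ^ 'd) \<le> (2 * pi) powr (- real CARD('d) / 2) / e ^ CARD('d)"
  unfolding gauss_kernel_def by (intro divide_right_mono std_gaussian_density_le) auto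

lemma has_bochner_integral_gauss_weight_iexp:
  fixes y :: "real ^ 'd"
  assumes "0 < e"
  shows "has_bochner_integral lborel (\<lambda>t. gauss_weight e t *\<^sub>R iexp (t \<bullet> y))
    (of_real ((2 * pi) ^ CARD('d) * gauss_kernel e y))"
proof -
  \<comment> \<open>c^2 = (2 pi)^d: one factor c turns the Gaussian density in t into the
    unnormalised weight, the other turns the resulting exponential into a Gaussian density in
    y.\<close>
  define c where "c = (2 * pi) powr (real CARD('d) / 2)"
  have c: "0 < c" "c * (2 * pi) powr (- real CARD('d) / 2) = 1" "c * c = (2 * pi) ^ CARD('d)"
    by (simp_all add: c_def powr_add[symmetric] powr_realpow)
  have "has_bochner_integral lborel (\<lambda>t. c *\<^sub>R (std_gaussian_density (0 + e *\<^sub>R t) *\<^sub>R iexp ((0 + e *\<^sub>R t) \<bullet> (y /\<^sub>R e))))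
      (c *\<^sub>R (complex_of_real (exp (- (norm (y /\<^sub>R e))\<^sup>2 / 2)) /\<^sub>R \<bar>e\<bar> ^ DIM(real ^ 'd)))"
    using assms by (intro has_bochner_integral_scaleR_right has_bochner_integral_lborel_affine
        has_bochner_integral_std_gaussian_iexp) auto
  moreover have "c *\<^sub>R (std_gaussian_density (0 + e *\<^sub>R t) *\<^sub>R iexp ((0 + e *\<^sub>R t) \<bullet> (y /\<^sub>R e)))
      = gauss_weight e t *\<^sub>R iexp (t \<bullet> y)" for t
  proof -
    have "c * std_gaussian_density (0 + e *\<^sub>R t) = gauss_weight e t"
      using assms c(2) unfolding std_gaussian_density_def gauss_weight_def mult.assoc[symmetric] by simp
    moreover have "(0 + e *\<^sub>R t) \<bullet> (y /\<^sub>R e) = t \<bullet> y" using assms by simp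
    ultimately show ?thesis unfolding scaleR_scaleR by (simp only:)
  qed
  moreover have "c *\<^sub>R (complex_of_real (exp (- (norm (y /\<^sub>R e))\<^sup>2 / 2)) /\<^sub>R \<bar>e\<bar> ^ DIM(real ^ 'd))
      = of_real ((2 * pi) ^ CARD('d) * gauss_kernel e y)"
  proof -
    define E where "E = exp (- (norm (y /\<^sub>R e))\<^sup>2 / 2)"
    have "(2 * pi) ^ CARD('d) * gauss_kernel e y = c * (c * (2 * pi) powr (- real CARD('d) / 2)) * E / e ^ CARD('d)"
      unfolding c(3)[symmetric] gauss_kernel_def std_gaussian_density_def E_def[symmetric]
      by (simp only: times_divide_eq_right mult.assoc)
    also have "\<dots> = c * E / e ^ CARD('d)" unfolding c(2) by simp
    finally show ?thesis
      unfolding E_def[symmetric] using assms by (simp add: scaleR_conv_of_real divide_inverse)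
  qed
  ultimately show ?thesis by (simp only:)
qed

lemma integrable_gauss_weight: "0 < e \<Longrightarrow> integrable lborel (gauss_weight e :: real ^ 'd \<Rightarrow> real)"
  using has_bochner_integral_gauss_weight_iexp[of e "0 :: real ^ 'd"]
  by (auto simp: has_bochner_integral_iff scaleR_conv_of_real complex_of_real_integrable_eq)

lemma integrable_gauss_weight_bounded:
  fixes f :: "real ^ 'd \<Rightarrow> complex"
  assumes "0 < e" "f \<in> borel_measurable borel" "\<And>t. cmod (f t) \<le> B"
  shows "integrable lborel (\<lambda>t. gauss_weight e t *\<^sub>R f t)"
proof (rule Bochner_Integration.integrable_bound)
  show "integrable lborel (\<lambda>t :: real ^ 'd. gauss_weight e t * B)"
    using integrable_gauss_weight[OF assms(1), where 'd='d] by simp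
  have "\<bar>gauss_weight e t\<bar> * cmod (f t) \<le> \<bar>gauss_weight e t * B\<bar>" for t
    using assms(3)[of t] by (auto simp: abs_mult intro!: mult_left_mono)
  then show "AE t in lborel. norm (gauss_weight e t *\<^sub>R f t) \<le> norm (gauss_weight e t * B)"
    by simp
qed (use assms in measurable)

lemma has_bochner_integral_gauss_kernel:
  assumes "0 < e"
  shows "has_bochner_integral lborel (\<lambda>x. gauss_kernel e (x - a :: real ^ 'd)) 1"
proof -
  have "has_bochner_integral lborel (\<lambda>x :: real ^ 'd. std_gaussian_density ((- (a /\<^sub>R e)) + (1 / e) *\<^sub>R x) / e ^ CARD('d))
      (1 /\<^sub>R \<bar>1 / e\<bar> ^ DIM(real ^ 'd) / e ^ CARD('d))"
    using assms by (intro has_bochner_integral_divide_zero has_bochner_integral_lborel_affine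
        has_bochner_integral_std_gaussian) auto
  moreover have "- (a /\<^sub>R e) + (1 / e) *\<^sub>R x = (x - a) /\<^sub>R e" for x
    by (simp add: scaleR_diff_right divide_inverse)
  ultimately show ?thesis
    using assms by (simp add: gauss_kernel_def power_one_over)
qed


section \<open>Characteristic functions of probability laws on real^d\<close>

definition char_vec :: "(real ^ 'd) measure \<Rightarrow> real ^ 'd \<Rightarrow> complex" where
  "char_vec N t = (CLINT y|N. iexp (t \<bullet> y))"

lemma measurable_char_vec[measurable]:
  assumes "sigma_finite_measure N" "sets N = sets borel"
  shows "char_vec N \<in> borel_measurable borel"
proof -
  interpret sigma_finite_measure N by fact
  note assms(2)[measurable_cong]
  show ?thesis
    unfolding char_vec_def[abs_def] by measurable
qed

locale vec_distribution = prob_space N for N :: "(real ^ 'd) measure" +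
  assumes sets_N[measurable_cong, simp]: "sets N = sets borel"
begin

lemma char_vec_measurable[measurable]: "char_vec N \<in> borel_measurable borel"
  by (intro measurable_char_vec sigma_finite_measure_axioms sets_N)

lemma integrable_iexp_inner: "integrable N (\<lambda>y. iexp (t \<bullet> y))"
  by (intro integrable_const_bound[of _ 1]) auto

lemma cmod_char_vec_le_1: "cmod (char_vec N t) \<le> 1"
proof -
  have "norm (char_vec N t) \<le> (\<integral>y. norm (iexp (t \<bullet> y)) \<partial>N)"
    unfolding char_vec_def by (rule integral_norm_bound)
  also have "\<dots> = 1" by (simp add: prob_space)
  finally show ?thesis .
qed

lemma cnj_char_vec: "cnj (char_vec N t) = char_vec N (- t)"
  unfolding char_vec_def integral_bounded_linear[OF bounded_linear_cnj integrable_iexp_inner, symmetric]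
  by (simp add: exp_cnj)

lemma integrable_gauss_kernel: "0 < e \<Longrightarrow> integrable N (\<lambda>y. gauss_kernel e (y - x))"
  by (intro integrable_const_bound[of _ "(2 * pi) powr (- real CARD('d) / 2) / e ^ CARD('d)"] AE_I2)
     (simp_all only: real_norm_def abs_of_nonneg gauss_kernel_nonneg gauss_kernel_le, measurable)

text \<open>Fourier inversion for the convolution of N with \<open>gauss_kernel e\<close>, whose
  density at x is the integral on the right. The weight makes the integrand jointly integrable in t
  and y, so Fubini applies and the inner integral over t is Gaussian.\<close>

lemma smoothing_identity:
  assumes e: "0 < e"
  shows "(CLINT t|lborel. gauss_weight e t *\<^sub>R (iexp (- (t \<bullet> x)) * char_vec N t))
    = of_real ((2 * pi) ^ CARD('d) * (\<integral>y. gauss_kernel e (y - x) \<partial>N))"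
proof -
  interpret P: pair_sigma_finite lborel N
    by unfold_locales
  let ?F = "\<lambda>t y. gauss_weight e t *\<^sub>R iexp (t \<bullet> (y - x))"
  have int: "integrable (lborel \<Otimes>\<^sub>M N) (\<lambda>(t, y). ?F t y)"
  proof (rule P.Fubini_integrable)
    show "(\<lambda>(t, y). ?F t y) \<in> borel_measurable (lborel \<Otimes>\<^sub>M N)" by measurable
    show "integrable lborel (\<lambda>t. \<integral>y. norm (case (t, y) of (t, y) \<Rightarrow> ?F t y) \<partial>N)"
      using integrable_gauss_weight[OF e, where 'd='d] by (simp add: prob_space)
    show "AE t in lborel. integrable N (\<lambda>y. case (t, y) of (t, y) \<Rightarrow> ?F t y)"
      by (auto intro!: AE_I2 integrable_const_bound[of _ 1])
  qed
  have "(CLINT t|lborel. gauss_weight e t *\<^sub>R (iexp (- (t \<bullet> x)) * char_vec N t))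
      = (CLINT t|lborel. (CLINT y|N. ?F t y))"
  proof (intro Bochner_Integration.integral_cong refl)
    fix t
    have "?F t y = gauss_weight e t *\<^sub>R (iexp (- (t \<bullet> x)) * iexp (t \<bullet> y))" for y
      unfolding exp_add[symmetric] by (simp add: inner_diff_right algebra_simps)
    then show "gauss_weight e t *\<^sub>R (iexp (- (t \<bullet> x)) * char_vec N t) = (CLINT y|N. ?F t y)"
      by (simp only: char_vec_def integral_scaleR_right integral_mult_right_zero)
  qed
  also have "\<dots> = (CLINT y|N. (CLINT t|lborel. ?F t y))"
    using P.Fubini_integral[OF int] by simp
  also have "\<dots> = (CLINT y|N. of_real ((2 * pi) ^ CARD('d) * gauss_kernel e (y - x)))"
    by (intro Bochner_Integration.integral_cong refl has_bochner_integral_integral_eq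
        has_bochner_integral_gauss_weight_iexp e)
  also have "\<dots> = of_real ((2 * pi) ^ CARD('d) * (\<integral>y. gauss_kernel e (y - x) \<partial>N))"
    by (subst integral_complex_of_real) simp
  finally show ?thesis .
qed

text \<open>Half of Plancherel's identity, for the smoothed density.\<close>

lemma plancherel_le:
  assumes N: "N = density lborel (\<lambda>x. ennreal (p x))" and [measurable]: "p \<in> borel_measurable borel"
    and p: "\<And>x. 0 \<le> p x" "\<And>x. p x \<le> B" and e: "0 < e"
  shows "(\<integral>t. gauss_weight e t * (cmod (char_vec N t))\<^sup>2 \<partial>lborel) \<le> (2 * pi) ^ CARD('d) * B"
proof -
  interpret P: pair_sigma_finite lborel N
    by unfold_locales
  let ?F = "\<lambda>t x. gauss_weight e t *\<^sub>R (iexp (- (t \<bullet> x)) * char_vec N t)"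
  have int: "integrable (lborel \<Otimes>\<^sub>M N) (\<lambda>(t, x). ?F t x)"
  proof (rule P.Fubini_integrable)
    show "(\<lambda>(t, x). ?F t x) \<in> borel_measurable (lborel \<Otimes>\<^sub>M N)" by measurable
    have "integrable lborel (\<lambda>t. gauss_weight e t *\<^sub>R char_vec N t)"
      using e cmod_char_vec_le_1 by (intro integrable_gauss_weight_bounded) auto
    from integrable_norm[OF this]
    show "integrable lborel (\<lambda>t. \<integral>x. norm (case (t, x) of (t, x) \<Rightarrow> ?F t x) \<partial>N)"
      by (simp add: prob_space norm_mult)
    show "AE t in lborel. integrable N (\<lambda>x. case (t, x) of (t, x) \<Rightarrow> ?F t x)"
      using cmod_char_vec_le_1
      by (auto intro!: AE_I2 integrable_const_bound[of _ 1] mult_le_one simp: norm_mult)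
  qed
  have "of_real (\<integral>t. gauss_weight e t * (cmod (char_vec N t))\<^sup>2 \<partial>lborel)
      = (CLINT t|lborel. of_real (gauss_weight e t * (cmod (char_vec N t))\<^sup>2))"
    by (simp only: integral_complex_of_real)
  \<comment> \<open>Only the conjugate factor of |f|^2 is expanded as an integral over N. After
    Fubini this leaves (2 pi)^d times the N-average of the smoothed density, which is at most
    B.\<close>
  also have "\<dots> = (CLINT t|lborel. (CLINT x|N. ?F t x))"
  proof (intro Bochner_Integration.integral_cong refl)
    fix t
    have "(CLINT x|N. ?F t x) = gauss_weight e t *\<^sub>R ((CLINT x|N. iexp (- t \<bullet> x)) * char_vec N t)"
      by (simp only: integral_scaleR_right integral_mult_left_zero inner_minus_left)
    also have "\<dots> = gauss_weight e t *\<^sub>R (cnj (char_vec N t) * char_vec N t)"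
      unfolding cnj_char_vec by (simp add: char_vec_def)
    finally show "of_real (gauss_weight e t * (cmod (char_vec N t))\<^sup>2) = (CLINT x|N. ?F t x)"
      by (simp only: complex_norm_square scaleR_conv_of_real of_real_mult mult.commute[of "cnj _"])
  qed
  also have "\<dots> = (CLINT x|N. (CLINT t|lborel. ?F t x))"
    using P.Fubini_integral[OF int] by simp
  also have "\<dots> = (CLINT x|N. of_real ((2 * pi) ^ CARD('d) * (\<integral>y. gauss_kernel e (y - x) \<partial>N)))"
    by (simp only: smoothing_identity[OF e])
  also have "\<dots> = of_real (\<integral>x. (2 * pi) ^ CARD('d) * (\<integral>y. gauss_kernel e (y - x) \<partial>N) \<partial>N)"
    by (simp only: integral_complex_of_real)
  finally have "(\<integral>t. gauss_weight e t * (cmod (char_vec N t))\<^sup>2 \<partial>lborel)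
      = (\<integral>x. (2 * pi) ^ CARD('d) * (\<integral>y. gauss_kernel e (y - x) \<partial>N) \<partial>N)"
    by (simp only: of_real_eq_iff)
  also have "\<dots> \<le> (\<integral>x. (2 * pi) ^ CARD('d) * B \<partial>N)"
  proof (rule integral_mono')
    show "integrable N (\<lambda>x. (2 * pi) ^ CARD('d) * B)" by simp
    show "0 \<le> (2 * pi) ^ CARD('d) * B" using order_trans[OF p(1) p(2)] by simp
    fix x :: "real ^ 'd"
    have k: "has_bochner_integral lborel (\<lambda>y. B * gauss_kernel e (y - x)) (B * 1)"
      by (intro has_bochner_integral_mult_right has_bochner_integral_gauss_kernel e)
    have "(\<integral>y. gauss_kernel e (y - x) \<partial>N) = (\<integral>y. p y * gauss_kernel e (y - x) \<partial>lborel)"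
      unfolding N using p by (subst integral_density) auto
    also have "\<dots> \<le> (\<integral>y. B * gauss_kernel e (y - x) \<partial>lborel)"
      using k p e order_trans[OF p(1) p(2)] by (intro integral_mono') (auto simp: has_bochner_integral_iff intro!: mult_right_mono)
    also have "\<dots> = B" using k by (simp add: has_bochner_integral_iff)
    finally show "(2 * pi) ^ CARD('d) * (\<integral>y. gauss_kernel e (y - x) \<partial>N) \<le> (2 * pi) ^ CARD('d) * B"
      by simp
  qed
  also have "\<dots> = (2 * pi) ^ CARD('d) * B"
    by (simp add: prob_space)
  finally show ?thesis .
qed

end

text \<open>The phase has modulus 1, so the bound does not depend on x; a comparison in supremum
  norm requires this uniformity.\<close>

lemma smoothed_difference_le:
  fixes N1 N2 :: "(real ^ 'd) measure"
  assumes "vec_distribution N1" "vec_distribution N2" and e: "0 < e"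
  shows "(2 * pi) ^ CARD('d) * \<bar>(\<integral>y. gauss_kernel e (y - x) \<partial>N1) - (\<integral>y. gauss_kernel e (y - x) \<partial>N2)\<bar>
    \<le> (\<integral>t. gauss_weight e t * cmod (char_vec N1 t - char_vec N2 t) \<partial>lborel)"
proof -
  interpret N1: vec_distribution N1 by fact
  interpret N2: vec_distribution N2 by fact
  let ?F = "\<lambda>N t. gauss_weight e t *\<^sub>R (iexp (- (t \<bullet> x)) * char_vec N t)"
  have int: "integrable lborel (?F N1)" "integrable lborel (?F N2)"
    using N1.cmod_char_vec_le_1 N2.cmod_char_vec_le_1
    by (auto intro!: integrable_gauss_weight_bounded[OF e, of _ 1] simp: norm_mult)
  have "(2 * pi) ^ CARD('d) * \<bar>(\<integral>y. gauss_kernel e (y - x) \<partial>N1) - (\<integral>y. gauss_kernel e (y - x) \<partial>N2)\<bar>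
      = cmod (of_real ((2 * pi) ^ CARD('d) * (\<integral>y. gauss_kernel e (y - x) \<partial>N1))
          - of_real ((2 * pi) ^ CARD('d) * (\<integral>y. gauss_kernel e (y - x) \<partial>N2)))"
    unfolding of_real_diff[symmetric] norm_of_real right_diff_distrib[symmetric] by (simp add: abs_mult)
  also have "\<dots> = cmod (CLINT t|lborel. ?F N1 t - ?F N2 t)"
    unfolding N1.smoothing_identity[OF e, symmetric] N2.smoothing_identity[OF e, symmetric]
    by (subst Bochner_Integration.integral_diff[OF int]) simp
  also have "\<dots> \<le> (\<integral>t. cmod (?F N1 t - ?F N2 t) \<partial>lborel)"
    by (rule integral_norm_bound)
  also have "\<dots> = (\<integral>t. gauss_weight e t * cmod (char_vec N1 t - char_vec N2 t) \<partial>lborel)"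
    unfolding scaleR_diff_right[symmetric] right_diff_distrib[symmetric] by (simp add: norm_mult)
  finally show ?thesis .
qed

section \<open>From characteristic functions to densities\<close>

context vec_distribution
begin

text \<open>Fubini and the substitution x = y - e u move the smoothing from the measure to the test
  function, where the limit e \<rightarrow> 0 is a matter of continuity.\<close>

lemma smoothing_test_function:
  fixes h :: "real ^ 'd \<Rightarrow> real"
  assumes h: "integrable lborel h" "\<And>x. \<bar>h x\<bar> \<le> B" and e: "0 < e"
  shows "(\<integral>x. h x * (\<integral>y. gauss_kernel e (y - x) \<partial>N) \<partial>lborel)
    = (\<integral>y. (\<integral>u. h (y - e *\<^sub>R u) * std_gaussian_density u \<partial>lborel) \<partial>N)"
    and "integrable lborel (\<lambda>x. h x * (\<integral>y. gauss_kernel e (y - x) \<partial>N))"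
proof -
  interpret P: pair_sigma_finite lborel N
    by unfold_locales
  have [measurable]: "h \<in> borel_measurable borel"
    using h(1) by (auto dest: borel_measurable_integrable)
  define C where "C = (2 * pi) powr (- real CARD('d) / 2) / e ^ CARD('d)"
  let ?F = "\<lambda>x y. h x * gauss_kernel e (y - x)"
  have bound: "norm (?F x y) \<le> norm (C * h x)" for x y
    using gauss_kernel_le[OF e, of "y - x"] gauss_kernel_nonneg[OF e, of "y - x"]
    unfolding C_def[symmetric] by (simp add: abs_mult mult.commute[of C] mult_left_mono)
  have int: "integrable (lborel \<Otimes>\<^sub>M N) (\<lambda>(x, y). ?F x y)"
  proof (rule P.Fubini_integrable)
    show "(\<lambda>(x, y). ?F x y) \<in> borel_measurable (lborel \<Otimes>\<^sub>M N)" by measurable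
    show "AE x in lborel. integrable N (\<lambda>y. case (x, y) of (x, y) \<Rightarrow> ?F x y)"
      using integrable_gauss_kernel[OF e] by (auto intro!: AE_I2)
    show "integrable lborel (\<lambda>x. \<integral>y. norm (case (x, y) of (x, y) \<Rightarrow> ?F x y) \<partial>N)"
    proof (rule Bochner_Integration.integrable_bound)
      show "integrable lborel (\<lambda>x. C * h x)" using h(1) by simp
      show "AE x in lborel. norm (\<integral>y. norm (case (x, y) of (x, y) \<Rightarrow> ?F x y) \<partial>N) \<le> norm (C * h x)"
      proof (intro AE_I2)
        fix x
        have f1: "0 \<le> (\<integral>y. norm (?F x y) \<partial>N)" by simp
        have f2: "(\<integral>y. norm (?F x y) \<partial>N) \<le> (\<integral>y. norm (C * h x) \<partial>N)"
          by (rule integral_mono'[OF _ bound]) simp_all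
        have f3: "(\<integral>y. norm (C * h x) \<partial>N) = norm (C * h x)"
          by (simp add: prob_space)
        from f1 f2[unfolded f3] show "norm (\<integral>y. norm (case (x, y) of (x, y) \<Rightarrow> ?F x y) \<partial>N) \<le> norm (C * h x)"
          unfolding case_prod_conv by (metis abs_of_nonneg real_norm_def)
      qed
    qed measurable
  qed
  have inner: "(\<integral>x. ?F x y \<partial>lborel) = (\<integral>u. h (y - e *\<^sub>R u) * std_gaussian_density u \<partial>lborel)" for y
  proof -
    have "integrable lborel (\<lambda>x. ?F x y)"
    proof (rule Bochner_Integration.integrable_bound)
      show "integrable lborel (\<lambda>x. C * h x)" using h(1) by simp
    qed (measurable, intro AE_I2 bound)
    then have "has_bochner_integral lborel (\<lambda>x. ?F x y) (\<integral>x. ?F x y \<partial>lborel)"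
      by (rule has_bochner_integral_integrable)
    from has_bochner_integral_lborel_affine[OF this, of "- e" y] e
    have "(\<integral>u. ?F (y + (- e) *\<^sub>R u) y \<partial>lborel) = (\<integral>x. ?F x y \<partial>lborel) / e ^ CARD('d)"
      by (simp add: has_bochner_integral_iff divide_inverse mult.commute)
    moreover have "?F (y + (- e) *\<^sub>R u) y = h (y - e *\<^sub>R u) * std_gaussian_density u / e ^ CARD('d)" for u
      using e by (simp add: gauss_kernel_def)
    ultimately have "(\<integral>u. h (y - e *\<^sub>R u) * std_gaussian_density u \<partial>lborel) / e ^ CARD('d) = (\<integral>x. ?F x y \<partial>lborel) / e ^ CARD('d)"
      by (simp only: integral_divide_zero)
    then show ?thesis using e by simp
  qed
  have "(\<integral>x. h x * (\<integral>y. gauss_kernel e (y - x) \<partial>N) \<partial>lborel) = (\<integral>x. (\<integral>y. ?F x y \<partial>N) \<partial>lborel)"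
    by simp
  also have "\<dots> = (\<integral>y. (\<integral>x. ?F x y \<partial>lborel) \<partial>N)"
    using P.Fubini_integral[OF int] by simp
  finally show "(\<integral>x. h x * (\<integral>y. gauss_kernel e (y - x) \<partial>N) \<partial>lborel)
      = (\<integral>y. (\<integral>u. h (y - e *\<^sub>R u) * std_gaussian_density u \<partial>lborel) \<partial>N)"
    unfolding inner .
  show "integrable lborel (\<lambda>x. h x * (\<integral>y. gauss_kernel e (y - x) \<partial>N))"
    using P.integrable_fst'[OF int] by simp
qed

text \<open>Dominated convergence twice: the inner integral is a Gaussian average of h around y and
  tends to h y by continuity, and it stays below the constant B.\<close>

lemma smoothing_limit:
  fixes h :: "real ^ 'd \<Rightarrow> real"
  assumes h: "continuous_on UNIV h" "\<And>x. \<bar>h x\<bar> \<le> B"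
    and e: "e \<longlonglongrightarrow> 0"
  shows "(\<lambda>k. \<integral>y. (\<integral>u. h (y - e k *\<^sub>R u) * std_gaussian_density u \<partial>lborel) \<partial>N) \<longlonglongrightarrow> (\<integral>y. h y \<partial>N)"
proof -
  have [measurable]: "h \<in> borel_measurable borel"
    using h(1) by (rule borel_measurable_continuous_onI)
  have B: "0 \<le> B" using order_trans[OF abs_ge_zero h(2)] .
  have g: "integrable lborel (\<lambda>u :: real ^ 'd. B * std_gaussian_density u)" 
    "(\<integral>u. B * std_gaussian_density (u :: real ^ 'd) \<partial>lborel) = B"
    using has_bochner_integral_mult_right[OF has_bochner_integral_std_gaussian, of B]
    by (auto simp: has_bochner_integral_iff)
  have bound: "norm (h (y - r *\<^sub>R u) * std_gaussian_density u) \<le> B * std_gaussian_density u" for y r u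
    using h(2) by (simp add: abs_mult mult_right_mono)
  show ?thesis
  proof (rule integral_dominated_convergence[where w="\<lambda>_. B"])
    show "AE y in N. (\<lambda>k. \<integral>u. h (y - e k *\<^sub>R u) * std_gaussian_density u \<partial>lborel) \<longlonglongrightarrow> h y"
    proof (intro AE_I2)
      fix y
      have "(\<lambda>k. \<integral>u. h (y - e k *\<^sub>R u) * std_gaussian_density u \<partial>lborel)
          \<longlonglongrightarrow> (\<integral>u. h (y - 0 *\<^sub>R u) * std_gaussian_density u \<partial>lborel)"
      proof (rule integral_dominated_convergence[where w="\<lambda>u. B * std_gaussian_density u"])
        show "AE u in lborel. (\<lambda>k. h (y - e k *\<^sub>R u) * std_gaussian_density u) \<longlonglongrightarrow> h (y - 0 *\<^sub>R u) * std_gaussian_density u"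
          using continuous_on_tendsto_compose[OF h(1)]
          by (intro AE_I2 tendsto_mult tendsto_const continuous_on_tendsto_compose[OF h(1)] tendsto_diff tendsto_scaleR e) auto
      qed (use g bound in auto)
      also have "(\<integral>u. h (y - 0 *\<^sub>R u) * std_gaussian_density u \<partial>lborel) = h y"
        by (simp add: has_bochner_integral_integral_eq[OF has_bochner_integral_std_gaussian])
      finally show "(\<lambda>k. \<integral>u. h (y - e k *\<^sub>R u) * std_gaussian_density u \<partial>lborel) \<longlonglongrightarrow> h y" .
    qed
    show "AE y in N. norm (\<integral>u. h (y - e k *\<^sub>R u) * std_gaussian_density u \<partial>lborel) \<le> B" for k
    proof (intro AE_I2)
      fix y
      have "norm (\<integral>u. h (y - e k *\<^sub>R u) * std_gaussian_density u \<partial>lborel) \<le> (\<integral>u. B * std_gaussian_density (u :: real ^ 'd) \<partial>lborel)"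
        using bound g B by (intro order_trans[OF integral_norm_bound integral_mono']) auto
      also note g(2)
      finally show "norm (\<integral>u. h (y - e k *\<^sub>R u) * std_gaussian_density u \<partial>lborel) \<le> B" .
    qed
  qed (simp_all)
qed

end

text \<open>One D bounds the difference of the smoothed densities at every point and for every
  smoothing width, as Fourier inversion provides. The lemmas below carry it over to the unsmoothed
  laws, from continuous functions to compact sets to almost every point.\<close>

locale smoothed_close = N1: vec_distribution N1 + N2: vec_distribution N2
  for N1 N2 :: "(real ^ 'd) measure" +
  fixes D :: real
  assumes close: "\<And>e x. 0 < e \<Longrightarrow> \<bar>(\<integral>y. gauss_kernel e (y - x) \<partial>N1) - (\<integral>y. gauss_kernel e (y - x) \<partial>N2)\<bar> \<le> D"
begin

lemma test_function_close:
  fixes h :: "real ^ 'd \<Rightarrow> real"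
  assumes h: "continuous_on UNIV h" "\<And>x. 0 \<le> h x" "\<And>x. h x \<le> B" "integrable lborel h"
  shows "\<bar>(\<integral>y. h y \<partial>N1) - (\<integral>y. h y \<partial>N2)\<bar> \<le> D * (\<integral>x. h x \<partial>lborel)"
proof -
  define e where "e k = inverse (real (Suc k))" for k
  have e: "e \<longlonglongrightarrow> 0" "0 < e k" for k
    unfolding e_def by (rule LIMSEQ_inverse_real_of_nat) simp
  have hB: "\<bar>h x\<bar> \<le> B" for x using h by simp
  let ?a = "\<lambda>N k. \<integral>y. (\<integral>u. h (y - e k *\<^sub>R u) * std_gaussian_density u \<partial>lborel) \<partial>N"
  have lim: "(\<lambda>k. \<bar>?a N1 k - ?a N2 k\<bar>) \<longlonglongrightarrow> \<bar>(\<integral>y. h y \<partial>N1) - (\<integral>y. h y \<partial>N2)\<bar>"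
    by (intro tendsto_rabs tendsto_diff N1.smoothing_limit[OF h(1) hB e(1)] N2.smoothing_limit[OF h(1) hB e(1)])
  moreover have "\<bar>?a N1 k - ?a N2 k\<bar> \<le> D * (\<integral>x. h x \<partial>lborel)" for k
  proof -
    let ?s = "\<lambda>N x. \<integral>y. gauss_kernel (e k) (y - x) \<partial>N"
    have int: "integrable lborel (\<lambda>x. h x * ?s N1 x)" "integrable lborel (\<lambda>x. h x * ?s N2 x)"
      using N1.smoothing_test_function(2)[OF h(4) hB e(2)] N2.smoothing_test_function(2)[OF h(4) hB e(2)] .
    have "\<bar>?a N1 k - ?a N2 k\<bar> = \<bar>\<integral>x. h x * ?s N1 x - h x * ?s N2 x \<partial>lborel\<bar>"
      unfolding N1.smoothing_test_function(1)[OF h(4) hB e(2), symmetric]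
        N2.smoothing_test_function(1)[OF h(4) hB e(2), symmetric]
      by (subst Bochner_Integration.integral_diff[OF int]) simp
    also have "\<dots> \<le> (\<integral>x. \<bar>h x * ?s N1 x - h x * ?s N2 x\<bar> \<partial>lborel)"
      using integral_norm_bound[of lborel "\<lambda>x. h x * ?s N1 x - h x * ?s N2 x"] by simp
    also have "\<dots> \<le> (\<integral>x. D * h x \<partial>lborel)"
    proof (intro integral_mono integrable_abs Bochner_Integration.integrable_diff int)
      fix x
      show "\<bar>h x * ?s N1 x - h x * ?s N2 x\<bar> \<le> D * h x"
        using mult_left_mono[OF close[OF e(2), of k x] h(2)[of x]] h(2)[of x]
        unfolding right_diff_distrib[symmetric] by (simp add: abs_mult mult.commute)
    qed (use h in simp)
    finally show ?thesis by simp
  qed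
  ultimately show ?thesis
    by (intro LIMSEQ_le_const2) auto
qed

lemma compact_close:
  assumes C: "compact C"
  shows "\<bar>measure N1 C - measure N2 C\<bar> \<le> D * measure lborel C"
\<comment> \<open>\<open>infdist x {}\<close> is 0 by convention, so the functions
  \<open>h k\<close> below approximate the indicator only for nonempty C.\<close>
proof (cases "C = {}")
  case False
  have cl: "closed C" using C by (rule compact_imp_closed)
  obtain r where r: "\<And>x. x \<in> C \<Longrightarrow> norm x \<le> r"
    using compact_imp_bounded[OF C] by (auto simp: bounded_iff)
  \<comment> \<open>Continuous functions equal to 1 on C that vanish from distance 1 / (k + 1) on;
    all live in the ball of radius r + 1, whose indicator W dominates them.\<close>
  define h where "h k x = max 0 (1 - real (Suc k) * infdist x C)" for k x
  define W where "W = (indicator (cball 0 (r + 1)) :: real ^ 'd \<Rightarrow> real)"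
  have cont: "continuous_on UNIV (h k)" for k
    unfolding h_def by (intro continuous_intros)
  then have [measurable]: "h k \<in> borel_measurable borel" for k
    by (rule borel_measurable_continuous_onI)
  have h: "0 \<le> h k x" "h k x \<le> 1" for k x
    by (auto simp: h_def infdist_nonneg)
  have hW: "norm (h k x) \<le> W x" for k x
  proof (cases "norm x \<le> r + 1")
    case True
    then show ?thesis using h by (simp add: W_def)
  next
    case out: False
    obtain c where c: "c \<in> C" "infdist x C = dist x c"
      using infdist_attains_inf[OF cl False] by blast
    have "norm x \<le> norm c + dist x c" 
      using norm_triangle_sub[of x c] by (simp add: dist_norm)
    then have "1 \<le> infdist x C" using r[OF c(1)] c(2) out by simp
    then have "1 * 1 \<le> real (Suc k) * infdist x C" by (intro mult_mono) auto
    then have "h k x = 0" by (simp add: h_def)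
    then show ?thesis by (simp add: W_def)
  qed
  have W: "integrable lborel W"
    unfolding W_def using emeasure_lborel_cball_finite by (auto simp: integrable_indicator_iff)
  have inth: "integrable lborel (h k)" for k
    using hW by (intro Bochner_Integration.integrable_bound[OF W]) (auto intro: order_trans[OF _ abs_ge_self])
  have ptw: "(\<lambda>k. h k x) \<longlonglongrightarrow> indicator C x" for x
  proof (cases "x \<in> C")
    case True
    then show ?thesis by (simp add: h_def infdist_zero)
  next
    case out: False
    then have d: "0 < infdist x C"
      using cl False infdist_pos_not_in_closed by metis
    obtain k0 where "1 / infdist x C < real k0" using reals_Archimedean2 by blast
    then have "h k x = 0" if "k0 \<le> k" for k
    proof -
      have "1 / infdist x C < real (Suc k)" using that \<open>_ < real k0\<close> by simp
      then show ?thesis using d by (simp add: h_def field_simps)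
    qed
    then have "eventually (\<lambda>k. h k x = 0) sequentially"
      by (auto simp: eventually_sequentially)
    then show ?thesis using out by (simp add: tendsto_eventually)
  qed
  have Cm[measurable]: "C \<in> sets borel" using cl by (rule borel_closed)
  have lim: "(\<lambda>k. \<integral>x. h k x \<partial>lborel) \<longlonglongrightarrow> (\<integral>x. indicator C x \<partial>lborel)"
    by (rule integral_dominated_convergence[where w=W]) (use W ptw hW in auto)
  have limN: "(\<lambda>k. \<integral>x. h k x \<partial>N) \<longlonglongrightarrow> measure N C" if "vec_distribution N" for N :: "(real ^ 'd) measure"
  proof -
    interpret vec_distribution N by fact
    have "(\<lambda>k. \<integral>x. h k x \<partial>N) \<longlonglongrightarrow> (\<integral>x. indicator C x \<partial>N)"
      by (rule integral_dominated_convergence[where w="\<lambda>_. 1"]) (use ptw h in auto)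
    then show ?thesis by (simp add: sets_eq_imp_space_eq[OF sets_N])
  qed
  have "\<bar>measure N1 C - measure N2 C\<bar> \<le> D * (\<integral>x. indicator C x \<partial>lborel)"
  proof (rule LIMSEQ_le)
    show "(\<lambda>k. \<bar>(\<integral>x. h k x \<partial>N1) - (\<integral>x. h k x \<partial>N2)\<bar>) \<longlonglongrightarrow> \<bar>measure N1 C - measure N2 C\<bar>"
      by (intro tendsto_rabs tendsto_diff limN N1.vec_distribution_axioms N2.vec_distribution_axioms)
    show "(\<lambda>k. D * (\<integral>x. h k x \<partial>lborel)) \<longlonglongrightarrow> D * (\<integral>x. indicator C x \<partial>lborel)"
      by (intro tendsto_mult tendsto_const lim)
    show "\<exists>K. \<forall>k\<ge>K. \<bar>(\<integral>x. h k x \<partial>N1) - (\<integral>x. h k x \<partial>N2)\<bar> \<le> D * (\<integral>x. h k x \<partial>lborel)"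
      using test_function_close[OF cont h inth] by blast
  qed
  then show ?thesis by simp
qed simp

text \<open>If p1 exceeded p2 + D on a set of positive measure, inner regularity would give a
  compact subset T of positive measure. \<open>compact_close\<close> makes the integral of p1 - p2 -
  D over T nonpositive, although the integrand is positive there.\<close>

lemma AE_density_le:
  assumes N1: "N1 = density lborel (\<lambda>x. ennreal (p1 x))" and N2: "N2 = density lborel (\<lambda>x. ennreal (p2 x))"
    and [measurable]: "p1 \<in> borel_measurable borel" "p2 \<in> borel_measurable borel"
    and nn: "\<And>x. 0 \<le> p1 x" "\<And>x. 0 \<le> p2 x"
  shows "AE x in lborel. p1 x \<le> p2 x + D"
proof -
  \<comment> \<open>Truncation to bounded sets makes the measure finite and the closed set T
    compact.\<close>
  have "AE x in lborel. \<not> (norm x \<le> real r \<and> p2 x + D < p1 x)" for r :: nat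
  proof (rule ccontr)
    assume neg: "\<not> ?thesis"
    define A where "A = {x :: real ^ 'd. norm x \<le> real r \<and> p2 x + D < p1 x}"
    have A[measurable]: "A \<in> sets borel" unfolding A_def by measurable
    then have "A \<notin> null_sets lborel"
      using neg by (auto simp: A_def AE_iff_null_sets)
    then have pos: "0 < emeasure lborel A" using A by (auto simp: null_sets_def zero_less_iff_neq_zero)
    have "emeasure lborel A \<le> emeasure lborel (cball (0 :: real ^ 'd) (real r))"
      by (intro emeasure_mono) (auto simp: A_def)
    then have fin: "emeasure lborel A < \<infinity>"
      by (rule le_less_trans[OF _ emeasure_lborel_cball_finite])
    define m where "m = measure lborel A"
    have mA: "emeasure lborel A = ennreal m"
      unfolding m_def using fin by (intro emeasure_eq_ennreal_measure) auto
    have m: "0 < m" "emeasure lborel A = ennreal m"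
      using pos unfolding mA by simp_all
    \<comment> \<open>What is cut off has measure strictly below that of A, so T is not a null
      set.\<close>
    obtain T where T: "closed T" "T \<subseteq> A" "A - T \<in> lmeasurable" "emeasure lebesgue (A - T) < ennreal m"
    proof (rule sets_lebesgue_inner_closed)
      show "A \<in> sets lebesgue" by simp
      show "0 < m" by (rule m(1))
    qed
    have cT: "compact T"
      using T(1,2) by (auto simp: compact_eq_bounded_closed A_def intro: boundedI[of _ "real r"])
    have Tm[measurable]: "T \<in> sets borel" using T(1) by (rule borel_closed)
    have "T \<notin> null_sets lborel"
    proof
      assume "T \<in> null_sets lborel"
      then have "emeasure lborel (A - T) = emeasure lborel A" by (intro emeasure_Diff_null_set) auto
      with T(4) m(2) show False by simp
    qed
    have finT: "emeasure lborel T < \<infinity>" using cT by (rule emeasure_compact_finite)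
    define F where "F x = indicator T x * (p1 x - p2 x - D)" for x :: "real ^ 'd"
    have meas: "measure N T = (\<integral>x. indicator T x * p x \<partial>lborel)" "integrable lborel (\<lambda>x. indicator T x * p x)"
      if "vec_distribution N" "N = density lborel (\<lambda>x. ennreal (p x))" "p \<in> borel_measurable borel" "\<And>x. 0 \<le> p x"
      for N :: "(real ^ 'd) measure" and p
    proof -
      interpret vec_distribution N by fact
      note that(3)[measurable]
      have "measure N T = (\<integral>x. indicator T x \<partial>N)" by (simp add: sets_eq_imp_space_eq[OF sets_N])
      also have "\<dots> = (\<integral>x. indicator T x * p x \<partial>lborel)"
        unfolding that(2) using that(4) by (subst integral_density) (auto simp: mult.commute)
      finally show "measure N T = (\<integral>x. indicator T x * p x \<partial>lborel)" .
      have "integrable N (indicator T :: _ \<Rightarrow> real)"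
        by (simp add: integrable_indicator_iff less_top[symmetric])
      then show "integrable lborel (\<lambda>x. indicator T x * p x)"
        unfolding that(2) using that(4) by (subst (asm) integrable_density) (auto simp: mult.commute)
    qed
    note m1 = meas[OF N1.vec_distribution_axioms N1 _ nn(1)] and m2 = meas[OF N2.vec_distribution_axioms N2 _ nn(2)]
    have int: "integrable lborel F" "(\<integral>x. F x \<partial>lborel) = measure N1 T - measure N2 T - D * measure lborel T"
    proof -
      have "has_bochner_integral lborel (\<lambda>x. indicator T x * p1 x - indicator T x * p2 x - D * indicator T x)
          (measure N1 T - measure N2 T - D * measure lborel T)"
        using m1 m2 finT by (intro has_bochner_integral_diff has_bochner_integral_mult_right has_bochner_integral_real_indicator)
          (auto simp: has_bochner_integral_iff)
      then show "integrable lborel F" "(\<integral>x. F x \<partial>lborel) = measure N1 T - measure N2 T - D * measure lborel T"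
        by (auto simp: F_def[abs_def] has_bochner_integral_iff algebra_simps)
    qed
    have F: "0 \<le> F x" for x
      using T(2) by (auto simp: F_def A_def split: split_indicator)
    have "(\<integral>x. F x \<partial>lborel) \<le> 0" using compact_close[OF cT] int by simp
    moreover have "0 \<le> (\<integral>x. F x \<partial>lborel)" using F by simp
    ultimately have "(\<integral>x. F x \<partial>lborel) = 0" by (rule order.antisym)
    then have "AE x in lborel. F x = 0"
      by (subst (asm) integral_nonneg_eq_0_iff_AE[OF int(1)]) (simp_all add: F)
    then have "AE x in lborel. x \<notin> T"
      by eventually_elim (use T(2) in \<open>auto simp: F_def A_def split: split_indicator_asm\<close>)
    with \<open>T \<notin> null_sets lborel\<close> show False
      by (simp add: AE_iff_null_sets)
  qed
  then have "AE x in lborel. \<forall>r :: nat. \<not> (norm x \<le> real r \<and> p2 x + D < p1 x)"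
    by (subst AE_all_countable) (rule allI)
  then show ?thesis
    by eventually_elim (meson not_le real_arch_simple)
qed

end

theorem AE_density_close:
  fixes N1 N2 :: "(real ^ 'd) measure"
  assumes "vec_distribution N1" "vec_distribution N2"
    and N1: "N1 = density lborel (\<lambda>x. ennreal (p1 x))" and N2: "N2 = density lborel (\<lambda>x. ennreal (p2 x))"
    and [measurable]: "p1 \<in> borel_measurable borel" "p2 \<in> borel_measurable borel"
    and nn: "\<And>x. 0 \<le> p1 x" "\<And>x. 0 \<le> p2 x"
    and bound: "\<And>e. 0 < e \<Longrightarrow> (\<integral>t. gauss_weight e t * cmod (char_vec N1 t - char_vec N2 t) \<partial>lborel) \<le> (2 * pi) ^ CARD('d) * D"
  shows "AE x in lborel. \<bar>p1 x - p2 x\<bar> \<le> D"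
proof -
  interpret smoothed_close N1 N2 D
  proof (intro smoothed_close.intro smoothed_close_axioms.intro assms)
    fix e :: real and x assume "0 < e"
    have "(2 * pi) ^ CARD('d) * \<bar>(\<integral>y. gauss_kernel e (y - x) \<partial>N1) - (\<integral>y. gauss_kernel e (y - x) \<partial>N2)\<bar> \<le> (2 * pi) ^ CARD('d) * D"
      using smoothed_difference_le[OF assms(1,2) \<open>0 < e\<close>] bound[OF \<open>0 < e\<close>] by (rule order_trans)
    then show "\<bar>(\<integral>y. gauss_kernel e (y - x) \<partial>N1) - (\<integral>y. gauss_kernel e (y - x) \<partial>N2)\<bar> \<le> D"
      by (rule mult_left_le_imp_le) simp
  qed
  interpret sym: smoothed_close N2 N1 D
    by (intro smoothed_close.intro smoothed_close_axioms.intro assms) (subst abs_minus_commute, rule close)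
  have "AE x in lborel. p1 x \<le> p2 x + D"
    by (rule AE_density_le[OF N1 N2 assms(5,6) nn])
  moreover have "AE x in lborel. p2 x \<le> p1 x + D"
    by (rule sym.AE_density_le[OF N2 N1 assms(6,5) nn(2,1)])
  ultimately show ?thesis
    by eventually_elim auto
qed

section \<open>Moments and bounds for characteristic functions\<close>

lemma integrable_exp_abs:
  fixes c :: real
  assumes c: "0 < c"
  shows "integrable lborel (\<lambda>x. exp (- c * \<bar>x\<bar>))"
proof (rule Bochner_Integration.integrable_bound)
  have "prob_space (density lborel (\<lambda>x. ennreal (exponential_density c x)))"
    using prob_space_exponential_density[OF c] .
  then have "(\<integral>\<^sup>+x. ennreal (exponential_density c x) \<partial>lborel) = 1"
    by (auto simp: emeasure_density dest!: prob_space.emeasure_space_1)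
  then have i: "integrable lborel (exponential_density c)"
    using c by (intro integrableI_nonneg) (auto simp: exponential_density_nonneg)
  from lborel_integrable_real_affine[OF this, of "-1" 0] i
  show "integrable lborel (\<lambda>x. (exponential_density c x + exponential_density c (- x)) / c)"
    by simp
  show "AE x in lborel. norm (exp (- c * \<bar>x\<bar>)) \<le> norm ((exponential_density c x + exponential_density c (- x)) / c)"
    using c by (auto intro!: AE_I2 simp: exponential_density_def field_simps abs_if)
qed measurable

lemma integrable_exp_norm:
  assumes a: "0 < a"
  shows "integrable lborel (\<lambda>x :: real ^ 'd. exp (- a * norm x))"
proof (rule Bochner_Integration.integrable_bound)
  \<comment> \<open>Each of the d coordinates is at most the norm in modulus, so with rate a/d per
    coordinate the product over all coordinates dominates exp (- a * norm x).\<close>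
  define c where "c = a / real CARD('d)"
  have c: "0 < c" using a by (simp add: c_def)
  have "has_bochner_integral lborel (\<lambda>x. exp (- c * \<bar>x\<bar>)) (\<integral>x. exp (- c * \<bar>x\<bar>) \<partial>lborel)"
    using integrable_exp_abs[OF c] by (rule has_bochner_integral_integrable)
  from has_bochner_integral_lborel_prod[OF this]
  show "integrable lborel (\<lambda>x :: real ^ 'd. \<Prod>b\<in>Basis. exp (- c * \<bar>x \<bullet> b\<bar>))"
    by (auto simp: has_bochner_integral_iff)
  have "exp (- a * norm x) \<le> (\<Prod>b\<in>Basis. exp (- c * \<bar>x \<bullet> b\<bar>))" for x :: "real ^ 'd"
  proof -
    have "(\<Sum>b\<in>Basis. c * \<bar>x \<bullet> b\<bar>) \<le> (\<Sum>b\<in>(Basis :: (real ^ 'd) set). c * norm x)"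
      using c by (intro sum_mono mult_left_mono Basis_le_norm) auto
    also have "\<dots> = a * norm x" by (simp add: c_def)
    finally show ?thesis by (simp add: exp_sum[symmetric] sum_negf)
  qed
  then show "AE x :: real ^ 'd in lborel. norm (exp (- a * norm x)) \<le> norm (\<Prod>b\<in>Basis. exp (- c * \<bar>x \<bullet> b\<bar>))"
    by (auto intro!: AE_I2 order_trans[OF _ abs_ge_self])
qed measurable

lemma power4_le_exp: "0 \<le> (y :: real) \<Longrightarrow> y ^ 4 \<le> 256 * exp y"
proof -
  assume y: "0 \<le> y"
  have "(y / 4) ^ 4 \<le> (exp (y / 4)) ^ 4"
  proof (rule power_mono)
    show "y / 4 \<le> exp (y / 4)" using exp_ge_add_one_self[of "y / 4"] by linarith
  qed (use y in simp)
  also have "\<dots> = exp y"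
    by (simp add: exp_of_nat_mult[symmetric])
  finally show ?thesis by (simp add: power_divide)
qed

lemma integrable_power4_exp_norm:
  assumes a: "0 < a"
  shows "integrable lborel (\<lambda>x :: real ^ 'd. (norm x) ^ 4 * exp (- a * norm x))"
proof (rule Bochner_Integration.integrable_bound)
  \<comment> \<open>Half of the exponential rate pays for the fourth power, via
    \<open>power4_le_exp\<close> at a/2 * norm x; the other half keeps the bound integrable.\<close>
  define K where "K = 256 * (2 / a) ^ 4"
  have K: "0 < K" using a by (simp add: K_def)
  show "integrable lborel (\<lambda>x :: real ^ 'd. K * exp (- (a / 2) * norm x))"
    using a by (intro integrable_mult_right integrable_exp_norm) simp
  have "(norm x) ^ 4 * exp (- a * norm x) \<le> K * exp (- (a / 2) * norm x)" for x :: "real ^ 'd"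
  proof -
    have "(a / 2 * norm x) ^ 4 \<le> 256 * exp (a / 2 * norm x)"
      using a by (intro power4_le_exp) simp
    then have "(norm x) ^ 4 \<le> K * exp (a / 2 * norm x)"
      using a by (simp add: K_def power_mult_distrib power_divide field_simps)
    then have "(norm x) ^ 4 * exp (- a * norm x) \<le> K * exp (a / 2 * norm x) * exp (- a * norm x)"
      by (rule mult_right_mono) simp
    also have "\<dots> = K * exp (- (a / 2) * norm x)"
      by (simp add: mult.assoc exp_add[symmetric])
    finally show ?thesis .
  qed
  then show "AE x :: real ^ 'd in lborel. norm ((norm x) ^ 4 * exp (- a * norm x)) \<le> norm (K * exp (- (a / 2) * norm x))"
    using K by (auto intro!: AE_I2 simp: abs_mult)
qed measurable

lemma integrable_power_gauss:
  assumes m: "m \<le> 4"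
  shows "integrable lborel (\<lambda>t :: real ^ 'd. (norm t) ^ m * exp (- (norm t)\<^sup>2 / 8))"
proof (rule Bochner_Integration.integrable_bound)
  show "integrable lborel (\<lambda>t :: real ^ 'd. exp 8 * (exp (- norm t) + norm t ^ 4 * exp (- norm t)))"
    using integrable_power4_exp_norm[of 1, where 'd='d] integrable_exp_norm[of 1, where 'd='d] by simp
  have "(norm t) ^ m * exp (- (norm t)\<^sup>2 / 8) \<le> exp 8 * (exp (- norm t) + norm t ^ 4 * exp (- norm t))" for t :: "real ^ 'd"
  proof -
    have "(norm t) ^ m \<le> 1 + (norm t) ^ 4"
    proof (cases "norm t \<le> 1")
      case True
      then have "(norm t) ^ m \<le> 1" by (intro power_le_one) auto
      then show ?thesis by (simp add: add_increasing2)
    next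
      case False
      then have "(norm t) ^ m \<le> (norm t) ^ 4" using m by (intro power_increasing) auto
      then show ?thesis by simp
    qed
    moreover have "exp (- (norm t)\<^sup>2 / 8) \<le> exp 8 * exp (- norm t)"
    proof -
      \<comment> \<open>The square gives - |t|^2 / 8 \<le> 2 - norm t; the constant 8 leaves
        room.\<close>
      have "0 \<le> (norm t - 4)\<^sup>2" by simp
      then have "- (norm t)\<^sup>2 / 8 \<le> 8 + - norm t" by (simp add: power2_eq_square field_simps)
      then show ?thesis by (simp add: exp_add[symmetric])
    qed
    ultimately have "(norm t) ^ m * exp (- (norm t)\<^sup>2 / 8) \<le> (1 + (norm t) ^ 4) * (exp 8 * exp (- norm t))"
      by (intro mult_mono) auto
    then show ?thesis by (simp add: algebra_simps)
  qed
  then show "AE t :: real ^ 'd in lborel. norm ((norm t) ^ m * exp (- (norm t)\<^sup>2 / 8))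
      \<le> norm (exp 8 * (exp (- norm t) + norm t ^ 4 * exp (- norm t)))"
    by (auto intro!: AE_I2 order_trans[OF _ abs_ge_self] simp: abs_mult)
qed measurable

lemma cmod_iexp_diff_le: "cmod (iexp x - iexp y) \<le> \<bar>x - y\<bar>"
proof -
  have "iexp x - iexp y = iexp y * (iexp (x - y) - 1)"
    by (simp add: algebra_simps exp_diff)
  then have "cmod (iexp x - iexp y) = cmod (iexp (x - y) - 1)"
    by (simp add: norm_mult)
  also have "\<dots> \<le> \<bar>x - y\<bar>" using iexp_approx1[of "x - y" 0] by simp
  finally show ?thesis .
qed

lemma isotropic_density_bounds:
  "\<exists>M B. 0 < M \<and> 0 < B \<and> (\<forall>p :: real ^ 'd \<Rightarrow> real. isotropic_density p \<longrightarrow> (\<forall>x. p x \<le> M) \<and>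
     integrable (density lborel (\<lambda>x. ennreal (p x))) (\<lambda>x. (norm x) ^ 4) \<and>
     (\<integral>x. (norm x) ^ 4 \<partial>density lborel (\<lambda>x. ennreal (p x))) \<le> B)"
proof -
  obtain A a where A: "0 < A" "0 < a"
    "\<And>p :: real ^ 'd \<Rightarrow> real. \<And>x. isotropic_density p \<Longrightarrow> p x \<le> A * exp (- a * norm x)"
    using isotropic_density_exponential_decay by blast
  define B where "B = A * (\<integral>x. (norm x) ^ 4 * exp (- a * norm (x :: real ^ 'd)) \<partial>lborel)"
  have B: "0 \<le> B" unfolding B_def using A(1) by (intro mult_nonneg_nonneg integral_nonneg_AE) auto
  have "(\<forall>x. p x \<le> A) \<and> integrable (density lborel (\<lambda>x. ennreal (p x))) (\<lambda>x. (norm x) ^ 4) \<and>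
     (\<integral>x. (norm x) ^ 4 \<partial>density lborel (\<lambda>x. ennreal (p x))) \<le> B + 1"
    if p: "isotropic_density p" for p :: "real ^ 'd \<Rightarrow> real"
  proof -
    interpret isotropic_density p by fact
    have "p x \<le> A" for x
    proof -
      have "A * exp (- a * norm x) \<le> A * 1" using A(1,2) by (intro mult_left_mono) auto
      with A(3)[OF p, of x] show ?thesis by simp
    qed
    have i: "integrable lborel (\<lambda>x :: real ^ 'd. A * ((norm x) ^ 4 * exp (- a * norm x)))"
      using integrable_power4_exp_norm[OF A(2)] by (rule integrable_mult_right)
    have le: "p x * (norm x) ^ 4 \<le> A * ((norm x) ^ 4 * exp (- a * norm x))" for x
      using mult_right_mono[OF A(3)[OF p, of x], of "(norm x) ^ 4"] by (simp add: mult_ac)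
    have j: "integrable lborel (\<lambda>x. p x * (norm x) ^ 4)"
      by (rule Bochner_Integration.integrable_bound[OF i])
        (use le A(1) in \<open>auto intro!: AE_I2 simp: abs_mult\<close>)
    have "(\<integral>x. (norm x) ^ 4 \<partial>law) = (\<integral>x. p x * (norm x) ^ 4 \<partial>lborel)"
      by (subst integral_density) auto
    also have "\<dots> \<le> B"
      unfolding B_def integral_mult_right_zero[symmetric] by (intro integral_mono i j le)
    finally show ?thesis
      using \<open>\<And>x. p x \<le> A\<close> j by (auto simp: integrable_density)
  qed
  with A(1) B show ?thesis
    by (intro exI[of _ A] exI[of _ "B + 1"]) auto
qed

sublocale isotropic_density \<subseteq> law: vec_distribution law
  by unfold_locales simp

section \<open>Characteristic functions at nearby points and at multiples\<close>

context vec_distribution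
begin

lemma char_vec_lipschitz:
  assumes "integrable N norm"
  shows "cmod (char_vec N s - char_vec N t) \<le> norm (s - t) * (\<integral>x. norm x \<partial>N)"
proof -
  have "char_vec N s - char_vec N t = (CLINT x|N. iexp (s \<bullet> x) - iexp (t \<bullet> x))"
    unfolding char_vec_def by (subst Bochner_Integration.integral_diff) (auto intro: integrable_iexp_inner)
  also have "cmod \<dots> \<le> (\<integral>x. cmod (iexp (s \<bullet> x) - iexp (t \<bullet> x)) \<partial>N)"
    by (rule integral_norm_bound)
  also have "\<dots> \<le> (\<integral>x. norm (s - t) * norm x \<partial>N)"
  proof (rule integral_mono')
    show "cmod (iexp (s \<bullet> x) - iexp (t \<bullet> x)) \<le> norm (s - t) * norm x" for x
      using cmod_iexp_diff_le[of "s \<bullet> x" "t \<bullet> x"] Cauchy_Schwarz_ineq2[of "s - t" x]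
      unfolding inner_diff_left[symmetric] by (rule order_trans)
  qed (use assms in auto)
  finally show ?thesis by simp
qed

text \<open>If \<open>s \<bullet> X\<close> is nearly constant modulo \<open>2\<pi>\<close>, then so is \<open>k s \<bullet> X\<close>.\<close>

lemma cmod_char_vec_multiple_ge:
  "1 - real k * sqrt (2 * (1 - cmod (char_vec N s))) \<le> cmod (char_vec N (real k *\<^sub>R s))"
proof -
  define f where "f = char_vec N s"
  \<comment> \<open>Rotation of f onto the nonnegative real axis. The value 1 at f = 0 keeps |u| =
    1.\<close>
  define u where "u = (if f = 0 then 1 else cnj (sgn f))"
  have u: "cmod u = 1" by (simp add: u_def norm_sgn)
  have uf: "u * f = of_real (cmod f)"
  proof (cases "f = 0")
    case False
    then have "cnj (sgn f) * f = of_real (cmod f)"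
      by (simp add: sgn_eq complex_norm_square[symmetric] power2_eq_square mult.commute[of "cnj f"])
    with False show ?thesis by (simp add: u_def)
  qed simp
  let ?z = "\<lambda>x. u * iexp (s \<bullet> x)"
  have z: "cmod (?z x) = 1" for x using u by (simp add: norm_mult)
  have intz: "integrable N ?z" using integrable_iexp_inner by simp
  have int: "integrable N (\<lambda>x. cmod (1 - ?z x))" 
    using intz by (intro integrable_norm Bochner_Integration.integrable_diff) auto
  have sq: "(cmod (1 - ?z x))\<^sup>2 = 2 - 2 * Re (?z x)" for x
  proof -
    have "(Re (?z x))\<^sup>2 + (Im (?z x))\<^sup>2 = 1" using z[of x] by (simp add: cmod_def)
    then show ?thesis
      unfolding cmod_power2 by (simp add: power2_eq_square algebra_simps del: times_complex.sel)
  qed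
  \<comment> \<open>The second moment of |1 - z| is 2 - 2 |f|, because z is unimodular with mean
    |f|. Jensen passes to the first moment, and |1 - z^k| \<le> k |1 - z| does the rest.\<close>
  have "(\<integral>x. cmod (1 - ?z x) \<partial>N)\<^sup>2 \<le> (\<integral>x. (cmod (1 - ?z x))\<^sup>2 \<partial>N)"
  proof (rule jensens_inequality[OF int, of UNIV])
    show "integrable N (\<lambda>x. (cmod (1 - ?z x))\<^sup>2)"
      unfolding sq by (intro Bochner_Integration.integrable_diff integrable_mult_right integrable_Re intz integrable_const)
    show "convex_on UNIV (\<lambda>x :: real. x\<^sup>2)"
      by (rule convex_power2)
  qed auto
  also have "(\<integral>x. (cmod (1 - ?z x))\<^sup>2 \<partial>N) = 2 - 2 * Re (CLINT x|N. ?z x)"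
    unfolding sq using integrable_Re[OF intz] integral_Re[OF intz]
    by (subst Bochner_Integration.integral_diff) (simp_all add: prob_space del: times_complex.sel)
  also have "(CLINT x|N. ?z x) = u * f"
    by (simp add: f_def char_vec_def)
  finally have mean: "(\<integral>x. cmod (1 - ?z x) \<partial>N) \<le> sqrt (2 * (1 - cmod f))"
    unfolding uf by (intro real_le_rsqrt) simp
  have pow: "(?z x) ^ k = u ^ k * iexp (real k *\<^sub>R s \<bullet> x)" for x
    by (simp add: power_mult_distrib exp_of_nat_mult[symmetric] mult_ac)
  have "1 - u ^ k * char_vec N (real k *\<^sub>R s) = (CLINT x|N. 1 - (?z x) ^ k)"
    unfolding pow using integrable_iexp_inner[of "real k *\<^sub>R s"]
    by (subst Bochner_Integration.integral_diff) (auto simp: prob_space char_vec_def)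
  also have "cmod \<dots> \<le> (\<integral>x. cmod (1 - (?z x) ^ k) \<partial>N)"
    by (rule integral_norm_bound)
  also have "\<dots> \<le> (\<integral>x. real k * cmod (1 - ?z x) \<partial>N)"
  proof (rule integral_mono')
    show "cmod (1 - (?z x) ^ k) \<le> real k * cmod (1 - ?z x)" for x
      using norm_power_diff[of 1 "?z x" k] z[of x] by simp
  qed (use int in auto)
  also have "\<dots> \<le> real k * sqrt (2 * (1 - cmod f))"
    using mean by (simp add: mult_left_mono)
  finally have "cmod (1 - u ^ k * char_vec N (real k *\<^sub>R s)) \<le> real k * sqrt (2 * (1 - cmod f))" .
  moreover have "1 - cmod (u ^ k * char_vec N (real k *\<^sub>R s)) \<le> cmod (1 - u ^ k * char_vec N (real k *\<^sub>R s))"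
    using norm_triangle_ineq2[of 1 "u ^ k * char_vec N (real k *\<^sub>R s)"] by simp
  moreover have "cmod (u ^ k * char_vec N (real k *\<^sub>R s)) = cmod (char_vec N (real k *\<^sub>R s))"
    using u by (simp add: norm_mult norm_power)
  ultimately show ?thesis by (simp add: f_def)
qed

end

section \<open>Characteristic functions of isotropic log-concave laws\<close>

context isotropic_density
begin

lemma law_first: "integrable law (\<lambda>x. \<theta> \<bullet> x)" "(\<integral>x. \<theta> \<bullet> x \<partial>law) = 0"
  using first[of \<theta>] by (auto simp: has_bochner_integral_iff integrable_density integral_density mult.commute)

lemma law_second: "integrable law (\<lambda>x. (\<theta> \<bullet> x)\<^sup>2)" "(\<integral>x. (\<theta> \<bullet> x)\<^sup>2 \<partial>law) = (norm \<theta>)\<^sup>2"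
  using second[of \<theta>] by (auto simp: has_bochner_integral_iff integrable_density integral_density mult.commute)

lemma law_norm: "integrable law norm" "(\<integral>x. norm x \<partial>law) \<le> 1 + real CARD('d)"
proof -
  have sq: "integrable law (\<lambda>x. (norm x)\<^sup>2)" "(\<integral>x. (norm x)\<^sup>2 \<partial>law) = real CARD('d)"
    using second_moment by (auto simp: has_bochner_integral_iff integrable_density integral_density mult.commute)
  have le: "norm x \<le> 1 + (norm x)\<^sup>2" for x :: "real ^ 'd"
  proof -
    have "0 \<le> (norm x - 1 / 2)\<^sup>2" by simp
    then show ?thesis by (simp add: power2_eq_square algebra_simps)
  qed
  have i: "integrable law (\<lambda>x. 1 + (norm x)\<^sup>2)" using sq by simp
  show j: "integrable law norm"
    by (rule Bochner_Integration.integrable_bound[OF i]) (use le in \<open>auto intro!: AE_I2\<close>)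
  have "(\<integral>x. norm x \<partial>law) \<le> (\<integral>x. 1 + (norm x)\<^sup>2 \<partial>law)"
    by (intro integral_mono i j le)
  also have "\<dots> = 1 + real CARD('d)"
    using sq by (simp add: law.prob_space del: space_density)
  finally show "(\<integral>x. norm x \<partial>law) \<le> 1 + real CARD('d)" .
qed

text \<open>If \<open>\<bar>f(s)\<bar>\<close> were close to \<open>1\<close> for the characteristic function \<open>f\<close>, then \<open>\<bar>f\<bar>\<close> would be
  at least \<open>1/2\<close> on disjoint balls around \<open>s, 2s, \<dots>, Ns\<close>, against Plancherel's inequality.\<close>

lemma cmod_char_vec_le_away_from_0:
  assumes M: "\<And>x. p x \<le> M" and c: "0 < c" "c \<le> norm s" and \<rho>: "\<rho> = min (1 / (4 * (1 + real CARD('d)))) (c / 2)"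
    and N: "0 < N" "(2 * pi) ^ CARD('d) * M < real N * (measure lborel (ball (0 :: real ^ 'd) \<rho>) / 8)"
  shows "cmod (char_vec law s) \<le> 1 - 1 / (32 * (real N)\<^sup>2)"
proof (rule ccontr)
  let ?f = "char_vec law"
  let ?v = "measure lborel (ball (0 :: real ^ 'd) \<rho>)"
  assume "\<not> ?thesis"
  then have close: "1 - cmod (?f s) < 1 / (32 * (real N)\<^sup>2)" by simp
  have \<rho>_pos: "0 < \<rho>" using c(1) by (simp add: \<rho> add_pos_pos)
  \<comment> \<open>1 / (32 N^2) is calibrated so that the loss in
    \<open>cmod_char_vec_multiple_ge\<close>, N * sqrt (2 / (32 N^2)), is 1/4.\<close>
  have mult: "3 / 4 \<le> cmod (?f (real k *\<^sub>R s))" if k: "k \<le> N" for k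
  proof -
    have "sqrt (2 * (1 - cmod (?f s))) \<le> sqrt (2 * (1 / (32 * (real N)\<^sup>2)))"
      using close by (intro real_sqrt_le_mono) simp
    also have "2 * (1 / (32 * (real N)\<^sup>2)) = (1 / (4 * real N))\<^sup>2"
      by (simp add: power2_eq_square)
    also have "sqrt \<dots> = 1 / (4 * real N)" by simp
    finally have "real k * sqrt (2 * (1 - cmod (?f s))) \<le> real N * (1 / (4 * real N))"
      using k by (intro mult_mono) (auto simp: law.cmod_char_vec_le_1)
    also have "\<dots> = 1 / 4" using N(1) by simp
    finally show ?thesis using law.cmod_char_vec_multiple_ge[of k s] by linarith
  qed
  define Bl where "Bl k = ball (real k *\<^sub>R s) \<rho>" for k :: nat
  define U where "U = (\<Union>k\<in>{1..N}. Bl k)"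
  \<comment> \<open>The mean norm is at most 1 + d and \<rho> \<le> 1 / (4 (1 + d)), so moving by
    \<rho> loses at most another 1/4.\<close>
  have half: "1 / 2 \<le> cmod (?f t)" if "t \<in> U" for t
  proof -
    from that obtain k where k: "k \<in> {1..N}" "norm (real k *\<^sub>R s - t) < \<rho>"
      by (auto simp: U_def Bl_def dist_norm)
    have "cmod (?f (real k *\<^sub>R s) - ?f t) \<le> norm (real k *\<^sub>R s - t) * (\<integral>x. norm x \<partial>law)"
      by (rule law.char_vec_lipschitz[OF law_norm(1)])
    also have "\<dots> \<le> \<rho> * (1 + real CARD('d))"
      using k(2) law_norm(2) \<rho>_pos by (intro mult_mono) auto
    also have "\<dots> \<le> 1 / (4 * (1 + real CARD('d))) * (1 + real CARD('d))"
      by (intro mult_right_mono) (auto simp: \<rho>)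
    also have "\<dots> = 1 / 4" by (simp add: add_pos_pos)
    finally have "cmod (?f (real k *\<^sub>R s) - ?f t) \<le> 1 / 4" .
    then show ?thesis
      using mult[of k] k(1) norm_triangle_ineq2[of "?f (real k *\<^sub>R s)" "?f t"] by auto
  qed
  \<comment> \<open>Distinct multiples of s are at least norm s \<ge> c \<ge> 2 \<rho>
    apart.\<close>
  have disj: "disjoint_family_on Bl {1..N}"
    unfolding disjoint_family_on_def
  proof (intro ballI impI)
    fix j k assume jk: "j \<in> {1..N}" "k \<in> {1..N}" "j \<noteq> k"
    have "2 * \<rho> \<le> norm s" using c by (simp add: \<rho>)
    also have "norm s \<le> \<bar>real j - real k\<bar> * norm s"
      using jk(3) by (intro mult_left_le_one_le[THEN order_trans] mult_le_cancel_right1[THEN iffD2]) auto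
    also have "\<dots> = dist (real j *\<^sub>R s) (real k *\<^sub>R s)"
      by (simp add: dist_norm scaleR_diff_left[symmetric])
    finally show "Bl j \<inter> Bl k = {}"
      unfolding Bl_def by (intro disjoint_ballI) simp
  qed
  have volB: "emeasure lborel (Bl k) = ennreal ?v" for k
  proof -
    have "emeasure lborel (Bl k) = emeasure lborel (ball (0 :: real ^ 'd) \<rho>)"
    proof -
      have "emeasure lborel (Bl k) = emeasure (distr lborel borel ((+) (real k *\<^sub>R s))) (Bl k)"
        by (simp add: lborel_distr_plus)
      also have "\<dots> = emeasure lborel ((+) (real k *\<^sub>R s) -` Bl k)"
        by (subst emeasure_distr) (auto simp: Bl_def)
      also have "(+) (real k *\<^sub>R s) -` Bl k = ball 0 \<rho>"
        by (auto simp: Bl_def dist_norm)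
      finally show ?thesis .
    qed
    also have "\<dots> = ennreal ?v"
      using emeasure_lborel_ball_finite[of "0 :: real ^ 'd" \<rho>] by (intro emeasure_eq_ennreal_measure) auto
    finally show ?thesis .
  qed
  have U[measurable]: "U \<in> sets borel" by (auto simp: U_def Bl_def)
  have "emeasure lborel U = (\<Sum>k\<in>{1..N}. emeasure lborel (Bl k))"
    unfolding U_def by (rule sum_emeasure[symmetric, OF _ disj]) (auto simp: Bl_def)
  then have volU: "emeasure lborel U = ennreal (real N * ?v)"
    by (simp add: volB ennreal_of_nat_eq_real_of_nat ennreal_mult)
  \<comment> \<open>All balls lie within radius r, so \<open>gauss_weight (1 / r)\<close> is at
    least exp (-1/2) \<ge> 1/2 on U. Together with (1/2)^2 from |f|^2 this is the 1/8 in the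
    hypothesis on N.\<close>
  define r where "r = real N * norm s + \<rho>"
  have r: "0 < r" using \<rho>_pos by (simp add: r_def add_nonneg_pos)
  have Ur: "norm t \<le> r" if "t \<in> U" for t
  proof -
    from that obtain k where k: "k \<in> {1..N}" "norm (t - real k *\<^sub>R s) < \<rho>"
      by (auto simp: U_def Bl_def dist_norm norm_minus_commute)
    have "norm t \<le> norm (real k *\<^sub>R s) + norm (t - real k *\<^sub>R s)"
      by (rule norm_triangle_sub)
    also have "\<dots> \<le> real N * norm s + \<rho>"
      using k by (intro add_mono) (auto intro: mult_right_mono)
    finally show ?thesis by (simp add: r_def)
  qed
  have ind: "1 / 8 * indicator U t \<le> gauss_weight (1 / r) t * (cmod (?f t))\<^sup>2" for t
  proof (cases "t \<in> U")
    case True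
    have "((1 / r) * norm t)\<^sup>2 \<le> 1"
      using Ur[OF True] r by (intro power_le_one) auto
    then have "exp (- 1 / 2) \<le> gauss_weight (1 / r) t"
      by (simp add: gauss_weight_def)
    moreover have "1 / 2 \<le> exp (- 1 / 2 :: real)"
      using exp_ge_add_one_self[of "- 1 / 2 :: real"] by simp
    moreover have "(1 / 2)\<^sup>2 \<le> (cmod (?f t))\<^sup>2"
      using half[OF True] by (intro power_mono) auto
    ultimately have "1 / 2 * (1 / 2)\<^sup>2 \<le> gauss_weight (1 / r) t * (cmod (?f t))\<^sup>2"
      by (intro mult_mono) auto
    with True show ?thesis by (simp add: power2_eq_square)
  qed simp
  have Ui: "has_bochner_integral lborel (indicator U :: _ \<Rightarrow> real) (real N * ?v)"
    using has_bochner_integral_real_indicator[of U lborel] volU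
    by (simp add: measure_def)
  have "integrable lborel (\<lambda>t. gauss_weight (1 / r) t *\<^sub>R (of_real ((cmod (?f t))\<^sup>2) :: complex))"
    using r law.cmod_char_vec_le_1
    by (intro integrable_gauss_weight_bounded[where B=1]) (auto simp: norm_power power_le_one)
  then have int: "integrable lborel (\<lambda>t. gauss_weight (1 / r) t * (cmod (?f t))\<^sup>2)"
    by (simp only: scaleR_conv_of_real of_real_mult[symmetric] complex_of_real_integrable_eq)
  have "real N * (?v / 8) = (\<integral>t. 1 / 8 * indicator U t \<partial>lborel)"
    using Ui by (simp add: has_bochner_integral_iff)
  also have "\<dots> \<le> (\<integral>t. gauss_weight (1 / r) t * (cmod (?f t))\<^sup>2 \<partial>lborel)"
    using Ui by (intro integral_mono int ind integrable_mult_right) (auto simp: has_bochner_integral_iff)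
  also have "\<dots> \<le> (2 * pi) ^ CARD('d) * M"
    using r by (intro law.plancherel_le[OF refl]) (auto intro: M)
  finally show False using N(2) by simp
qed

text \<open>For fixed s this is the one-dimensional Taylor estimate for s \<bullet> X at argument 1,
  with mean 0 and variance |s|^2. The next term, of order three or, if that vanishes, four, is
  absorbed into the error. As norm x ^ k \<le> 1 + norm x ^ 4 for k \<le> 4, the constant 1 + B
  serves both orders.\<close>

lemma char_vec_taylor:
  assumes "integrable law (\<lambda>x. (norm x) ^ 4)" "(\<integral>x. (norm x) ^ 4 \<partial>law) \<le> B"
  shows "cmod (char_vec law s - (1 - (norm s)\<^sup>2 / 2)) \<le> (1 + B) * norm s ^ 3"
    and "(\<integral>x. (s \<bullet> x) ^ 3 \<partial>law) = 0 \<Longrightarrow> cmod (char_vec law s - (1 - (norm s)\<^sup>2 / 2)) \<le> (1 + B) * norm s ^ 4"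
proof -
  define L where "L = distr law borel (\<lambda>x. s \<bullet> x)"
  interpret L: real_distribution L
    unfolding L_def real_distribution_def real_distribution_axioms_def
    by (auto intro!: law.prob_space_distr)
  have char: "char L 1 = char_vec law s"
    unfolding char_def L_def char_vec_def by (subst integral_distr) auto
  have B: "0 \<le> B" using order_trans[OF integral_nonneg_AE assms(2)] by simp
  have norm_pow: "integrable law (\<lambda>x. (norm x) ^ k)" "(\<integral>x. (norm x) ^ k \<partial>law) \<le> 1 + B" if k: "k \<le> 4" for k
  proof -
    have le: "(norm x) ^ k \<le> 1 + (norm x) ^ 4" for x :: "real ^ 'd"
    proof (cases "norm x \<le> 1")
      case True
      then have "(norm x) ^ k \<le> 1" by (intro power_le_one) auto
      then show ?thesis by (simp add: add_increasing2)
    next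
      case False
      then have "(norm x) ^ k \<le> (norm x) ^ 4" using k by (intro power_increasing) auto
      then show ?thesis by simp
    qed
    have i: "integrable law (\<lambda>x. 1 + (norm x) ^ 4)" using assms(1) by simp
    show j: "integrable law (\<lambda>x. (norm x) ^ k)"
      by (rule Bochner_Integration.integrable_bound[OF i]) (use le in \<open>auto intro!: AE_I2\<close>)
    have "(\<integral>x. (norm x) ^ k \<partial>law) \<le> (\<integral>x. 1 + (norm x) ^ 4 \<partial>law)"
      by (intro integral_mono i j le)
    also have "\<dots> = 1 + (\<integral>x. (norm x) ^ 4 \<partial>law)"
      using assms(1) by (simp add: law.prob_space del: space_density)
    finally show "(\<integral>x. (norm x) ^ k \<partial>law) \<le> 1 + B" using assms(2) by simp
  qed
  have CS: "\<bar>s \<bullet> x\<bar> ^ k \<le> norm s ^ k * norm x ^ k" for x k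
    unfolding power_mult_distrib[symmetric] by (intro power_mono Cauchy_Schwarz_ineq2) simp
  have inner_pow: "integrable law (\<lambda>x. (s \<bullet> x) ^ k)" if "k \<le> 4" for k
    by (rule Bochner_Integration.integrable_bound[OF integrable_mult_right[OF norm_pow(1)[OF that], of "norm s ^ k"]])
       (use CS in \<open>auto intro!: AE_I2 simp: power_abs\<close>)
  have mom: "integrable L (\<lambda>y. y ^ k)" if "k \<le> 4" for k
    unfolding L_def using inner_pow[OF that] by (subst integrable_distr_eq) auto
  have Emom: "(\<integral>y. y ^ k \<partial>L) = (\<integral>x. (s \<bullet> x) ^ k \<partial>law)" for k
    unfolding L_def by (subst integral_distr) auto
  have abs_mom: "(\<integral>y. \<bar>y\<bar> ^ k \<partial>L) \<le> (1 + B) * norm s ^ k" if k: "k \<le> 4" for k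
  proof -
    have "(\<integral>y. \<bar>y\<bar> ^ k \<partial>L) = (\<integral>x. \<bar>s \<bullet> x\<bar> ^ k \<partial>law)"
      unfolding L_def by (subst integral_distr) auto
    also have "\<dots> \<le> (\<integral>x. norm s ^ k * norm x ^ k \<partial>law)"
      by (intro integral_mono' integrable_mult_right norm_pow k CS) auto
    also have "\<dots> \<le> norm s ^ k * (1 + B)"
      using norm_pow(2)[OF k] by (simp add: mult_left_mono)
    finally show ?thesis by (simp add: mult.commute)
  qed
  have E: "(\<integral>y. y ^ 0 \<partial>L) = 1" "(\<integral>y. y ^ 1 \<partial>L) = 0" "(\<integral>y. y ^ 2 \<partial>L) = (norm s)\<^sup>2"
    unfolding Emom using law_first(2)[of s] law_second(2)[of s] by (simp_all add: law.prob_space del: space_density)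
  define m3 where "m3 = (\<integral>y. y ^ 3 \<partial>L)"
  define m4 where "m4 = (\<integral>y. y ^ 4 \<partial>L)"
  have m3: "\<bar>m3\<bar> \<le> (1 + B) * norm s ^ 3"
  proof -
    have "\<bar>m3\<bar> \<le> (\<integral>y. \<bar>y\<bar> ^ 3 \<partial>L)"
      unfolding m3_def using integral_norm_bound[of L "\<lambda>y. y ^ 3"] by (simp add: power_abs)
    with abs_mom[of 3] show ?thesis by simp
  qed
  have m4: "\<bar>m4\<bar> \<le> (1 + B) * norm s ^ 4"
  proof -
    have "\<bar>m4\<bar> \<le> (\<integral>y. \<bar>y\<bar> ^ 4 \<partial>L)"
      unfolding m4_def using integral_norm_bound[of L "\<lambda>y. y ^ 4"] by (simp add: power_abs)
    with abs_mom[of 4] show ?thesis by simp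
  qed
  have sum3: "(\<Sum>k\<le>3. ((\<i> * complex_of_real 1) ^ k / fact k) * of_real (\<integral>y. y ^ k \<partial>L))
      = of_real (1 - (norm s)\<^sup>2 / 2) - \<i> * of_real (m3 / 6)"
  proof -
    have "{..3::nat} = {0, 1, 2, 3}" by auto
    then show ?thesis using L.prob_space by (simp add: E[unfolded power_0 power_one_right] E m3_def power3_eq_cube fact_numeral)
  qed
  have sum4: "(\<Sum>k\<le>4. ((\<i> * complex_of_real 1) ^ k / fact k) * of_real (\<integral>y. y ^ k \<partial>L))
      = of_real (1 - (norm s)\<^sup>2 / 2) - \<i> * of_real (m3 / 6) + of_real (m4 / 24)"
  proof -
    have "{..4::nat} = insert 4 {..3}" by auto
    then show ?thesis using sum3 by (simp add: m4_def fact_numeral)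
  qed
  \<comment> \<open>The remainder 2 / 3! = 1/3 plus 1/6 from the cubic term stays below 1; for order
    four the sum is 1/12 + 1/24.\<close>
  have "cmod (char L 1 - (of_real (1 - (norm s)\<^sup>2 / 2) - \<i> * of_real (m3 / 6))) \<le> 1 / 3 * (\<integral>y. \<bar>y\<bar> ^ 3 \<partial>L)"
    using L.char_approx1[of 3 1] mom unfolding sum3 by (simp add: fact_numeral)
  moreover have "cmod (\<i> * of_real (m3 / 6)) = \<bar>m3\<bar> / 6"
    by (simp add: norm_mult)
  moreover have "cmod (char L 1 - of_real (1 - (norm s)\<^sup>2 / 2))
      \<le> cmod (char L 1 - (of_real (1 - (norm s)\<^sup>2 / 2) - \<i> * of_real (m3 / 6))) + cmod (\<i> * of_real (m3 / 6))"
    using norm_triangle_ineq4[of "char L 1 - (of_real (1 - (norm s)\<^sup>2 / 2) - \<i> * of_real (m3 / 6))" "\<i> * of_real (m3 / 6)"]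
    by (simp add: algebra_simps)
  ultimately have "cmod (char L 1 - of_real (1 - (norm s)\<^sup>2 / 2)) \<le> (1 + B) * norm s ^ 3"
    using m3 abs_mom[of 3] by linarith
  then show "cmod (char_vec law s - (1 - (norm s)\<^sup>2 / 2)) \<le> (1 + B) * norm s ^ 3"
    unfolding char by simp
  assume "(\<integral>x. (s \<bullet> x) ^ 3 \<partial>law) = 0"
  then have "m3 = 0" by (simp add: m3_def Emom)
  have "cmod (char L 1 - (of_real (1 - (norm s)\<^sup>2 / 2) + of_real (m4 / 24))) \<le> 1 / 12 * (\<integral>y. \<bar>y\<bar> ^ 4 \<partial>L)"
    using L.char_approx1[of 4 1] mom unfolding sum4 \<open>m3 = 0\<close> by (simp add: fact_numeral)
  moreover have "cmod (of_real (m4 / 24)) = \<bar>m4\<bar> / 24"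
    by (simp only: norm_of_real abs_divide abs_numeral)
  moreover have "cmod (char L 1 - of_real (1 - (norm s)\<^sup>2 / 2))
      \<le> cmod (char L 1 - (of_real (1 - (norm s)\<^sup>2 / 2) + of_real (m4 / 24))) + cmod (of_real (m4 / 24))"
    using norm_triangle_ineq[of "char L 1 - (of_real (1 - (norm s)\<^sup>2 / 2) + of_real (m4 / 24))" "of_real (m4 / 24)"]
    by (simp add: algebra_simps)
  ultimately have "cmod (char L 1 - of_real (1 - (norm s)\<^sup>2 / 2)) \<le> (1 + B) * norm s ^ 4"
    using m4 abs_mom[of 4] by linarith
  then show "cmod (char_vec law s - (1 - (norm s)\<^sup>2 / 2)) \<le> (1 + B) * norm s ^ 4"
    unfolding char by simp
qed

end

text \<open>N is chosen so large, in terms of d, M and c alone, that N disjoint balls would carry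
  more than Plancherel's inequality permits; hence one \<delta> serves all isotropic densities
  bounded by M.\<close>

lemma char_vec_bounded_away_from_1:
  assumes c: "0 < c"
  shows "\<exists>\<delta>. 0 < \<delta> \<and> \<delta> < 1 \<and> (\<forall>p :: real ^ 'd \<Rightarrow> real. isotropic_density p \<longrightarrow> (\<forall>x. p x \<le> M) \<longrightarrow>
    (\<forall>s. c \<le> norm s \<longrightarrow> cmod (char_vec (density lborel (\<lambda>x. ennreal (p x))) s) \<le> \<delta>))"
proof -
  define \<rho> where "\<rho> = min (1 / (4 * (1 + real CARD('d)))) (c / 2)"
  define v where "v = measure lborel (ball (0 :: real ^ 'd) \<rho>)"
  have \<rho>: "0 < \<rho>" using c by (simp add: \<rho>_def add_pos_pos)
  then have v: "0 < v" unfolding v_def using content_ball_pos[OF \<rho>, of "0 :: real ^ 'd"] by simp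
  obtain N0 where N0: "(2 * pi) ^ CARD('d) * M / (v / 8) < real N0"
    using reals_Archimedean2 by blast
  define N where "N = Suc N0"
  have N: "0 < N" by (simp add: N_def)
  have "(2 * pi) ^ CARD('d) * M / (v / 8) < real N" using N0 by (simp add: N_def)
  then have NM: "(2 * pi) ^ CARD('d) * M < real N * (v / 8)"
    using v by (subst (asm) pos_divide_less_eq) auto
  have "1 \<le> (real N)\<^sup>2" using N by (intro one_le_power) simp
  then have "1 < 32 * (real N)\<^sup>2" by linarith
  then have "0 < 1 - 1 / (32 * (real N)\<^sup>2)" "1 - 1 / (32 * (real N)\<^sup>2) < 1"
    using N by (auto simp: divide_less_eq)
  moreover have "cmod (char_vec (density lborel (\<lambda>x. ennreal (p x))) s) \<le> 1 - 1 / (32 * (real N)\<^sup>2)"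
    if "isotropic_density p" "\<forall>x. p x \<le> M" "c \<le> norm s" for p :: "real ^ 'd \<Rightarrow> real" and s
    using isotropic_density.cmod_char_vec_le_away_from_0[OF that(1) _ c that(3) \<rho>_def N NM[unfolded v_def]] that(2) by blast
  ultimately show ?thesis by blast
qed

section \<open>Sums of independent random vectors\<close>

text \<open>Division by r brings all factors into the unit disc, where products differ by at most
  the sum of the differences. Scaling back leaves r^(n-1) for n factors, which supplies the Gaussian
  decay in \<open>char_product_diff_le\<close>.\<close>

lemma norm_prod_diff_le:
  fixes z w :: "'i \<Rightarrow> complex"
  assumes "finite I" "\<And>i. i \<in> I \<Longrightarrow> norm (z i) \<le> r" "\<And>i. i \<in> I \<Longrightarrow> norm (w i) \<le> r"
    "\<And>i. i \<in> I \<Longrightarrow> norm (z i - w i) \<le> e" and r: "0 < r"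
  shows "norm ((\<Prod>i\<in>I. z i) - (\<Prod>i\<in>I. w i)) \<le> r ^ card I * (real (card I) * (e / r))"
proof -
  have "norm ((\<Prod>i\<in>I. z i / of_real r) - (\<Prod>i\<in>I. w i / of_real r)) \<le> (\<Sum>i\<in>I. norm (z i / of_real r - w i / of_real r))"
    using assms by (intro norm_prod_diff) (auto simp: norm_divide)
  also have "\<dots> \<le> (\<Sum>i\<in>I. e / r)"
    unfolding diff_divide_distrib[symmetric] using assms
    by (intro sum_mono) (simp add: norm_divide divide_right_mono)
  finally have "norm (((\<Prod>i\<in>I. z i) - (\<Prod>i\<in>I. w i)) / of_real (r ^ card I)) \<le> real (card I) * (e / r)"
    by (simp add: prod_dividef diff_divide_distrib)
  then show ?thesis
    using r by (simp add: norm_divide norm_power field_simps)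
qed

text \<open>(1 - x + x^2/2) (1 + x + x^2/2) = 1 + x^4/4 \<ge> 1, so this is the reciprocal of the
  Taylor lower bound for exp x.\<close>

lemma exp_minus_le_quadratic: "0 \<le> (x :: real) \<Longrightarrow> exp (- x) \<le> 1 - x + x\<^sup>2 / 2"
proof -
  assume x: "0 \<le> x"
  have pos: "0 < 1 + x + x\<^sup>2 / 2" using x by (simp add: add_pos_nonneg)
  have "exp (- x) \<le> 1 / (1 + x + x\<^sup>2 / 2)"
    unfolding exp_minus inverse_eq_divide
    using exp_lower_Taylor_quadratic[OF x] pos by (intro divide_left_mono) auto
  also have "\<dots> \<le> 1 - x + x\<^sup>2 / 2"
  proof -
    have "(1 - x + x\<^sup>2 / 2) * (1 + x + x\<^sup>2 / 2) = 1 + x ^ 4 / 4"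
      by (simp add: field_simps power2_eq_square power4_eq_xxxx)
    then have "1 \<le> (1 - x + x\<^sup>2 / 2) * (1 + x + x\<^sup>2 / 2)" by simp
    then show ?thesis using pos by (simp add: pos_divide_le_eq)
  qed
  finally show ?thesis .
qed

text \<open>The threshold 1 / (4 b) brings the error b y^m \<le> b y^3 down to y^2/4, half of the
  quadratic term; the remaining 1 - y^2/4 still has Gaussian decay. The 1 in b + 1 pays for
  replacing 1 - y^2/2 by the exponential, at a cost of at most y^4 \<le> y^m.\<close>

lemma near_gaussian_factor:
  fixes z :: complex
  assumes m: "m \<in> {3, 4}" and b: "1 \<le> b" and y: "0 \<le> y" "y \<le> 1 / (4 * b)"
    and z: "norm (z - of_real (1 - y\<^sup>2 / 2)) \<le> b * y ^ m"
  shows "norm z \<le> exp (- y\<^sup>2 / 4)" "norm (z - of_real (exp (- y\<^sup>2 / 2))) \<le> (b + 1) * y ^ m"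
proof -
  have by_le: "b * y \<le> 1 / 4" using b y(2) by (simp add: field_simps)
  have "y \<le> 1 / 4"
    using y by (rule_tac order_trans[OF y(2)]) (use b in \<open>simp add: field_simps\<close>)
  then have y1: "y \<le> 1" by simp
  have m3: "y ^ m \<le> y ^ 3" and m4: "y ^ 4 \<le> y ^ m"
    using m y(1) y1 by (auto intro!: power_decreasing)
  have "b * y ^ m \<le> b * y ^ 3" using m3 b by (intro mult_left_mono) auto
  also have "\<dots> = (b * y) * y\<^sup>2" by (simp add: power3_eq_cube power2_eq_square)
  also have "\<dots> \<le> 1 / 4 * y\<^sup>2" using by_le by (intro mult_right_mono) auto
  finally have small: "b * y ^ m \<le> y\<^sup>2 / 4" by simp
  have y2: "y\<^sup>2 \<le> 1" using y(1) y1 by (intro power_le_one)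
  have "norm z \<le> norm (of_real (1 - y\<^sup>2 / 2) :: complex) + norm (z - of_real (1 - y\<^sup>2 / 2))"
    by (rule norm_triangle_sub)
  also have "norm (of_real (1 - y\<^sup>2 / 2) :: complex) = 1 - y\<^sup>2 / 2"
    unfolding norm_of_real using y2 by simp
  finally have "norm z \<le> 1 + (- y\<^sup>2 / 4)" using z small by simp
  also have "\<dots> \<le> exp (- y\<^sup>2 / 4)" by (rule exp_ge_add_one_self)
  finally show "norm z \<le> exp (- y\<^sup>2 / 4)" .
  have "\<bar>exp (- (y\<^sup>2 / 2)) - (1 - y\<^sup>2 / 2)\<bar> \<le> (y\<^sup>2 / 2)\<^sup>2 / 2"
    using exp_minus_le_quadratic[of "y\<^sup>2 / 2"] exp_ge_add_one_self[of "- (y\<^sup>2 / 2)"] by simp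
  also have "\<dots> \<le> y ^ 4" by (simp add: power_divide)
  also note m4
  finally have "norm (of_real (1 - y\<^sup>2 / 2) - of_real (exp (- y\<^sup>2 / 2)) :: complex) \<le> y ^ m"
    unfolding of_real_diff[symmetric] norm_of_real by (simp add: abs_minus_commute)
  then have "norm (z - of_real (exp (- y\<^sup>2 / 2))) \<le> b * y ^ m + y ^ m"
    using z norm_triangle_ineq[of "z - of_real (1 - y\<^sup>2 / 2)" "of_real (1 - y\<^sup>2 / 2) - of_real (exp (- y\<^sup>2 / 2))"] by simp
  then show "norm (z - of_real (exp (- y\<^sup>2 / 2))) \<le> (b + 1) * y ^ m"
    by (simp add: algebra_simps)
qed

lemma power_times_geometric_bounded:
  fixes \<delta> :: real
  assumes "0 < \<delta>" "\<delta> < 1"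
  shows "\<exists>K\<ge>0. \<forall>n\<ge>2. real n ^ k * \<delta> ^ (n - 2) \<le> K"
proof -
  define a where "a = - ln \<delta>"
  have a: "0 < a" using assms by (simp add: a_def)
  \<comment> \<open>From x/k \<le> exp (x/k) at x = a n; the division by \<delta>^2 accounts for the
    exponent n - 2.\<close>
  define K where "K = (real k / a) ^ k / \<delta>\<^sup>2"
  have "real n ^ k * \<delta> ^ (n - 2) \<le> K" if n: "2 \<le> n" for n
  proof -
    have \<delta>n: "\<delta> ^ n = exp (- (a * real n))"
      using assms by (simp add: a_def exp_of_nat2_mult)
    have le: "(a * real n) ^ k \<le> real k ^ k * exp (a * real n)"
    proof (cases "k = 0")
      case False
      have "(a * real n / real k) ^ k \<le> exp (a * real n / real k) ^ k"
        using a exp_ge_add_one_self[of "a * real n / real k"] by (intro power_mono) (linarith, simp)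
      also have "\<dots> = exp (a * real n)"
        using False by (simp add: exp_of_nat_mult[symmetric])
      finally show ?thesis using False by (simp add: power_divide field_simps)
    qed (use a in simp)
    have "real n ^ k * \<delta> ^ n = (a * real n) ^ k * exp (- (a * real n)) / a ^ k"
      using a by (simp add: \<delta>n power_mult_distrib)
    also have "\<dots> \<le> real k ^ k * exp (a * real n) * exp (- (a * real n)) / a ^ k"
      using le a by (intro divide_right_mono mult_right_mono) auto
    also have "\<dots> = (real k / a) ^ k"
      by (simp add: exp_minus power_divide)
    finally have "real n ^ k * \<delta> ^ n \<le> (real k / a) ^ k" .
    moreover have "\<delta> ^ (n - 2) = \<delta> ^ n / \<delta>\<^sup>2"
      using assms n by (simp add: power_diff)
    ultimately show ?thesis
      using assms by (simp add: K_def divide_right_mono)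
  qed
  moreover have "0 \<le> K" using a by (simp add: K_def)
  ultimately show ?thesis by blast
qed

lemma measurable_vec_nth[measurable (raw)]:
  fixes f :: "'a \<Rightarrow> real ^ 'd"
  assumes "f \<in> borel_measurable M"
  shows "(\<lambda>\<omega>. f \<omega> $ i) \<in> borel_measurable M"
  by (intro borel_measurable_continuous_on[OF _ assms]) (intro continuous_intros)

section \<open>Random vectors and the law of their normalized sum\<close>

context prob_space
begin

lemma isotropic_density_of_random_vector:
  fixes X :: "'a \<Rightarrow> real ^ 'd"
  assumes lc: "has_log_concave_density M X" and mean: "(\<integral>\<omega>. X \<omega> \<partial>M) = 0" and cov: "covariance_matrix M X = mat 1"
  shows "\<exists>p. isotropic_density p \<and> distr M borel X = density lborel (\<lambda>x. ennreal (p x))"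
proof -
  obtain p where p: "log_concave p" and D: "distributed M lborel X (\<lambda>x. ennreal (p x))"
    using lc by (auto simp: has_log_concave_density_def)
  have nn: "0 \<le> p x" for x using p by (simp add: log_concave_def)
  have [measurable]: "X \<in> borel_measurable M" using distributed_measurable[OF D] by simp
  have pm[measurable]: "p \<in> borel_measurable borel"
    using distributed_real_measurable[OF _ D] nn by simp
  have law: "distr M borel X = density lborel (\<lambda>x. ennreal (p x))"
    using distributed_distr_eq_density[OF D] by (simp cong: distr_cong)
  have c: "(\<integral>\<omega>. X \<omega> $ i * X \<omega> $ j \<partial>M) = (if i = j then 1 else 0)" for i j
    using cov by (simp add: covariance_matrix_def mean vec_eq_iff mat_def)
  \<comment> \<open>The integral is 1, hence exists, as a nonexistent one would have the value 0.
    All further integrability follows by |x| \<le> 1 + x^2 and |x y| \<le> x^2 + y^2.\<close>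
  have sq: "integrable M (\<lambda>\<omega>. X \<omega> $ i * X \<omega> $ i)" for i
    using c[of i i] not_integrable_integral_eq by fastforce
  have comp: "integrable M (\<lambda>\<omega>. X \<omega> $ i)" for i
  proof (rule Bochner_Integration.integrable_bound)
    show "integrable M (\<lambda>\<omega>. 1 + X \<omega> $ i * X \<omega> $ i)" using sq by simp
    have "\<bar>x\<bar> \<le> 1 + x * x" for x :: real
    proof -
      have "0 \<le> (\<bar>x\<bar> - 1 / 2)\<^sup>2" by simp
      then show ?thesis by (simp add: power2_eq_square algebra_simps)
    qed
    then show "AE \<omega> in M. norm (X \<omega> $ i) \<le> norm (1 + X \<omega> $ i * X \<omega> $ i)" by simp
  qed measurable
  have prod: "integrable M (\<lambda>\<omega>. X \<omega> $ i * X \<omega> $ j)" for i j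
  proof (rule Bochner_Integration.integrable_bound)
    show "integrable M (\<lambda>\<omega>. X \<omega> $ i * X \<omega> $ i + X \<omega> $ j * X \<omega> $ j)" using sq by simp
    have "\<bar>x * y\<bar> \<le> x * x + y * y" for x y :: real
    proof -
      have "0 \<le> (\<bar>x\<bar> - \<bar>y\<bar>)\<^sup>2" by simp
      then have "2 * \<bar>x * y\<bar> \<le> x * x + y * y" by (simp add: power2_eq_square abs_mult algebra_simps)
      then show ?thesis using abs_ge_zero[of "x * y"] by linarith
    qed
    then show "AE \<omega> in M. norm (X \<omega> $ i * X \<omega> $ j) \<le> norm (X \<omega> $ i * X \<omega> $ i + X \<omega> $ j * X \<omega> $ j)" by simp
  qed measurable
  have intX: "integrable M X"
  proof (rule Bochner_Integration.integrable_bound)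
    show "integrable M (\<lambda>\<omega>. \<Sum>i\<in>UNIV. \<bar>X \<omega> $ i\<bar>)" using comp by simp
    show "AE \<omega> in M. norm (X \<omega>) \<le> norm (\<Sum>i\<in>UNIV. \<bar>X \<omega> $ i\<bar>)"
      using norm_le_l1_cart by (intro AE_I2) (simp add: abs_of_nonneg sum_nonneg)
  qed measurable
  have first: "has_bochner_integral M (\<lambda>\<omega>. \<theta> \<bullet> X \<omega>) 0" for \<theta>
    using intX mean by (simp add: has_bochner_integral_iff)
  have second: "has_bochner_integral M (\<lambda>\<omega>. (\<theta> \<bullet> X \<omega>)\<^sup>2) ((norm \<theta>)\<^sup>2)" for \<theta>
  proof -
    have "has_bochner_integral M (\<lambda>\<omega>. \<Sum>i\<in>UNIV. \<Sum>j\<in>UNIV. (\<theta> $ i * \<theta> $ j) * (X \<omega> $ i * X \<omega> $ j))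
        (\<Sum>i\<in>UNIV. \<Sum>j\<in>UNIV. (\<theta> $ i * \<theta> $ j) * (if i = j then 1 else 0))"
      using prod c by (intro has_bochner_integral_sum has_bochner_integral_mult_right) (simp add: has_bochner_integral_iff)
    moreover have "(\<Sum>i\<in>UNIV. \<Sum>j\<in>UNIV. (\<theta> $ i * \<theta> $ j) * (if i = j then 1 else 0)) = (norm \<theta>)\<^sup>2"
      by (simp add: power2_norm_eq_inner inner_vec_def sum.delta if_distrib cong: if_cong)
    moreover have "(\<Sum>i\<in>UNIV. \<Sum>j\<in>UNIV. (\<theta> $ i * \<theta> $ j) * (x $ i * x $ j)) = (\<theta> \<bullet> x)\<^sup>2" for x
      by (simp add: inner_vec_def power2_eq_square sum_product mult_ac)
    ultimately show ?thesis by (simp only:)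
  qed
  have transfer: "has_bochner_integral lborel (\<lambda>x. g x * p x) I"
    if "has_bochner_integral M (\<lambda>\<omega>. g (X \<omega>)) I" "g \<in> borel_measurable borel" for g :: "real ^ 'd \<Rightarrow> real" and I
    using distributed_integral[OF D, of g] distributed_integrable[OF D, of g] nn that
    by (simp add: has_bochner_integral_iff mult.commute)
  have "isotropic_density p"
  proof
    show "has_bochner_integral lborel p 1"
      using transfer[of "\<lambda>_. 1" 1] by (simp add: has_bochner_integral_iff prob_space)
    show "has_bochner_integral lborel (\<lambda>x. \<theta> \<bullet> x * p x) 0" for \<theta>
      using transfer[OF first] by simp
    show "has_bochner_integral lborel (\<lambda>x. (\<theta> \<bullet> x)\<^sup>2 * p x) ((norm \<theta>)\<^sup>2)" for \<theta>
      using transfer[OF second] by simp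
  qed (use p pm in auto)
  with law show ?thesis by blast
qed

lemma char_vec_distr:
  "X \<in> borel_measurable M \<Longrightarrow> char_vec (distr M borel X) t = (CLINT \<omega>|M. iexp (t \<bullet> X \<omega>))"
  unfolding char_vec_def by (subst integral_distr) auto

lemma char_vec_normalized_sum:
  fixes X :: "nat \<Rightarrow> 'a \<Rightarrow> real ^ 'd"
  assumes "indep_vars (\<lambda>_. borel) X {1..n}"
  shows "char_vec (distr M borel (normalized_sum n X)) t = (\<Prod>k\<in>{1..n}. char_vec (distr M borel (X k)) (t /\<^sub>R sqrt (real n)))"
proof -
  have rv[measurable]: "X k \<in> borel_measurable M" if "k \<in> {1..n}" for k
    using assms that by (simp add: indep_vars_def)
  have [measurable]: "normalized_sum n X \<in> borel_measurable M"
    unfolding normalized_sum_def[abs_def] by measurable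
  let ?s = "t /\<^sub>R sqrt (real n)"
  have "iexp (t \<bullet> normalized_sum n X \<omega>) = (\<Prod>k\<in>{1..n}. iexp (?s \<bullet> X k \<omega>))" for \<omega>
    by (simp add: normalized_sum_def inner_sum_right sum_distrib_left exp_sum divide_inverse)
  then have "char_vec (distr M borel (normalized_sum n X)) t = (CLINT \<omega>|M. (\<Prod>k\<in>{1..n}. iexp (?s \<bullet> X k \<omega>)))"
    by (simp add: char_vec_distr)
  also have "\<dots> = (\<Prod>k\<in>{1..n}. CLINT \<omega>|M. iexp (?s \<bullet> X k \<omega>))"
  proof (rule indep_vars_lebesgue_integral)
    show "indep_vars (\<lambda>_. borel) (\<lambda>k \<omega>. iexp (?s \<bullet> X k \<omega>)) {1..n}"
      using assms by (rule indep_vars_compose2) simp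
    show "integrable M (\<lambda>\<omega>. iexp (?s \<bullet> X k \<omega>))" if "k \<in> {1..n}" for k
      using rv[OF that] by (intro integrable_const_bound[of _ 1]) auto
  qed simp
  also have "\<dots> = (\<Prod>k\<in>{1..n}. char_vec (distr M borel (X k)) ?s)"
    by (intro prod.cong refl) (simp add: char_vec_distr)
  finally show ?thesis .
qed

end

lemma char_vec_std_gaussian:
  "char_vec (density lborel (\<lambda>x. ennreal (std_gaussian_density x))) t = of_real (exp (- (norm t)\<^sup>2 / 2))"
  using has_bochner_integral_std_gaussian_iexp[of t]
  unfolding char_vec_def
  by (subst integral_density) (auto simp: has_bochner_integral_iff inner_commute)

lemma vec_distribution_std_gaussian: "vec_distribution (density lborel (\<lambda>x :: real ^ 'd. ennreal (std_gaussian_density x)))"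
proof (intro vec_distribution.intro vec_distribution_axioms.intro prob_spaceI)
  show "emeasure (density lborel (\<lambda>x :: real ^ 'd. ennreal (std_gaussian_density x)))
      (space (density lborel (\<lambda>x. ennreal (std_gaussian_density x)))) = 1"
    using has_bochner_integral_std_gaussian[where 'd='d]
    by (simp add: emeasure_density has_bochner_integral_iff nn_integral_eq_integral)
qed simp

text \<open>Meant for r = sqrt n: the square integral of f (t / sqrt n) costs n^(d/2), uniformly in
  e, and \<delta>^(n-2) later beats this power.\<close>

lemma scaled_plancherel_le:
  fixes p :: "real ^ 'd \<Rightarrow> real"
  assumes p: "isotropic_density p" "\<And>x. p x \<le> B" and e: "0 < e" and r: "0 < r"
  defines "f \<equiv> char_vec (density lborel (\<lambda>x. ennreal (p x)))"
  shows "integrable lborel (\<lambda>t. gauss_weight e t * (cmod (f (t /\<^sub>R r)))\<^sup>2)"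
    and "(\<integral>t. gauss_weight e t * (cmod (f (t /\<^sub>R r)))\<^sup>2 \<partial>lborel) \<le> r ^ CARD('d) * ((2 * pi) ^ CARD('d) * B)"
proof -
  interpret isotropic_density p by fact
  let ?g = "\<lambda>t. gauss_weight (e * r) t * (cmod (f t))\<^sup>2"
  have "integrable lborel (\<lambda>t. gauss_weight (e * r) t *\<^sub>R (of_real ((cmod (f t))\<^sup>2) :: complex))"
    using e r law.cmod_char_vec_le_1 unfolding f_def
    by (intro integrable_gauss_weight_bounded[where B=1]) (auto simp: norm_power power_le_one)
  then have "integrable lborel ?g"
    by (simp only: scaleR_conv_of_real of_real_mult[symmetric] complex_of_real_integrable_eq)
  then have "has_bochner_integral lborel ?g (\<integral>t. ?g t \<partial>lborel)"
    by (rule has_bochner_integral_integrable)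
  from has_bochner_integral_lborel_affine[OF this, of "1 / r" 0] r
  have h: "has_bochner_integral lborel (\<lambda>t. ?g (t /\<^sub>R r)) ((\<integral>t. ?g t \<partial>lborel) * r ^ CARD('d))"
    by (simp add: power_one_over inverse_eq_divide mult.commute)
  have eq: "?g (t /\<^sub>R r) = gauss_weight e t * (cmod (f (t /\<^sub>R r)))\<^sup>2" for t
  proof -
    have "e * r * norm (t /\<^sub>R r) = e * norm t" using r by simp
    then show ?thesis by (simp only: gauss_weight_def)
  qed
  show "integrable lborel (\<lambda>t. gauss_weight e t * (cmod (f (t /\<^sub>R r)))\<^sup>2)"
    using h unfolding eq by (auto simp: has_bochner_integral_iff)
  have "(\<integral>t. gauss_weight e t * (cmod (f (t /\<^sub>R r)))\<^sup>2 \<partial>lborel) = (\<integral>t. ?g t \<partial>lborel) * r ^ CARD('d)"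
    using h unfolding eq by (auto simp: has_bochner_integral_iff)
  also have "\<dots> \<le> ((2 * pi) ^ CARD('d) * B) * r ^ CARD('d)"
    using e r p(2) unfolding f_def
    by (intro mult_right_mono law.plancherel_le[OF refl]) auto
  finally show "(\<integral>t. gauss_weight e t * (cmod (f (t /\<^sub>R r)))\<^sup>2 \<partial>lborel) \<le> r ^ CARD('d) * ((2 * pi) ^ CARD('d) * B)"
    by (simp add: mult_ac)
qed

text \<open>\<open>m = 3\<close> in general and \<open>m = 4\<close> for symmetric distributions; then \<open>n / sqrt n ^ m\<close> is the rate.\<close>

lemma char_product_diff_le:
  fixes f :: "nat \<Rightarrow> real ^ 'd \<Rightarrow> complex" and t :: "real ^ 'd"
  assumes n: "2 \<le> n" and m: "m \<in> {3, 4}" and b: "1 \<le> b" and \<delta>: "0 < \<delta>" "\<delta> < 1"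
    and le1: "\<And>k s. k \<in> {1..n} \<Longrightarrow> cmod (f k s) \<le> 1"
    and taylor: "\<And>k s. k \<in> {1..n} \<Longrightarrow> cmod (f k s - of_real (1 - (norm s)\<^sup>2 / 2)) \<le> b * norm s ^ m"
    and away: "\<And>k s. k \<in> {1..n} \<Longrightarrow> 1 / (4 * b) \<le> norm s \<Longrightarrow> cmod (f k s) \<le> \<delta>"
  shows "cmod ((\<Prod>k\<in>{1..n}. f k (t /\<^sub>R sqrt (real n))) - of_real (exp (- (norm t)\<^sup>2 / 2)))
    \<le> (b + 1 + (4 * b) ^ m) * (real n / sqrt (real n) ^ m) * (norm t ^ m * exp (- (norm t)\<^sup>2 / 8))
      + \<delta> ^ (n - 2) * ((cmod (f 1 (t /\<^sub>R sqrt (real n))))\<^sup>2 + (cmod (f 2 (t /\<^sub>R sqrt (real n))))\<^sup>2)"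
    (is "?L \<le> (b + 1 + (4 * b) ^ m) * ?\<kappa> * ?G + ?H")
proof -
  define s where "s = t /\<^sub>R sqrt (real n)"
  define y where "y = norm s"
  have n0: "0 < real n" using n by simp
  have y: "0 \<le> y" by (simp add: y_def)
  have ty: "norm t = sqrt (real n) * y" using n0 by (simp add: y_def s_def)
  have t2: "(norm t)\<^sup>2 = real n * y\<^sup>2" using n0 by (simp add: ty power_mult_distrib)
  have \<kappa>: "?\<kappa> * norm t ^ m = real n * y ^ m"
    using n0 by (simp add: ty power_mult_distrib)
  have \<kappa>0: "0 \<le> ?\<kappa>" by simp
  have G0: "0 \<le> ?G" by simp
  have H0: "0 \<le> ?H" using \<delta> by simp
  show ?thesis
  proof (cases "y \<le> 1 / (4 * b)")
    case True
    define r where "r = exp (- y\<^sup>2 / 4)"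
    have r: "0 < r" by (simp add: r_def)
    have fac: "cmod (f k s) \<le> r" "cmod (f k s - of_real (exp (- y\<^sup>2 / 2))) \<le> (b + 1) * y ^ m" if "k \<in> {1..n}" for k
      using near_gaussian_factor[OF m b y True, of "f k s"] taylor[OF that, of s] by (auto simp: y_def r_def)
    have "exp (- y\<^sup>2 / 2) \<le> r" by (simp add: r_def)
    then have "cmod ((\<Prod>k\<in>{1..n}. f k s) - (\<Prod>k\<in>{1..n}. of_real (exp (- y\<^sup>2 / 2))))
        \<le> r ^ card {1..n} * (real (card {1..n}) * ((b + 1) * y ^ m / r))"
      using fac r by (intro norm_prod_diff_le) auto
    also have "(\<Prod>k\<in>{1..n}. of_real (exp (- y\<^sup>2 / 2))) = (of_real (exp (- (norm t)\<^sup>2 / 2)) :: complex)"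
    proof -
      have "(\<Prod>k\<in>{1..n}. exp (- y\<^sup>2 / 2)) = exp (- (norm t)\<^sup>2 / 2)"
        by (simp add: exp_of_nat_mult[symmetric] t2)
      then show ?thesis by (simp only: of_real_prod[symmetric])
    qed
    also have "r ^ card {1..n} * (real (card {1..n}) * ((b + 1) * y ^ m / r)) = (b + 1) * (real n * y ^ m) * (r ^ n / r)"
      unfolding card_atLeastAtMost diff_Suc_1 by (simp only: times_divide_eq_right times_divide_eq_left mult_ac)
    \<comment> \<open>n - 1 of the n factors keep their decay exp (- y^2/4), and n - 1 \<ge> n/2
      turns this into exp (- |t|^2/8), since |t|^2 = n y^2.\<close>
    also have "\<dots> \<le> (b + 1) * (real n * y ^ m) * exp (- (norm t)\<^sup>2 / 8)"
    proof (rule mult_left_mono)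
      have "r ^ n / r = exp (- (real n - 1) * y\<^sup>2 / 4)"
        by (simp add: r_def exp_of_nat_mult[symmetric] exp_diff[symmetric] algebra_simps diff_divide_distrib)
      also have "\<dots> \<le> exp (- (norm t)\<^sup>2 / 8)"
      proof -
        have "(real n / 2) * y\<^sup>2 \<le> (real n - 1) * y\<^sup>2" using n by (intro mult_right_mono) auto
        then show ?thesis by (simp add: t2 algebra_simps)
      qed
      finally show "r ^ n / r \<le> exp (- (norm t)\<^sup>2 / 8)" .
    qed (use b y in simp)
    also have "\<dots> = (b + 1) * ?\<kappa> * ?G"
      unfolding \<kappa>[symmetric] by simp
    also have "\<dots> \<le> (b + 1 + (4 * b) ^ m) * ?\<kappa> * ?G + ?H"
    proof -
      have "(b + 1) * ?\<kappa> * ?G \<le> (b + 1 + (4 * b) ^ m) * ?\<kappa> * ?G"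
        by (intro mult_right_mono \<kappa>0 G0) (use b in simp)
      with H0 show ?thesis by linarith
    qed
    finally show ?thesis unfolding s_def .
  next
    case False
    then have away': "1 / (4 * b) \<le> norm s" by (simp add: y_def)
    \<comment> \<open>Far out 4 b y exceeds 1, so inserting its m-th power brings the Gaussian tail,
      too, under the rate n / sqrt n ^ m.\<close>
    have g: "exp (- (norm t)\<^sup>2 / 2) \<le> (4 * b) ^ m * ?\<kappa> * ?G"
    proof -
      have "1 \<le> (4 * b * y) ^ m" using False b by (intro one_le_power) (simp add: field_simps)
      also have "\<dots> = (4 * b) ^ m * y ^ m" by (rule power_mult_distrib)
      also have "\<dots> \<le> (4 * b) ^ m * (real n * y ^ m)"
        using n b y mult_right_mono[of 1 "real n" "y ^ m"] by (intro mult_left_mono) auto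
      finally have one: "1 \<le> (4 * b) ^ m * (real n * y ^ m)" .
      have "exp (- (norm t)\<^sup>2 / 2) \<le> 1 * exp (- (norm t)\<^sup>2 / 8)" by simp
      also have "\<dots> \<le> (4 * b) ^ m * (real n * y ^ m) * exp (- (norm t)\<^sup>2 / 8)"
        using one by (intro mult_right_mono) auto
      finally show ?thesis unfolding \<kappa>[symmetric] by simp
    qed
    \<comment> \<open>The first two factors are kept and bounded by the sum of their squares, whose
      weighted integrals Plancherel controls; only the remaining n - 2 are replaced by
      \<delta>.\<close>
    have split: "{1..n} = insert 1 (insert 2 {3..n})" using n by auto
    have "cmod (\<Prod>k\<in>{1..n}. f k s) = cmod (f 1 s) * (cmod (f 2 s) * (\<Prod>k\<in>{3..n}. cmod (f k s)))"
      unfolding split by (simp add: norm_mult prod_norm)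
    also have "\<dots> \<le> cmod (f 1 s) * (cmod (f 2 s) * \<delta> ^ (n - 2))"
    proof (intro mult_left_mono)
      have "(\<Prod>k\<in>{3..n}. cmod (f k s)) \<le> (\<Prod>k\<in>{3..n}. \<delta>)"
        using away[OF _ away'] by (intro prod_mono) auto
      also have "\<dots> = \<delta> ^ (n - 2)" using n by (simp add: numeral_eq_Suc)
      finally show "(\<Prod>k\<in>{3..n}. cmod (f k s)) \<le> \<delta> ^ (n - 2)" .
    qed auto
    also have "cmod (f 1 s) * (cmod (f 2 s) * \<delta> ^ (n - 2)) = \<delta> ^ (n - 2) * (cmod (f 1 s) * cmod (f 2 s))"
      by simp
    also have "\<dots> \<le> \<delta> ^ (n - 2) * ((cmod (f 1 s))\<^sup>2 + (cmod (f 2 s))\<^sup>2)"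
    proof (rule mult_left_mono)
      have "0 \<le> (cmod (f 1 s) - cmod (f 2 s))\<^sup>2" by simp
      then have "2 * (cmod (f 1 s) * cmod (f 2 s)) \<le> (cmod (f 1 s))\<^sup>2 + (cmod (f 2 s))\<^sup>2"
        by (simp add: power2_eq_square algebra_simps)
      moreover have "0 \<le> cmod (f 1 s) * cmod (f 2 s)" by simp
      ultimately show "cmod (f 1 s) * cmod (f 2 s) \<le> (cmod (f 1 s))\<^sup>2 + (cmod (f 2 s))\<^sup>2" by linarith
    qed (use \<delta> in simp)
    finally have "cmod (\<Prod>k\<in>{1..n}. f k s) \<le> ?H"
      by (simp add: s_def mult_left_mono)
    moreover have "?L \<le> cmod (\<Prod>k\<in>{1..n}. f k s) + exp (- (norm t)\<^sup>2 / 2)"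
      unfolding s_def[symmetric] using norm_triangle_ineq4[of "\<Prod>k\<in>{1..n}. f k s" "of_real (exp (- (norm t)\<^sup>2 / 2))"]
      by (simp only: norm_of_real abs_exp_cancel)
    moreover have "(4 * b) ^ m * ?\<kappa> * ?G \<le> (b + 1 + (4 * b) ^ m) * ?\<kappa> * ?G"
      by (intro mult_right_mono \<kappa>0 G0) (use b in simp)
    ultimately show ?thesis using g by linarith
  qed
qed

section \<open>The local limit theorem\<close>

lemma density_distance_le:
  assumes [measurable]: "p \<in> borel_measurable borel" and "AE x in lborel. \<bar>p x - std_gaussian_density x\<bar> \<le> D"
  shows "density_distance p \<le> ereal D"
  unfolding density_distance_def using assms(2) by (intro esssup_I) auto

lemma (in prob_space) third_moment_symmetric:
  fixes X :: "'a \<Rightarrow> real ^ 'd"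
  assumes [measurable]: "X \<in> borel_measurable M" and "symmetric_distribution M X"
  shows "(\<integral>x. (s \<bullet> x) ^ 3 \<partial>distr M borel X) = 0"
proof -
  have "(\<integral>x. (s \<bullet> x) ^ 3 \<partial>distr M borel X) = (\<integral>x. (s \<bullet> x) ^ 3 \<partial>distr M borel (\<lambda>\<omega>. - X \<omega>))"
    using assms(2) by (simp add: symmetric_distribution_def)
  also have "\<dots> = - (\<integral>x. (s \<bullet> x) ^ 3 \<partial>distr M borel X)"
    by (simp add: integral_distr power3_eq_cube)
  finally show ?thesis by simp
qed

text \<open>Integrated over t, the first term of \<open>char_product_diff_le\<close> yields the rate
  times a Gaussian moment. The second yields a multiple of \<delta>^(n-2) n^(d/2), which is of order
  1/n and so within either rate. For n = 1 it suffices that both densities are bounded.\<close>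

theorem local_limit_estimate:
  "\<exists>C\<ge>0. \<forall>m\<in>{3, 4}. \<forall>n\<ge>1. \<forall>(M :: 'a measure) (X :: nat \<Rightarrow> 'a \<Rightarrow> real ^ 'd) (p :: real ^ 'd \<Rightarrow> real).
    isotropic_log_concave_vectors M n X \<and> (\<forall>x. 0 \<le> p x) \<and>
    distributed M lborel (normalized_sum n X) (\<lambda>x. ennreal (p x)) \<and>
    (m = 4 \<longrightarrow> (\<forall>k\<in>{1..n}. symmetric_distribution M (X k))) \<longrightarrow>
      density_distance p \<le> ereal (C * (real n / sqrt (real n) ^ m))"
proof -
  obtain M0 B where M0: "0 < M0" and B: "0 < B"
    and bounds: "\<And>q :: real ^ 'd \<Rightarrow> real. isotropic_density q \<Longrightarrow> (\<forall>x. q x \<le> M0) \<and>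
       integrable (density lborel (\<lambda>x. ennreal (q x))) (\<lambda>x. (norm x) ^ 4) \<and>
       (\<integral>x. (norm x) ^ 4 \<partial>density lborel (\<lambda>x. ennreal (q x))) \<le> B"
    using isotropic_density_bounds[where 'd='d] by blast
  define b where "b = 1 + B"
  have b: "1 \<le> b" using B by (simp add: b_def)
  then have "0 < 1 / (4 * b)" by simp
  from char_vec_bounded_away_from_1[OF this, of M0, where 'd='d]
  obtain \<delta> where \<delta>: "0 < \<delta>" "\<delta> < 1" and away: "\<And>(q :: real ^ 'd \<Rightarrow> real) s. isotropic_density q \<Longrightarrow> \<forall>x. q x \<le> M0 \<Longrightarrow>
      1 / (4 * b) \<le> norm s \<Longrightarrow> cmod (char_vec (density lborel (\<lambda>x. ennreal (q x))) s) \<le> \<delta>"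
    by blast
  \<comment> \<open>The exponent d + 1: n^d covers the Plancherel cost sqrt n ^ d, and one more n
    leaves a gain of 1/n.\<close>
  obtain K where K: "0 \<le> K" and geom: "\<And>n. 2 \<le> n \<Longrightarrow> real n ^ (CARD('d) + 1) * \<delta> ^ (n - 2) \<le> K"
    using power_times_geometric_bounded[OF \<delta>] by blast
  define G where "G m = (\<integral>t. norm t ^ m * exp (- (norm (t :: real ^ 'd))\<^sup>2 / 8) \<partial>lborel)" for m
  define A where "A m = (b + 1 + (4 * b) ^ m) * G m + 2 * K * ((2 * pi) ^ CARD('d) * M0)" for m
  \<comment> \<open>M0 + 1 serves n = 1; adding A for both orders lets one constant serve both
    rates. The division undoes the factor (2 pi)^d of Fourier inversion.\<close>
  define C where "C = (M0 + 1) + (A 3 + A 4) / (2 * pi) ^ CARD('d)"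
  have G: "0 \<le> G m" for m unfolding G_def by (intro integral_nonneg_AE) auto
  have A: "0 \<le> A m" for m
    unfolding A_def using b K G M0 by (intro add_nonneg_nonneg mult_nonneg_nonneg) auto
  have AC: "A m \<le> (2 * pi) ^ CARD('d) * C" if "m \<in> {3, 4}" for m
  proof -
    have "A m \<le> (2 * pi) ^ CARD('d) * (M0 + 1) + (A 3 + A 4)"
      using that A[of 3] A[of 4] M0 by (auto intro: add_increasing)
    also have "\<dots> = (2 * pi) ^ CARD('d) * C"
    proof -
      have P: "(2 * pi) ^ CARD('d) \<noteq> 0" by simp
      show ?thesis
        unfolding C_def distrib_left[of _ "M0 + 1"] times_divide_eq_right nonzero_mult_div_cancel_left[OF P] ..
    qed
    finally show ?thesis .
  qed
  have C: "M0 + 1 \<le> C" using A[of 3] A[of 4] by (simp add: C_def)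
  have "density_distance p \<le> ereal (C * (real n / sqrt (real n) ^ m))"
    if m: "m \<in> {3, 4}" and n: "1 \<le> n" and iso: "isotropic_log_concave_vectors M n X"
      and p0: "\<forall>x. 0 \<le> p x" and D: "distributed M lborel (normalized_sum n X) (\<lambda>x. ennreal (p x))"
      and sym: "m = 4 \<longrightarrow> (\<forall>k\<in>{1..n}. symmetric_distribution M (X k))"
    for m n and M :: "'a measure" and X :: "nat \<Rightarrow> 'a \<Rightarrow> real ^ 'd" and p
  proof -
    interpret prob_space M using iso by (simp add: isotropic_log_concave_vectors_def)
    have indep: "indep_vars (\<lambda>_. borel) X {1..n}"
      using iso by (simp add: isotropic_log_concave_vectors_def)
    then have rv: "X k \<in> borel_measurable M" if "k \<in> {1..n}" for k
      using that by (simp add: indep_vars_def)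
    have pm[measurable]: "p \<in> borel_measurable borel"
      using distributed_real_measurable[OF _ D] p0 by simp
    have "\<forall>k\<in>{1..n}. \<exists>q. isotropic_density q \<and> distr M borel (X k) = density lborel (\<lambda>x. ennreal (q x))"
      using iso by (auto simp: isotropic_log_concave_vectors_def intro!: isotropic_density_of_random_vector)
    then obtain q where q: "\<And>k. k \<in> {1..n} \<Longrightarrow> isotropic_density (q k)"
      "\<And>k. k \<in> {1..n} \<Longrightarrow> distr M borel (X k) = density lborel (\<lambda>x. ennreal (q k x))"
      unfolding bchoice_iff by blast
    have qM: "\<And>k x. k \<in> {1..n} \<Longrightarrow> q k x \<le> M0" using bounds q(1) by blast
    have law: "distr M borel (normalized_sum n X) = density lborel (\<lambda>x. ennreal (p x))"
      using distributed_distr_eq_density[OF D] by (simp cong: distr_cong)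
    show ?thesis
    proof (cases "n = 1")
      case True
      have "normalized_sum n X = X 1" by (simp add: normalized_sum_def True fun_eq_iff)
      \<comment> \<open>p is an arbitrary version, so it agrees with the bounded density
        \<open>q 1\<close> only almost everywhere.\<close>
      with law q(2)[of 1] True have "density lborel (\<lambda>x. ennreal (p x)) = density lborel (\<lambda>x. ennreal (q 1 x))"
        by simp
      moreover have [measurable]: "q 1 \<in> borel_measurable borel" and q0: "\<And>x. 0 \<le> q 1 x"
        using q(1)[of 1] True isotropic_density.measurable isotropic_density.nonneg by auto
      ultimately have "AE x in lborel. ennreal (p x) = ennreal (q 1 x)"
        by (subst (asm) sigma_finite_measure.density_unique_iff[OF sigma_finite_lborel]) auto
      then have "AE x in lborel. \<bar>p x - std_gaussian_density x\<bar> \<le> C * (real n / sqrt (real n) ^ m)"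
      proof eventually_elim
        case (elim x)
        then have "p x = q 1 x" using p0 q0 by simp
        then have "p x \<le> M0" using qM[of 1 x] True by simp
        moreover have "0 \<le> p x" using p0 by blast
        moreover have "std_gaussian_density x \<le> 1"
          by (rule order_trans[OF std_gaussian_density_le]) (use pi_ge_two in \<open>auto intro!: powr_le_one_le simp: powr_minus_divide divide_le_eq_1 ge_one_powr_ge_zero\<close>)
        moreover have "0 \<le> std_gaussian_density x" by simp
        ultimately have "\<bar>p x - std_gaussian_density x\<bar> \<le> C" using C by linarith
        then show ?case using True by simp
      qed
      then show ?thesis by (rule density_distance_le[OF pm])
    next
      case False
      with n have n2: "2 \<le> n" by simp
      define \<kappa> where "\<kappa> = real n / sqrt (real n) ^ m"
      define f where "f k = char_vec (density lborel (\<lambda>x. ennreal (q k x)))" for k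
      define h where "h k t = cmod (f k (t /\<^sub>R sqrt (real n)))" for k t
      define P where "P = (2 * pi) ^ CARD('d)"
      have taylor: "cmod (f k s - of_real (1 - (norm s)\<^sup>2 / 2)) \<le> b * norm s ^ m" if k: "k \<in> {1..n}" for k s
      proof -
        interpret isotropic_density "q k" using q(1)[OF k] .
        note T = char_vec_taylor[of B s]
        show ?thesis
        proof (cases "m = 3")
          case True
          then show ?thesis using T(1) bounds[OF q(1)[OF k]] by (simp add: f_def b_def)
        next
          case False
          then have m4: "m = 4" using m by simp
          then have "(\<integral>x. (s \<bullet> x) ^ 3 \<partial>law) = 0"
            using third_moment_symmetric[OF rv[OF k], of s] sym k q(2)[OF k] by simp
          then show ?thesis using T(2) bounds[OF q(1)[OF k]] m4 by (simp add: f_def b_def)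
        qed
      qed
      have le1: "cmod (f k s) \<le> 1" if k: "k \<in> {1..n}" for k s
      proof -
        interpret isotropic_density "q k" using q(1)[OF k] .
        show ?thesis unfolding f_def by (rule law.cmod_char_vec_le_1)
      qed
      have away_f: "cmod (f k s) \<le> \<delta>" if "k \<in> {1..n}" "1 / (4 * b) \<le> norm s" for k s
        unfolding f_def by (rule away) (use q(1) qM that in auto)
      have "1 / real n \<le> \<kappa>"
      proof -
        have "sqrt (real n) ^ m \<le> sqrt (real n) ^ 4" using m n by (intro power_increasing) auto
        also have "\<dots> = real n * real n" by (simp add: power4_eq_xxxx)
        finally show ?thesis using n by (simp add: \<kappa>_def field_simps)
      qed
      have rate: "\<delta> ^ (n - 2) * sqrt (real n) ^ CARD('d) \<le> K * \<kappa>"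
      proof -
        have "sqrt (real n) \<le> real n"
          using n by (intro real_le_lsqrt) (auto simp: power2_eq_square)
        then have "\<delta> ^ (n - 2) * sqrt (real n) ^ CARD('d) \<le> \<delta> ^ (n - 2) * real n ^ CARD('d)"
          using \<delta> by (intro mult_left_mono power_mono) auto
        also have "\<dots> = real n ^ (CARD('d) + 1) * \<delta> ^ (n - 2) * (1 / real n)"
          using n by simp
        also have "\<dots> \<le> K * \<kappa>"
          using geom[OF n2] K \<open>1 / real n \<le> \<kappa>\<close> by (intro mult_mono) auto
        finally show ?thesis .
      qed
      have char: "cmod (char_vec (density lborel (\<lambda>x. ennreal (p x))) t - char_vec (density lborel (\<lambda>x. ennreal (std_gaussian_density x))) t)
        \<le> (b + 1 + (4 * b) ^ m) * \<kappa> * (norm t ^ m * exp (- (norm t)\<^sup>2 / 8)) + \<delta> ^ (n - 2) * ((h 1 t)\<^sup>2 + (h 2 t)\<^sup>2)" for t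
      proof -
        have "char_vec (density lborel (\<lambda>x. ennreal (p x))) t = (\<Prod>k\<in>{1..n}. f k (t /\<^sub>R sqrt (real n)))"
          unfolding law[symmetric] char_vec_normalized_sum[OF indep] f_def using q(2) by (intro prod.cong) auto
        then show ?thesis
          unfolding char_vec_std_gaussian \<kappa>_def h_def
          using char_product_diff_le[OF n2 m b \<delta> le1 taylor away_f, where t = t] by simp
      qed
      have "AE x in lborel. \<bar>p x - std_gaussian_density x\<bar> \<le> C * \<kappa>"
      proof (rule AE_density_close[OF _ vec_distribution_std_gaussian refl refl])
        show "vec_distribution (density lborel (\<lambda>x. ennreal (p x)))"
          unfolding law[symmetric] vec_distribution_def vec_distribution_axioms_def
          using distributed_measurable[OF D] by (auto intro!: prob_space_distr)
        fix e :: real assume e: "0 < e"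
        let ?gauss = "\<lambda>t :: real ^ 'd. norm t ^ m * exp (- (norm t)\<^sup>2 / 8)"
        have sqrt_pos: "0 < sqrt (real n)" using n by simp
        have sc: "integrable lborel (\<lambda>t. gauss_weight e t * (h k t)\<^sup>2)"
          "(\<integral>t. gauss_weight e t * (h k t)\<^sup>2 \<partial>lborel) \<le> sqrt (real n) ^ CARD('d) * (P * M0)" if "k \<in> {1..n}" for k
          unfolding h_def f_def P_def by (rule scaled_plancherel_le[OF q(1)[OF that] qM[OF that] e sqrt_pos])+
        have k12: "1 \<in> {1..n}" "2 \<in> {1..n}" using n2 by auto
        have ig: "integrable lborel ?gauss" using m by (intro integrable_power_gauss) auto
        have i: "integrable lborel (\<lambda>t. (b + 1 + (4 * b) ^ m) * \<kappa> * ?gauss t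
            + \<delta> ^ (n - 2) * (gauss_weight e t * (h 1 t)\<^sup>2 + gauss_weight e t * (h 2 t)\<^sup>2))"
          by (intro Bochner_Integration.integrable_add integrable_mult_right ig sc k12)
        have "(\<integral>t. gauss_weight e t * cmod (char_vec (density lborel (\<lambda>x. ennreal (p x))) t
              - char_vec (density lborel (\<lambda>x. ennreal (std_gaussian_density x))) t) \<partial>lborel)
          \<le> (\<integral>t. (b + 1 + (4 * b) ^ m) * \<kappa> * ?gauss t
            + \<delta> ^ (n - 2) * (gauss_weight e t * (h 1 t)\<^sup>2 + gauss_weight e t * (h 2 t)\<^sup>2) \<partial>lborel)"
        \<comment> \<open>The weight, being at most 1, is dropped in front of the integrable first
          term and kept in front of the squares; the final bound is free of e.\<close>
        proof (rule integral_mono'[OF i])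
          fix t :: "real ^ 'd"
          have c0: "0 \<le> (b + 1 + (4 * b) ^ m) * \<kappa> * ?gauss t"
            using b by (auto simp: \<kappa>_def)
          show "gauss_weight e t * cmod (char_vec (density lborel (\<lambda>x. ennreal (p x))) t
              - char_vec (density lborel (\<lambda>x. ennreal (std_gaussian_density x))) t)
            \<le> (b + 1 + (4 * b) ^ m) * \<kappa> * ?gauss t + \<delta> ^ (n - 2) * (gauss_weight e t * (h 1 t)\<^sup>2 + gauss_weight e t * (h 2 t)\<^sup>2)"
          proof -
            have "gauss_weight e t * cmod (char_vec (density lborel (\<lambda>x. ennreal (p x))) t
                - char_vec (density lborel (\<lambda>x. ennreal (std_gaussian_density x))) t)
              \<le> gauss_weight e t * ((b + 1 + (4 * b) ^ m) * \<kappa> * ?gauss t + \<delta> ^ (n - 2) * ((h 1 t)\<^sup>2 + (h 2 t)\<^sup>2))"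
              by (intro mult_left_mono char) simp
            also have "\<dots> = gauss_weight e t * ((b + 1 + (4 * b) ^ m) * \<kappa> * ?gauss t)
                + \<delta> ^ (n - 2) * (gauss_weight e t * (h 1 t)\<^sup>2 + gauss_weight e t * (h 2 t)\<^sup>2)"
              by (simp only: distrib_left mult.left_commute)
            also have "gauss_weight e t * ((b + 1 + (4 * b) ^ m) * \<kappa> * ?gauss t) \<le> (b + 1 + (4 * b) ^ m) * \<kappa> * ?gauss t"
              using c0 by (intro mult_left_le_one_le) auto
            finally show ?thesis by simp
          qed
          show "0 \<le> (b + 1 + (4 * b) ^ m) * \<kappa> * ?gauss t + \<delta> ^ (n - 2) * (gauss_weight e t * (h 1 t)\<^sup>2 + gauss_weight e t * (h 2 t)\<^sup>2)"
            using c0 \<delta> by (intro add_nonneg_nonneg) auto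
        qed
        also have "\<dots> = (b + 1 + (4 * b) ^ m) * \<kappa> * G m
            + \<delta> ^ (n - 2) * ((\<integral>t. gauss_weight e t * (h 1 t)\<^sup>2 \<partial>lborel) + (\<integral>t. gauss_weight e t * (h 2 t)\<^sup>2 \<partial>lborel))"
          using ig sc(1)[OF k12(1)] sc(1)[OF k12(2)] by (simp add: G_def)
        also have "\<dots> \<le> (b + 1 + (4 * b) ^ m) * \<kappa> * G m + \<delta> ^ (n - 2) * (2 * (sqrt (real n) ^ CARD('d) * (P * M0)))"
          using sc(2)[OF k12(1)] sc(2)[OF k12(2)] \<delta> by (intro add_left_mono mult_left_mono) auto
        also have "\<dots> = (b + 1 + (4 * b) ^ m) * \<kappa> * G m + (\<delta> ^ (n - 2) * sqrt (real n) ^ CARD('d)) * (2 * (P * M0))"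
          by simp
        also have "\<dots> \<le> (b + 1 + (4 * b) ^ m) * \<kappa> * G m + (K * \<kappa>) * (2 * (P * M0))"
          using rate M0 by (intro add_left_mono mult_right_mono) (auto simp: P_def)
        also have "\<dots> = A m * \<kappa>" by (simp add: A_def P_def algebra_simps)
        also have "\<dots> \<le> (2 * pi) ^ CARD('d) * C * \<kappa>"
          using AC[OF m] by (intro mult_right_mono) (auto simp: \<kappa>_def)
        finally show "(\<integral>t. gauss_weight e t * cmod (char_vec (density lborel (\<lambda>x. ennreal (p x))) t
              - char_vec (density lborel (\<lambda>x. ennreal (std_gaussian_density x))) t) \<partial>lborel)
          \<le> (2 * pi) ^ CARD('d) * (C * \<kappa>)"
          by (simp only: mult.assoc)
      qed (use p0 in auto)
      then show ?thesis unfolding \<kappa>_def by (rule density_distance_le[OF pm])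
    qed
  qed
  moreover have "0 \<le> C" using C M0 by simp
  ultimately show ?thesis by blast
qed

section \<open>Constants and the choice of the sample space\<close>

lemma ex_local_limit_constant: "\<exists>C. local_limit_constant TYPE('a) TYPE('d::finite) C"
proof -
  obtain C where C: "\<And>m n M X p. m \<in> {3, 4} \<Longrightarrow> 1 \<le> n \<Longrightarrow>
      isotropic_log_concave_vectors (M :: 'a measure) n (X :: nat \<Rightarrow> 'a \<Rightarrow> real ^ 'd) \<Longrightarrow> \<forall>x. 0 \<le> p x \<Longrightarrow>
      distributed M lborel (normalized_sum n X) (\<lambda>x. ennreal (p x)) \<Longrightarrow>
      (m = 4 \<longrightarrow> (\<forall>k\<in>{1..n}. symmetric_distribution M (X k))) \<Longrightarrow>
      density_distance p \<le> ereal (C * (real n / sqrt (real n) ^ m))"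
    using local_limit_estimate[where 'a='a and 'd='d] by blast
  have rates: "real n / sqrt (real n) ^ 3 = 1 / sqrt (real n)" "real n / sqrt (real n) ^ 4 = 1 / real n" if "1 \<le> n" for n
    using that by (simp_all add: power3_eq_cube power4_eq_xxxx)
  show ?thesis
    unfolding local_limit_constant_def
    using C[of 3] C[of 4] by (intro exI[of _ C]) (auto simp: rates)
qed

text \<open>Hypotheses and conclusion concern only the joint law of X_1, ..., X_n. Pushed forward to
  the sequence space, M makes the coordinates X' have this law, so a constant valid there applies to
  the same density p.\<close>

lemma local_limit_constant_transfer:
  assumes C: "local_limit_constant TYPE(nat \<Rightarrow> real ^ 'd) TYPE('d::finite) C"
  shows "local_limit_constant TYPE('a) TYPE('d) C"
  unfolding local_limit_constant_def
proof (intro allI impI)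
  fix n :: nat and M :: "'a measure" and X :: "nat \<Rightarrow> 'a \<Rightarrow> real ^ 'd" and p :: "real ^ 'd \<Rightarrow> real"
  assume n: "1 \<le> n"
    and asm: "isotropic_log_concave_vectors M n X \<and> (\<forall>x. 0 \<le> p x) \<and>
      distributed M lborel (normalized_sum n X) (\<lambda>x. ennreal (p x))"
  interpret prob_space M using asm by (simp add: isotropic_log_concave_vectors_def)
  have indep: "indep_vars (\<lambda>_. borel) X {1..n}"
    using asm by (simp add: isotropic_log_concave_vectors_def)
  then have rv: "X k \<in> borel_measurable M" if "k \<in> {1..n}" for k
    using that by (simp add: indep_vars_def)
  \<comment> \<open>Coordinates outside 1..n are set to 0, since nothing, not even measurability, is
    known about the other X k.\<close>
  define T where "T \<omega> k = (if k \<in> {1..n} then X k \<omega> else 0)" for \<omega> k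
  define Q where "Q = (\<Pi>\<^sub>M k\<in>(UNIV :: nat set). (borel :: (real ^ 'd) measure))"
  define M' where "M' = distr M Q T"
  define X' where "X' k x = x k" for k :: nat and x :: "nat \<Rightarrow> real ^ 'd"
  have T[measurable]: "T \<in> measurable M Q"
    unfolding Q_def
  proof (rule measurable_PiM_single')
    show "(\<lambda>\<omega>. T \<omega> k) \<in> borel_measurable M" for k
      using rv by (cases "k \<in> {1..n}") (auto simp: T_def)
  qed auto
  have X'm[measurable]: "X' k \<in> borel_measurable Q" for k
    unfolding X'_def Q_def by (rule measurable_component_singleton) simp
  then have X'm'[measurable]: "X' k \<in> borel_measurable M'" for k
    unfolding M'_def by simp
  have X'T: "X' k (T \<omega>) = X k \<omega>" if "k \<in> {1..n}" for k \<omega>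
    using that by (simp add: X'_def T_def)
  interpret M': prob_space M'
    unfolding M'_def by (rule prob_space_distr[OF T])
  have sumT: "normalized_sum n X' (T \<omega>) = normalized_sum n X \<omega>" for \<omega>
    unfolding normalized_sum_def using X'T by simp
  have sum_m[measurable]: "normalized_sum n X' \<in> borel_measurable Q"
    unfolding normalized_sum_def[abs_def] by measurable
  have distr: "distr M' N g = distr M N (\<lambda>\<omega>. g (T \<omega>))" if "g \<in> measurable Q N" for g and N :: "'c measure"
    unfolding M'_def using that by (simp add: distr_distr comp_def)
  have int: "integral\<^sup>L M' g = (\<integral>\<omega>. g (T \<omega>) \<partial>M)" if "g \<in> borel_measurable Q" for g :: "(nat \<Rightarrow> real ^ 'd) \<Rightarrow> 'c :: {banach, second_countable_topology}"
    unfolding M'_def using that by (simp add: integral_distr)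
  have I: "{1..n} \<noteq> {}" using n by simp
  have "M'.indep_vars (\<lambda>_. borel) X' {1..n}"
  \<comment> \<open>Independence is read off the joint law, which T preserves; the characterization
    is for nonempty index sets, hence \<open>I\<close>.\<close>
  proof (subst M'.indep_vars_iff_distr_eq_PiM'[OF I])
    have "distr M' (\<Pi>\<^sub>M i\<in>{1..n}. borel) (\<lambda>x. \<lambda>i\<in>{1..n}. X' i x) = distr M (\<Pi>\<^sub>M i\<in>{1..n}. borel) (\<lambda>x. \<lambda>i\<in>{1..n}. X i x)"
    proof -
      have "(\<lambda>x. \<lambda>i\<in>{1..n}. X' i x) \<in> measurable Q (\<Pi>\<^sub>M i\<in>{1..n}. borel)"
        by (rule measurable_restrict) (rule X'm)
      from distr[OF this] show ?thesis by (simp add: X'T cong: restrict_cong)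
    qed
    also have "\<dots> = (\<Pi>\<^sub>M i\<in>{1..n}. distr M borel (X i))"
      using indep rv by (subst (asm) indep_vars_iff_distr_eq_PiM'[OF I]) auto
    also have "\<dots> = (\<Pi>\<^sub>M i\<in>{1..n}. distr M' borel (X' i))"
      by (intro PiM_cong refl) (subst distr, auto intro!: distr_cong simp: X'T)
    finally show "distr M' (\<Pi>\<^sub>M i\<in>{1..n}. borel) (\<lambda>x. \<lambda>i\<in>{1..n}. X' i x) = (\<Pi>\<^sub>M i\<in>{1..n}. distr M' borel (X' i))" .
  qed simp
  moreover have "has_log_concave_density M' (X' k) \<and> (\<integral>\<omega>. X' k \<omega> \<partial>M') = 0 \<and> covariance_matrix M' (X' k) = mat 1"
    if k: "k \<in> {1..n}" for k
  proof -
    have X: "has_log_concave_density M (X k)" "(\<integral>\<omega>. X k \<omega> \<partial>M) = 0" "covariance_matrix M (X k) = mat 1"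
      using asm k by (auto simp: isotropic_log_concave_vectors_def)
    obtain q where q: "log_concave q" "distributed M lborel (X k) (\<lambda>x. ennreal (q x))"
      using X(1) by (auto simp: has_log_concave_density_def)
    have "distr M' lborel (X' k) = distr M lborel (X k)"
      using X'm[of k] by (subst distr) (auto intro!: distr_cong simp: X'T[OF k])
    with q have "distributed M' lborel (X' k) (\<lambda>x. ennreal (q x))"
      by (simp add: distributed_def)
    then have "has_log_concave_density M' (X' k)"
      using q by (auto simp: has_log_concave_density_def)
    moreover have mean: "(\<integral>\<omega>. X' k \<omega> \<partial>M') = (\<integral>\<omega>. X k \<omega> \<partial>M)"
      by (subst int) (auto simp: X'T[OF k])
    moreover have "covariance_matrix M' (X' k) = covariance_matrix M (X k)"
      unfolding covariance_matrix_def mean by (subst int) (auto simp: X'T[OF k])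
    ultimately show ?thesis using X by simp
  qed
  ultimately have "isotropic_log_concave_vectors M' n X'"
    unfolding isotropic_log_concave_vectors_def using M'.prob_space_axioms by blast
  moreover have "distributed M' lborel (normalized_sum n X') (\<lambda>x. ennreal (p x))"
  proof -
    have "distr M' lborel (normalized_sum n X') = distr M lborel (normalized_sum n X)"
      using sum_m by (subst distr) (auto intro!: distr_cong simp: sumT)
    moreover have "normalized_sum n X' \<in> borel_measurable M'"
      using sum_m by (simp add: M'_def)
    ultimately show ?thesis using asm by (simp add: distributed_def)
  qed
  moreover have "symmetric_distribution M' (X' k)" if "symmetric_distribution M (X k)" and k: "k \<in> {1..n}" for k
  proof -
    have "distr M' borel (\<lambda>x. - X' k x) = distr M borel (\<lambda>\<omega>. - X k \<omega>)"
      by (subst distr) (auto intro!: distr_cong simp: X'T[OF k])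
    moreover have "distr M' borel (X' k) = distr M borel (X k)"
      by (subst distr) (auto intro!: distr_cong simp: X'T[OF k])
    ultimately show ?thesis using that(1) by (simp add: symmetric_distribution_def)
  qed
  ultimately show "density_distance p \<le> ereal (C / sqrt (real n)) \<and>
      ((\<forall>k\<in>{1..n}. symmetric_distribution M (X k)) \<longrightarrow> density_distance p \<le> ereal (C / real n))"
    using C n asm unfolding local_limit_constant_def by blast
qed

theorem corollary1p2:
  shows "(\<exists>C. local_limit_constant TYPE(nat \<Rightarrow> real ^ 'd) TYPE('d::finite) C) \<and>
         (\<forall>C. local_limit_constant TYPE(nat \<Rightarrow> real ^ 'd) TYPE('d) C \<longrightarrow>
              local_limit_constant TYPE('a) TYPE('d) C)"
  using ex_local_limit_constant local_limit_constant_transfer by blast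

end
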